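(* Suppose a combinatorial pentagonal tiling of the sphere has a vertex $\nu$ of degree $>3$ such that all vertices other than $\nu$ within distance $4$ of $\nu$ have degree $3$. Then the tiling is isomorphic to the earth map tiling $E_5(k)$ for some integer $k\ge 4$.
   Context: A combinatorial pentagonal tiling of the sphere is a finite graph (multiple edges are allowed a priori) embedded in the $2$-sphere, dividing the sphere into regions called tiles that are homeomorphic to the disk, such that the boundary of every tile is a simple closed path consisting of exactly five edges of the graph, and every vertex has degree $\ge 3$. The distance between two vertices is the number of edges in a shortest path in the graph connecting them. Two tilings are isomorphic if there is a homeomorphism of the sphere (possibly orientation reversing) carrying the graph of one onto the graph of the other (vertices to vertices, edges to edges). The earth map tiling $E_5(k)$ with distance $5$ between the poles ($k\ge 3$ an integer): it has two vertices $\nu,\sigma$ (the poles), each of degree $k$, and vertices $x_i,y_i,y'_i,z_i,z'_i,w_i$ of degree $3$, where $i\in\mathbb{Z}/k$. Its $4k$ tiles are the following pentagons, given by the cyclic sequence of their vertices, for $i\in\mathbb{Z}/k$ (tiles are glued along common edges): $$(\nu,x_i,y'_i,y_{i+1},x_{i+1}),\quad (x_i,y_i,z_i,z'_i,y'_i),\quad (y'_i,y_{i+1},z_{i+1},w_{i+1},z'_i),\quad (\sigma,w_i,z_i,z'_i,w_{i+1}).$$ Thus the edges are $\nu x_i,\ x_iy_i,\ x_iy'_i,\ y'_iy_{i+1},\ y_iz_i,\ y'_iz'_i,\ z_iz'_i,\ z_iw_i,\ z'_iw_{i+1},\ w_i\sigma$. *)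

theory Defs
  imports "HOL-Analysis.Analysis"
begin

section \<open>Graphs embedded in the 2-sphere\<close>

abbreviation S2 :: "(real^3) set" where
  "S2 \<equiv> sphere 0 1"

text \<open>
  A graph in the sphere is given by its vertices (points) and its edges (arcs, as point sets).
  Distinct edges may have the same two endpoints. There are no loops; in a pentagonal
  tiling this is no restriction, since every edge lies on the boundary of some tile and
  a simple closed path of five edges contains no loop.
\<close>

definition embedded_graph :: "(real^3) set \<Rightarrow> (real^3) set set \<Rightarrow> bool" where
  "embedded_graph V E \<longleftrightarrow>
     finite V \<and> finite E \<and> V \<subseteq> S2 \<and>
     (\<forall>e\<in>E. e \<subseteq> S2 \<and>
        (\<exists>g. arc g \<and> path_image g = e \<and> e \<inter> V = {pathstart g, pathfinish g})) \<and>
     (\<forall>e\<in>E. \<forall>f\<in>E. e \<noteq> f \<longrightarrow> e \<inter> f \<subseteq> V)"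

definition vertex_degree :: "(real^3) set set \<Rightarrow> real^3 \<Rightarrow> nat" where
  "vertex_degree E v = card {e \<in> E. v \<in> e}"

definition adjacency :: "(real^3) set \<Rightarrow> (real^3) set set \<Rightarrow> ((real^3) \<times> (real^3)) set" where
  "adjacency V E = {(u, v). \<exists>e\<in>E. e \<inter> V = {u, v}}"

text \<open>A pair in the \<open>n\<close>-th relational power of adjacency is joined by a walk with \<open>n\<close> edges;
  the distance is \<open>\<infinity>\<close> if there is no walk.\<close>

definition graph_dist :: "(real^3) set \<Rightarrow> (real^3) set set \<Rightarrow> real^3 \<Rightarrow> real^3 \<Rightarrow> enat" where
  "graph_dist V E u v = (INF n \<in> {n. (u, v) \<in> adjacency V E ^^ n}. enat n)"


section \<open>Pentagonal tilings\<close>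

text \<open>Regions are open in the sphere. The tile belonging to the region \<open>r\<close> is \<open>closure r\<close>,
  and its boundary is \<open>closure r - r\<close>.\<close>

definition regions :: "(real^3) set \<Rightarrow> (real^3) set set \<Rightarrow> (real^3) set set" where
  "regions V E = components (S2 - (V \<union> \<Union>E))"

text \<open>The boundary of the tile of \<open>r\<close> is a simple closed path running through the
  vertices \<open>vs\<close> in this cyclic order.\<close>

definition boundary_cycle ::
  "(real^3) set \<Rightarrow> (real^3) set set \<Rightarrow> (real^3) set \<Rightarrow> (real^3) list \<Rightarrow> bool" where
  "boundary_cycle V E r vs \<longleftrightarrow>
     distinct vs \<and> set vs \<subseteq> V \<and>
     (\<exists>es. length es = length vs \<and> distinct es \<and> set es \<subseteq> E \<and>
        (\<forall>i<length vs. es ! i \<inter> V = {vs ! i, vs ! ((i + 1) mod length vs)}) \<and>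
        closure r - r = \<Union>(set es))"

definition pentagonal_tiling :: "(real^3) set \<Rightarrow> (real^3) set set \<Rightarrow> bool" where
  "pentagonal_tiling V E \<longleftrightarrow>
     embedded_graph V E \<and>
     (\<forall>r \<in> regions V E. closure r homeomorphic cball (0::real^2) 1 \<and>
        (\<exists>vs. length vs = 5 \<and> boundary_cycle V E r vs)) \<and>
     (\<forall>v\<in>V. vertex_degree E v \<ge> 3)"

definition tiling_isomorphic ::
  "(real^3) set \<Rightarrow> (real^3) set set \<Rightarrow> (real^3) set \<Rightarrow> (real^3) set set \<Rightarrow> bool" where
  "tiling_isomorphic V E V' E' \<longleftrightarrow>
     (\<exists>h h'. homeomorphism S2 S2 h h' \<and> h ` V = V' \<and> (\<lambda>e. h ` e) ` E = E')"


section \<open>The earth map tilings with distance 5 between the poles\<close>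

text \<open>Indices range over \<open>{..<k}\<close> and are added modulo \<open>k\<close>.\<close>

datatype earth_vertex =
  North_Pole | South_Pole | VX nat | VY nat | VY' nat | VZ nat | VZ' nat | VW nat

definition earth_vertices :: "nat \<Rightarrow> earth_vertex set" where
  "earth_vertices k =
     {North_Pole, South_Pole} \<union> (\<Union>i<k. {VX i, VY i, VY' i, VZ i, VZ' i, VW i})"

definition earth_edges :: "nat \<Rightarrow> earth_vertex set set" where
  "earth_edges k =
     (\<Union>i<k. let j = (i + 1) mod k in
        {{North_Pole, VX i}, {VX i, VY i}, {VX i, VY' i}, {VY' i, VY j}, {VY i, VZ i},
         {VY' i, VZ' i}, {VZ i, VZ' i}, {VZ i, VW i}, {VZ' i, VW j}, {VW i, South_Pole}})"

definition earth_pentagons :: "nat \<Rightarrow> earth_vertex list set" where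
  "earth_pentagons k =
     (\<Union>i<k. let j = (i + 1) mod k in
        {[North_Pole, VX i, VY' i, VY j, VX j],
         [VX i, VY i, VZ i, VZ' i, VY' i],
         [VY' i, VY j, VZ j, VW j, VZ' i],
         [South_Pole, VW i, VZ i, VZ' i, VW j]})"

text \<open>The graph \<open>V\<close>, \<open>E\<close> is a realisation of the earth map tiling in the sphere: \<open>\<phi>\<close> places
  the vertices, and \<open>\<psi>\<close> assigns to each of the \<open>4 * k\<close> pentagons its region.\<close>

definition earth_map_tiling :: "nat \<Rightarrow> (real^3) set \<Rightarrow> (real^3) set set \<Rightarrow> bool" where
  "earth_map_tiling k V E \<longleftrightarrow>
     k \<ge> 3 \<and> pentagonal_tiling V E \<and>
     (\<exists>\<phi> \<psi>. bij_betw \<phi> (earth_vertices k) V \<and>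
        bij_betw (\<lambda>e. e \<inter> V) E ((\<lambda>d. \<phi> ` d) ` earth_edges k) \<and>
        bij_betw \<psi> (earth_pentagons k) (regions V E) \<and>
        (\<forall>p \<in> earth_pentagons k. boundary_cycle V E (\<psi> p) (map \<phi> p)))"

end

(*
  In the plane, an edge that is crossed changes the winding number of a closed walk by the number of
  times the walk runs through it.  For the boundaries of the tiles this shows that every edge lies in
  exactly two tiles, which can be oriented coherently; so the tiling is described by its darts
  (directed edges) with the permutations "next dart around the tile" and "reversed dart".  For walks of
  length 3 it shows that two such walks at the vertex nu do not cross.

  Starting with the k tiles at nu, the degrees force the 4k tiles of the earth map tiling one after
  another, as long as no vertex met on the way is nu again.  If one is, then some tile in the list is a
  tile at nu, which yields a chord joining two edges at nu.  Chords do not cross, and from a shortest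
  chord the forced neighbours produce a strictly shorter one.  The same propagation, now without any
  planarity, excludes that w_i or the south pole is nu.

  The labelling obtained is a covering of the tiling by the earth map with a single point over nu,
  hence bijective.  Two tilings with the same combinatorics are homeomorphic: map edges to edges and
  extend over each tile by coning.
*)

theory Submission
  imports Defs "HOL-Complex_Analysis.Winding_Numbers"
begin

section \<open>Maps with pentagonal faces\<close>

text \<open>The degree hypothesis is silent about \<open>\<nu>\<close> itself, so the rotation at a
  newly met vertex can be closed only once that vertex is known to differ from \<open>\<nu>\<close>.
  This governs the order of the argument. The vertices x, y, y' lie on tiles at
  \<open>\<nu>\<close>; z, z', w and the south pole need not. The bound 4 on the distance is what
  the vertices w require. The degree of the south pole is never prescribed; it is fixed by the final
  bijection. For z and z' there is a circularity: an identification of two tiles spreads only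
  through vertices already known to differ from \<open>\<nu>\<close>. A shortest chord breaks the
  circle, because any further coincidence inside its arc would be a shorter chord. The spread moves
  each end of the chord inward by three, and a gap too small for that would make some tile its own
  neighbour. Once all z and z' are safe, an induction on an integer gap settles w and the south
  pole. Orientations are fixed by jumps of winding numbers, not by their values, so the tile that
  becomes unbounded under projection needs no special treatment.\<close>

lemma not_injE:
  fixes f :: "nat \<Rightarrow> 'a"
  assumes "\<not> inj f"
  obtains i j where "i < j" "f i = f j"
proof -
  from assms obtain i j where "i \<noteq> j" "f i = f j" by (auto simp: inj_def)
  then show thesis using that[of i j] that[of j i] by (cases "i < j") auto
qed

text \<open>In terms of darts: \<open>n\<close> is the next dart around the face on a fixed side, \<open>a\<close> the reversed dart.
  The function \<open>c\<close> of \<open>cut\<close> stands for the winding number of a closed walk around the faces.\<close>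

locale pentagonal_map =
  fixes D :: "'d set" and n a :: "'d \<Rightarrow> 'd" and org :: "'d \<Rightarrow> 'v"
  assumes finite_D: "finite D"
    and n_D: "d \<in> D \<Longrightarrow> n d \<in> D"
    and a_D: "d \<in> D \<Longrightarrow> a d \<in> D"
    and n5: "d \<in> D \<Longrightarrow> n (n (n (n (n d)))) = d"
    and a_a: "d \<in> D \<Longrightarrow> a (a d) = d"
    and org_a: "d \<in> D \<Longrightarrow> org (a d) = org (n d)"
    and org_distinct: "d \<in> D \<Longrightarrow>
      distinct [org d, org (n d), org (n (n d)), org (n (n (n d))), org (n (n (n (n d))))]"
    and link: "d \<in> D \<Longrightarrow> d' \<in> D \<Longrightarrow> org d = org d' \<Longrightarrow> \<exists>m. ((\<lambda>d. n (a d)) ^^ m) d = d'"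
    and conn: "S \<subseteq> D \<Longrightarrow> S \<noteq> {} \<Longrightarrow> (\<And>d. d \<in> S \<Longrightarrow> n d \<in> S) \<Longrightarrow> (\<And>d. d \<in> S \<Longrightarrow> a d \<in> S) \<Longrightarrow> S = D"
    and cut: "d0 \<in> D \<Longrightarrow> d1 \<in> D \<Longrightarrow> d2 \<in> D \<Longrightarrow> org (n d0) = org d1 \<Longrightarrow> org (n d1) = org d2 \<Longrightarrow>
      org (n d2) = org d0 \<Longrightarrow> \<exists>c :: 'd \<Rightarrow> int. \<forall>d \<in> D. c (n d) = c d \<and>
        c d - c (a d) = int (count_list [d0, d1, d2] d) - int (count_list [d0, d1, d2] (a d))"
begin

definition rot :: "'d \<Rightarrow> 'd" where "rot d = n (a d)"

lemma rot_D: "d \<in> D \<Longrightarrow> rot d \<in> D"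
  by (simp add: rot_def n_D a_D)

lemma n_inj: "d \<in> D \<Longrightarrow> e \<in> D \<Longrightarrow> n d = n e \<Longrightarrow> d = e"
  by (metis n5)

lemma a_inj: "d \<in> D \<Longrightarrow> e \<in> D \<Longrightarrow> a d = a e \<Longrightarrow> d = e"
  by (metis a_a)

lemma rot_inj: "d \<in> D \<Longrightarrow> e \<in> D \<Longrightarrow> rot d = rot e \<Longrightarrow> d = e"
  by (metis a_D a_inj n_inj rot_def)

lemma org_rot: "d \<in> D \<Longrightarrow> org (rot d) = org d"
  by (metis a_D a_a org_a rot_def)

lemma rot_pow_D: "d \<in> D \<Longrightarrow> (rot ^^ m) d \<in> D"
  by (induction m) (auto simp: rot_D)

lemma org_rot_pow: "d \<in> D \<Longrightarrow> org ((rot ^^ m) d) = org d"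
  by (induction m) (auto simp: rot_pow_D org_rot)

lemma rot_pow_inj: "d \<in> D \<Longrightarrow> e \<in> D \<Longrightarrow> (rot ^^ m) d = (rot ^^ m) e \<Longrightarrow> d = e"
proof (induction m)
  case (Suc m)
  then show ?case using rot_inj[of "(rot ^^ m) d" "(rot ^^ m) e"] rot_pow_D by simp
qed simp

lemma rot_link: "d \<in> D \<Longrightarrow> d' \<in> D \<Longrightarrow> org d = org d' \<Longrightarrow> \<exists>m. (rot ^^ m) d = d'"
proof -
  have r: "rot = (\<lambda>d. n (a d))" by (rule ext) (rule rot_def)
  show "d \<in> D \<Longrightarrow> d' \<in> D \<Longrightarrow> org d = org d' \<Longrightarrow> \<exists>m. (rot ^^ m) d = d'" unfolding r by (rule link)
qed

lemma fibre:
  assumes d: "d \<in> D"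
  shows "{d' \<in> D. org d' = org d} = range (\<lambda>m. (rot ^^ m) d)"
proof (intro set_eqI iffI)
  fix x assume "x \<in> {d' \<in> D. org d' = org d}"
  then have "x \<in> D" "org d = org x" by simp_all
  from rot_link[OF d this] show "x \<in> range (\<lambda>m. (rot ^^ m) d)" by (metis rangeI)
next
  fix x assume "x \<in> range (\<lambda>m. (rot ^^ m) d)"
  then show "x \<in> {d' \<in> D. org d' = org d}" using rot_pow_D[OF d] org_rot_pow[OF d] by (metis (mono_tags, lifting) imageE mem_Collect_eq)
qed

text \<open>The first return time \<open>p\<close> of \<open>d\<close> gives \<open>p\<close>
  different iterates; reducing exponents modulo \<open>p\<close> shows that they exhaust the orbit,
  which by \<open>fibre\<close> is the set of all darts at the vertex. So \<open>p\<close> is the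
  degree.\<close>

lemma rot_period:
  assumes d: "d \<in> D" and k: "k = card {d' \<in> D. org d' = org d}"
  shows "k > 0" "(rot ^^ k) d = d" "inj_on (\<lambda>m. (rot ^^ m) d) {..<k}"
proof -
  let ?f = "\<lambda>m. (rot ^^ m) d"
  have fin: "finite (range ?f)"
    using finite_D fibre[OF d, symmetric] by simp
  have "\<not> inj ?f"
  proof
    assume "inj ?f"
    with fin have "finite (UNIV :: nat set)" by (rule finite_imageD)
    then show False by simp
  qed
  then obtain i j where "i < j" "?f i = ?f j"
    by (rule not_injE)
  then have "(rot ^^ i) (?f (j - i)) = (rot ^^ i) d"
    using funpow_add[of i "j - i" rot, THEN fun_cong, of d] by simp
  then have "?f (j - i) = d"
    by (rule rot_pow_inj[rotated 2]) (auto simp: d rot_pow_D)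
  then have ex: "\<exists>p. p > 0 \<and> ?f p = d" using \<open>i < j\<close> by (intro exI[of _ "j - i"]) auto
  define p where "p = (LEAST p. p > 0 \<and> ?f p = d)"
  have p: "p > 0" "?f p = d" using LeastI_ex[OF ex] unfolding p_def by auto
  have inj: "inj_on ?f {..<p}"
  proof (rule linorder_inj_onI)
    fix i j assume ij: "i < j" "i \<in> {..<p}" "j \<in> {..<p}"
    show "?f i \<noteq> ?f j"
    proof
      assume "?f i = ?f j"
      then have "(rot ^^ i) (?f (j - i)) = (rot ^^ i) d"
        using ij(1) funpow_add[of i "j - i" rot, THEN fun_cong, of d] by simp
      then have "?f (j - i) = d"
        by (rule rot_pow_inj[rotated 2]) (auto simp: d rot_pow_D)
      then have "p \<le> j - i" unfolding p_def using ij(1) by (intro Least_le) auto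
      then show False using ij by auto
    qed
  qed auto
  have m: "?f m = ?f (m mod p)" for m
    using funpow_mod_eq[OF p(2)] by simp
  have "range ?f = ?f ` {..<p}"
  proof safe
    fix m show "?f m \<in> ?f ` {..<p}" using m[of m] p(1) by auto
  qed auto
  then have "k = p" using card_image[OF inj] fibre[OF d] k by simp
  then show "k > 0" "?f k = d" "inj_on ?f {..<k}" using p inj by auto
qed

text \<open>\<open>a d\<close> starts where \<open>n d\<close> starts, so within the tile of
  \<open>d\<close> it could only be \<open>n d\<close>; but it ends at the origin of
  \<open>d\<close>, and \<open>n (n d)\<close> does not start there. No tile is its own neighbour:
  this refutes the degenerate gluings below.\<close>

lemma a_neq_face: "d \<in> D \<Longrightarrow> a d \<noteq> d \<and> a d \<noteq> n d \<and> a d \<noteq> n (n d) \<and> a d \<noteq> n (n (n d)) \<and> a d \<noteq> n (n (n (n d)))"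
  using org_a[of d] org_distinct[of d] org_a[of "a d"] a_a[of d] a_D[of d] n5[of d] by auto

lemma n_neq_face: "d \<in> D \<Longrightarrow> n d \<noteq> d \<and> n (n d) \<noteq> d \<and> n (n (n d)) \<noteq> d \<and> n (n (n (n d))) \<noteq> d"
  using org_distinct[of d] by auto

end

section \<open>Forced gluings around a vertex of large degree\<close>

locale earthlike = pentagonal_map D n a org
  for D :: "'d set" and n a :: "'d \<Rightarrow> 'd" and org :: "'d \<Rightarrow> 'v" +
  fixes t0 :: 'd and k :: nat
  assumes t0: "t0 \<in> D" and k: "k = card {d \<in> D. org d = org t0}"
    and deg3: "d \<in> D \<Longrightarrow> org d \<noteq> org t0 \<Longrightarrow>
      (org t0, org d) \<in> {(org e, org (n e)) | e. e \<in> D} ^^ m \<Longrightarrow> m \<le> 4 \<Longrightarrow>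
      card {d' \<in> D. org d' = org d} = 3"
begin

abbreviation \<nu> :: 'v where "\<nu> \<equiv> org t0"

text \<open>The tiles \<open>T i = (\<nu>, x\<^sub>i, y'\<^sub>i, y\<^sub>i\<^sub>+\<^sub>1, x\<^sub>i\<^sub>+\<^sub>1)\<close>, \<open>N i = (x\<^sub>i, y\<^sub>i, z\<^sub>i, z'\<^sub>i, y'\<^sub>i)\<close>,
  \<open>P i = (y\<^sub>i\<^sub>+\<^sub>1, y'\<^sub>i, z'\<^sub>i, w\<^sub>i\<^sub>+\<^sub>1, z\<^sub>i\<^sub>+\<^sub>1)\<close> and \<open>Q i = (\<sigma>, w\<^sub>i\<^sub>+\<^sub>1, z'\<^sub>i, z\<^sub>i, w\<^sub>i)\<close>, all listed in the direction of \<open>n\<close>;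
  the second argument selects the dart.\<close>

definition T :: "int \<Rightarrow> nat \<Rightarrow> 'd" where
  "T i m = (n ^^ m) ((rot ^^ nat ((- i) mod int k)) t0)"

definition N :: "int \<Rightarrow> nat \<Rightarrow> 'd" where
  "N i m = (n ^^ m) (a (T (i - 1) 3))"

definition P :: "int \<Rightarrow> nat \<Rightarrow> 'd" where
  "P i m = (n ^^ m) (a (T i 2))"

definition Q :: "int \<Rightarrow> nat \<Rightarrow> 'd" where
  "Q i m = (n ^^ m) (n (n (n (a (N i 2)))))"

lemma n_pow_D: "d \<in> D \<Longrightarrow> (n ^^ m) d \<in> D"
  by (induction m) (auto simp: n_D)

lemma face_D [simp]: "T i m \<in> D" "N i m \<in> D" "P i m \<in> D" "Q i m \<in> D"
  unfolding T_def N_def P_def Q_def by (intro n_pow_D n_D a_D rot_pow_D t0)+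

lemma n_pow_simps: "d \<in> D \<Longrightarrow> n ((n ^^ 0) d) = (n ^^ 1) d \<and> n ((n ^^ 1) d) = (n ^^ 2) d \<and>
  n ((n ^^ 2) d) = (n ^^ 3) d \<and> n ((n ^^ 3) d) = (n ^^ 4) d \<and> n ((n ^^ 4) d) = (n ^^ 0) d"
  by (simp add: n5 numeral_2_eq_2 numeral_3_eq_3 numeral_Bit0)

lemma n_T [simp]: "n (T i 0) = T i 1" "n (T i (Suc 0)) = T i 2" "n (T i 2) = T i 3" "n (T i 3) = T i 4" "n (T i 4) = T i 0"
  using n_pow_simps[OF rot_pow_D[OF t0]] by (simp_all add: T_def)

lemma n_N [simp]: "n (N i 0) = N i 1" "n (N i (Suc 0)) = N i 2" "n (N i 2) = N i 3" "n (N i 3) = N i 4" "n (N i 4) = N i 0"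
  using n_pow_simps[OF a_D[OF face_D(1)[of "i - 1" 3]]] by (simp_all add: N_def)

lemma n_P [simp]: "n (P i 0) = P i 1" "n (P i (Suc 0)) = P i 2" "n (P i 2) = P i 3" "n (P i 3) = P i 4" "n (P i 4) = P i 0"
  using n_pow_simps[OF a_D[OF face_D(1)[of "i" 2]]] by (simp_all add: P_def)

lemma n_Q [simp]: "n (Q i 0) = Q i 1" "n (Q i (Suc 0)) = Q i 2" "n (Q i 2) = Q i 3" "n (Q i 3) = Q i 4" "n (Q i 4) = Q i 0"
  using n_pow_simps[OF n_D[OF n_D[OF n_D[OF a_D[OF face_D(2)[of "i" 2]]]]]] by (simp_all add: Q_def)

lemma k_pos: "k > 0"
  using rot_period(1)[OF t0 k] .

lemma T_periodic: "T (i + int k * j) m = T i m"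
proof -
  have "(- (i + int k * j)) mod int k = (- i) mod int k"
    by (metis minus_add_distrib mod_mult_self2 mult_minus_right)
  then show ?thesis by (simp add: T_def)
qed

lemma T0_eq_iff: "T i 0 = T j 0 \<longleftrightarrow> i mod int k = j mod int k"
proof -
  have kk: "int k > 0" using k_pos by simp
  have "T i 0 = T j 0 \<longleftrightarrow> nat ((- i) mod int k) = nat ((- j) mod int k)"
    unfolding T_def using inj_on_eq_iff[OF rot_period(3)[OF t0 k], of "nat ((- i) mod int k)" "nat ((- j) mod int k)"] kk
    by (simp add: nat_less_iff)
  also have "\<dots> \<longleftrightarrow> (- i) mod int k = (- j) mod int k"
    using kk by (intro eq_nat_nat_iff) simp_all
  also have "\<dots> \<longleftrightarrow> i mod int k = j mod int k"
    by (metis add.inverse_inverse mod_minus_cong)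
  finally show ?thesis .
qed

text \<open>The last side of tile i, reversed, is the first side of tile i + 1. Hence
  \<open>rot\<close> lowers the index, which is why \<open>T\<close> uses the exponent
  \<open>- i\<close>.\<close>

lemma rot_T: "rot (T (i + 1) 0) = T i 0"
proof -
  have kk: "int k > 0" using k_pos by simp
  let ?x = "nat ((- (i + 1)) mod int k)"
  have "rot (T (i + 1) 0) = (rot ^^ Suc ?x) t0" by (simp add: T_def)
  also have "\<dots> = (rot ^^ (Suc ?x mod k)) t0"
    by (rule funpow_mod_eq[symmetric]) (rule rot_period(2)[OF t0 k])
  also have "int (Suc ?x mod k) = (- i) mod int k"
  proof -
    have "int (Suc ?x mod k) = ((- (i + 1)) mod int k + 1) mod int k"
      using kk by (simp add: zmod_int add.commute)
    also have "\<dots> = (- (i + 1) + 1) mod int k" by (rule mod_add_left_eq)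
    finally show ?thesis by simp
  qed
  then have "Suc ?x mod k = nat ((- i) mod int k)" by linarith
  finally show ?thesis by (simp add: T_def)
qed

lemma org_T0 [simp]: "org (T i 0) = \<nu>"
  by (simp add: T_def org_rot_pow t0)

text \<open>The window of k consecutive indices may start anywhere. The chord arguments place its
  start at one end of the chord, so that positions on the cycle can be compared as integers.\<close>

lemma org_eq_nuE:
  assumes "d \<in> D" "org d = \<nu>"
  obtains q where "l \<le> q" "q < l + int k" "d = T q 0"
proof -
  have "d \<in> {d \<in> D. org d = \<nu>}" using assms by simp
  then obtain m where m: "d = (rot ^^ m) t0" using fibre[OF t0] by auto
  have kk: "int k > 0" using k_pos by simp
  have "d = T (- int m) 0"
    using funpow_mod_eq[OF rot_period(2)[OF t0 k], of m] m by (simp add: T_def nat_mod_as_int)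
  moreover define q where "q = l + (- int m - l) mod int k"
  have "q mod int k = (- int m) mod int k" unfolding q_def by (simp add: mod_simps)
  then have "T q 0 = T (- int m) 0" by (simp add: T0_eq_iff)
  ultimately have "d = T q 0" by simp
  moreover have "l \<le> q" "q < l + int k" using kk by (simp_all add: q_def)
  ultimately show thesis using that by blast
qed

lemma a_T0 [simp]: "a (T i 0) = T (i - 1) 4"
proof -
  have "n (a (T i 0)) = n (T (i - 1) 4)"
    using rot_T[of "i - 1"] by (simp add: rot_def)
  then show ?thesis by (rule n_inj[rotated 2]) (simp_all add: a_D)
qed

lemma a_T2 [simp]: "a (T i 2) = P i 0" by (simp add: P_def)
lemma a_T3 [simp]: "a (T i 3) = N (i + 1) 0" by (simp add: N_def)
lemma a_T4 [simp]: "a (T i 4) = T (i + 1) 0"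
proof -
  have "a (T (i + 1) 0) = T i 4" using a_T0[of "i + 1"] by simp
  from a_a[OF face_D(1)[of "i + 1" 0], unfolded this] show ?thesis .
qed
lemma a_P0 [simp]: "a (P i 0) = T i 2"
  using a_a[OF face_D(1)[of i 2]] by simp
lemma a_N0 [simp]: "a (N i 0) = T (i - 1) 3"
  using a_a[OF face_D(1)[of "i - 1" 3]] by simp
lemma a_N2 [simp]: "a (N i 2) = Q i 2"
proof -
  \<comment> \<open>The three steps in the definition of \<open>Q\<close> lead from
    \<open>a (N i 2)\<close> to dart 0; two more complete the turn around the tile.\<close>
  have "Q i 2 = n (n (n (n (n (a (N i 2))))))" by (simp add: Q_def numeral_2_eq_2)
  then show ?thesis by (simp add: n5 a_D)
qed
lemma a_Q2 [simp]: "a (Q i 2) = N i 2"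
  using a_a[OF face_D(2)[of i 2]] by simp

definition near :: "nat \<Rightarrow> 'v set" where
  "near m = {v. \<exists>j\<le>m. (\<nu>, v) \<in> {(org e, org (n e)) | e. e \<in> D} ^^ j}"

lemma near_0: "\<nu> \<in> near 0" by (simp add: near_def)

lemma near_step:
  assumes "org e \<in> near m" "e \<in> D" "Suc m = m'"
  shows "org (n e) \<in> near m'"
proof -
  from assms obtain j where j: "j \<le> m" "(\<nu>, org e) \<in> {(org e, org (n e)) | e. e \<in> D} ^^ j" by (auto simp: near_def)
  have "(org e, org (n e)) \<in> {(org e, org (n e)) | e. e \<in> D}" using \<open>e \<in> D\<close> by blast
  with j(2) have "(\<nu>, org (n e)) \<in> {(org e, org (n e)) | e. e \<in> D} ^^ Suc j" by (rule relpow_Suc_I)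
  then show ?thesis using j(1) assms(3) unfolding near_def by (intro CollectI exI[of _ "Suc j"] conjI) simp_all
qed

lemma rot3:
  assumes "d \<in> D" "org d \<noteq> \<nu>" "org d \<in> near 4"
  shows "rot (rot (rot d)) = d"
proof -
  from assms(3) obtain j where "j \<le> 4" "(\<nu>, org d) \<in> {(org e, org (n e)) | e. e \<in> D} ^^ j" by (auto simp: near_def)
  then have "card {d' \<in> D. org d' = org d} = 3" using deg3[OF assms(1,2)] by blast
  from rot_period(2)[OF assms(1) this[symmetric]] show ?thesis by (simp add: numeral_3_eq_3)
qed

lemma near_mono: "m \<le> m' \<Longrightarrow> near m \<subseteq> near m'"
  by (auto simp: near_def intro: order_trans)

lemma org_a_back: "d \<in> D \<Longrightarrow> org (n (a d)) = org d"
  using org_rot by (simp add: rot_def)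

lemma T_neq: "org (T i (Suc 0)) \<noteq> \<nu>" "org (T i 2) \<noteq> \<nu>" "org (T i 3) \<noteq> \<nu>" "org (T i 4) \<noteq> \<nu>"
  using org_distinct[OF face_D(1)[of i 0]] by auto

lemma near_T: "org (T i (Suc 0)) \<in> near 1" "org (T i 2) \<in> near 2" "org (T i 3) \<in> near 2" "org (T i 4) \<in> near 1"
proof -
  have 1: "org (T i (Suc 0)) \<in> near 1" for i using near_step[of "T i 0" 0 1] near_0 by simp
  then show "org (T i (Suc 0)) \<in> near 1" by simp
  show "org (T i 2) \<in> near 2" using near_step[of "T i 1" 1 2] 1[of i] by simp
  have 4: "org (T i 4) = org (T (i + 1) 1)" using org_a[of "T (i + 1) 0"] by simp
  then show "org (T i 4) \<in> near 1" using 1 by simp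
  have "org (T i 3) = org (n (N (i + 1) 0))" using org_a_back[of "T i 3"] by simp
  moreover have "org (N (i + 1) 0) = org (T i 4)" using org_a[of "T i 3"] by simp
  ultimately show "org (T i 3) \<in> near 2" using near_step[of "N (i + 1) 0" 1 2] 4 1[of "i+1"] by simp
qed

text \<open>The propagation step. At a vertex of degree 3, two known gluings give the three darts in
  rotational order; the third quarter of information, that the rotation returns to its start, says
  which dart is glued to \<open>f\<close>.\<close>

lemma rot3_close:
  assumes "rot d = e" "rot e = f" "d \<in> D" "org d \<noteq> \<nu>" "org d \<in> near m" "m \<le> 4" "g \<in> D" "n g = d"
  shows "a f = g" "a g = f"
proof -
  have "rot (rot (rot d)) = d" using assms near_mono[of m 4] by (intro rot3) auto
  then have "n (a f) = n g" using assms by (simp add: rot_def)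
  moreover have "f \<in> D" using assms rot_D by blast
  ultimately show "a f = g" using assms n_inj[of "a f" g] by (simp add: a_D)
  then show "a g = f" using a_a[OF \<open>f \<in> D\<close>] by simp
qed

lemma org_N0: "org (N i 0) = org (T (i - 1) 4)"
  using org_a[of "T (i - 1) 3"] by simp

text \<open>The rotation at x_i runs through \<open>N i 0\<close>, \<open>T (i - 1) 4\<close>,
  \<open>T i 1\<close>, and closing it glues the edge x_i y'_i. The next two gluings arise in the
  same way at y'_i and y_{i+1}. All these vertices lie on tiles at \<open>\<nu>\<close> and
  therefore differ from it.\<close>

lemma a_T1 [simp]: "a (T i (Suc 0)) = N i 4" and a_N4 [simp]: "a (N i 4) = T i 1"
proof -
  have "rot (N i 0) = T (i - 1) 4" "rot (T (i - 1) 4) = T i 1" by (simp_all add: rot_def)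
  from rot3_close[OF this, of 1 "N i 4"] show "a (T i (Suc 0)) = N i 4" "a (N i 4) = T i 1"
    using T_neq near_T by (simp_all add: org_N0)
qed

lemma a_P1 [simp]: "a (P i (Suc 0)) = N i 3" and a_N3 [simp]: "a (N i 3) = P i 1"
proof -
  have 1: "rot (N i 4) = T i 2" "rot (T i 2) = P i 1" by (simp_all add: rot_def)
  have "org (N i 4) = org (T i 2)" using org_rot[of "N i 4"] 1 by simp
  with rot3_close[OF 1, of 2 "N i 3"] show "a (P i (Suc 0)) = N i 3" "a (N i 3) = P i 1"
    using T_neq near_T by simp_all
qed

lemma org_P0: "org (P i 0) = org (T i 3)"
  using org_rot[of "P i 0"] by (simp add: rot_def)

lemma a_P4 [simp]: "a (P i 4) = N (i + 1) 1" and a_N1': "a (N (i + 1) 1) = P i 4"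
proof -
  have 1: "rot (P i 0) = T i 3" "rot (T i 3) = N (i + 1) 1" by (simp_all add: rot_def)
  from rot3_close[OF 1, of 2 "P i 4"] show "a (P i 4) = N (i + 1) 1" "a (N (i + 1) 1) = P i 4"
    using T_neq near_T by (simp_all add: org_P0)
qed

lemma a_N1 [simp]: "a (N i (Suc 0)) = P (i - 1) 4"
  using a_N1'[of "i - 1"] by simp

abbreviation z :: "int \<Rightarrow> 'v" where "z i \<equiv> org (N i 2)"
abbreviation z' :: "int \<Rightarrow> 'v" where "z' i \<equiv> org (N i 3)"
abbreviation w :: "int \<Rightarrow> 'v" where "w i \<equiv> org (P (i - 1) 3)"

lemma near_z: "z i \<in> near 3"
  using near_step[of "N i 1" 2 3] near_T(3)[of "i - 1"] org_rot[of "T (i - 1) 3"] by (simp add: rot_def)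

lemma near_z': "z' i \<in> near 3"
  using near_step[of "P i 1" 2 3] near_T(2)[of i] org_rot[of "T i 2"] org_a[of "P i 1"]
  by (simp add: rot_def)

text \<open>From here on the vertex whose rotation is closed need not lie on a tile named
  \<open>T\<close>, so that it differs from \<open>\<nu>\<close> has to be assumed for the time
  being.\<close>

lemma a_P2: "z' i \<noteq> \<nu> \<Longrightarrow> a (P i 2) = Q i 1" and a_Q1: "z' i \<noteq> \<nu> \<Longrightarrow> a (Q i (Suc 0)) = P i 2"
proof -
  have 1: "rot (Q i 2) = N i 3" "rot (N i 3) = P i 2" by (simp_all add: rot_def)
  have 2: "org (Q i 2) = z' i" using org_rot[of "Q i 2"] 1 by simp
  assume "z' i \<noteq> \<nu>"
  with rot3_close[OF 1, of 3 "Q i 1"] show "a (P i 2) = Q i 1" "a (Q i (Suc 0)) = P i 2"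
    using near_z'[of i] 2 by simp_all
qed

lemma org_P4: "org (P (i - 1) 4) = z i"
  using org_a[of "N i 1"] by simp

lemma a_Q3: "z i \<noteq> \<nu> \<Longrightarrow> a (Q i 3) = P (i - 1) 3" and a_P3: "z i \<noteq> \<nu> \<Longrightarrow> a (P (i - 1) 3) = Q i 3"
proof -
  have 1: "rot (P (i - 1) 4) = N i 2" "rot (N i 2) = Q i 3" by (simp_all add: rot_def)
  assume "z i \<noteq> \<nu>"
  with rot3_close[OF 1, of 3 "P (i - 1) 3"] show "a (Q i 3) = P (i - 1) 3" "a (P (i - 1) 3) = Q i 3"
    using near_z[of i] by (simp_all add: org_P4)
qed

text \<open>The last step, from z_i to w_i, reaches distance 4, the largest that \<open>deg3\<close>
  admits.\<close>

lemma near_w: "z i \<noteq> \<nu> \<Longrightarrow> w i \<in> near 4"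
  using near_step[of "Q i 3" 3 4] near_z[of i] org_rot[of "N i 2"] org_a[of "Q i 3"]
  by (simp add: rot_def a_Q3 a_P3)

text \<open>The rotation at w_i glues consecutive tiles along an edge ending at the south pole. The
  ring of tiles around that pole is thus obtained from the vertices w alone.\<close>

lemma a_Q4:
  assumes "z i \<noteq> \<nu>" "z' (i - 1) \<noteq> \<nu>" "w i \<noteq> \<nu>"
  shows "a (Q i 4) = Q (i - 1) 0" "a (Q (i - 1) 0) = Q i 4"
proof -
  have 1: "rot (Q (i - 1) 1) = P (i - 1) 3" "rot (P (i - 1) 3) = Q i 4"
    using assms by (simp_all add: rot_def a_Q1 a_P3)
  have "org (Q (i - 1) 1) = w i" using org_rot[of "Q (i - 1) 1"] 1 by simp
  with rot3_close[OF 1, of 4 "Q (i - 1) 0"] show "a (Q i 4) = Q (i - 1) 0" "a (Q (i - 1) 0) = Q i 4"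
    using near_w assms by simp_all
qed

text \<open>Coincidence of two darts spreads to all of their tile and across all its edges. Each use
  below simplifies these equations with the gluing rules and then picks the one that carries the
  identification further.\<close>

lemma step:
  assumes "x = y"
  shows "n x = n y \<and> n (n x) = n (n y) \<and> n (n (n x)) = n (n (n y)) \<and> n (n (n (n x))) = n (n (n (n y))) \<and>
    a x = a y \<and> a (n x) = a (n y) \<and> a (n (n x)) = a (n (n y)) \<and> a (n (n (n x))) = a (n (n (n y))) \<and>
    a (n (n (n (n x)))) = a (n (n (n (n y))))"
  using assms by simp

end

text \<open>In one period starting at \<open>i\<close> the classes of \<open>i\<close> and
  \<open>j\<close> are met once each, so \<open>g\<close> rises once and falls once. For winding
  numbers of the tiles around \<open>\<nu>\<close> this describes the two sides of a chord.\<close>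

lemma of_bool_arcs:
  fixes g :: "int \<Rightarrow> int" and k :: int
  assumes g: "\<And>p. g p - g (p - 1) = of_bool (p mod k = i mod k) - of_bool (p mod k = j mod k)"
    and ij: "i < j" "j < i + k"
  shows "i \<le> p \<Longrightarrow> p < i + k \<Longrightarrow> g p = g (i - 1) + of_bool (p < j)"
proof (induction p rule: int_ge_induct)
  have neq: "p mod k \<noteq> q mod k" if "p < q" "q < p + k" for p q
  proof
    assume "p mod k = q mod k"
    then have "k dvd q - p" by (metis mod_eq_dvd_iff)
    then show False using that zdvd_imp_le[of k "q - p"] by auto
  qed
  case base
  then show ?case using g[of i] ij neq[of i j] by simp
next
  case (step p)
  have neq: "p mod k \<noteq> q mod k" if "p < q" "q < p + k" for p q
  proof
    assume "p mod k = q mod k"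
    then have "k dvd q - p" by (metis mod_eq_dvd_iff)
    then show False using that zdvd_imp_le[of k "q - p"] by auto
  qed
  have "(p + 1) mod k \<noteq> i mod k" using neq[of i "p + 1"] step by simp
  moreover have "(p + 1) mod k = j mod k \<longleftrightarrow> p + 1 = j"
    using neq[of "p + 1" j] neq[of j "p + 1"] step ij by (cases "p + 1" j rule: linorder_cases) auto
  ultimately have "g (p + 1) - g p = - of_bool (p + 1 = j)" using g[of "p + 1"] by simp
  then show ?case using step by (cases "p + 1 = j") auto
qed

section \<open>Chords at the pole do not exist\<close>

context earthlike
begin

text \<open>Only position 0 starts at \<open>\<nu>\<close>. Equal darts remain equal under
  \<open>n\<close>, and moving one of them to position 0 leaves the other elsewhere.\<close>

lemma T_neq_position [simp]:
  "T i 0 \<noteq> T j (Suc 0)" "T i 0 \<noteq> T j 2" "T i 0 \<noteq> T j 3" "T i 0 \<noteq> T j 4"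
  "T i (Suc 0) \<noteq> T j 0" "T i (Suc 0) \<noteq> T j 2" "T i (Suc 0) \<noteq> T j 3" "T i (Suc 0) \<noteq> T j 4"
  "T i 2 \<noteq> T j 0" "T i 2 \<noteq> T j (Suc 0)" "T i 2 \<noteq> T j 3" "T i 2 \<noteq> T j 4"
  "T i 3 \<noteq> T j 0" "T i 3 \<noteq> T j (Suc 0)" "T i 3 \<noteq> T j 2" "T i 3 \<noteq> T j 4"
  "T i 4 \<noteq> T j 0" "T i 4 \<noteq> T j (Suc 0)" "T i 4 \<noteq> T j 2" "T i 4 \<noteq> T j 3"
proof -
  have 0: "T i 0 \<noteq> T j (Suc 0)" "T i 0 \<noteq> T j 2" "T i 0 \<noteq> T j 3" "T i 0 \<noteq> T j 4" for i j
    using org_T0[of i] T_neq[of j] by metis+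
  note 0 [simp] 0[symmetric, simp]
  show "T i 0 \<noteq> T j (Suc 0)" "T i 0 \<noteq> T j 2" "T i 0 \<noteq> T j 3" "T i 0 \<noteq> T j 4"
    "T i (Suc 0) \<noteq> T j 0" "T i 2 \<noteq> T j 0" "T i 3 \<noteq> T j 0" "T i 4 \<noteq> T j 0" by simp_all
  show "T i (Suc 0) \<noteq> T j 2" by (rule notI, drule step, simp)
  show "T i (Suc 0) \<noteq> T j 3" by (rule notI, drule step, simp)
  show "T i (Suc 0) \<noteq> T j 4" by (rule notI, drule step, simp)
  show "T i 2 \<noteq> T j (Suc 0)" by (rule notI, drule step, simp)
  show "T i 2 \<noteq> T j 3" by (rule notI, drule step, simp)
  show "T i 2 \<noteq> T j 4" by (rule notI, drule step, simp)
  show "T i 3 \<noteq> T j (Suc 0)" by (rule notI, drule step, simp)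
  show "T i 3 \<noteq> T j 2" by (rule notI, drule step, simp)
  show "T i 3 \<noteq> T j 4" by (rule notI, drule step, simp)
  show "T i 4 \<noteq> T j (Suc 0)" by (rule notI, drule step, simp)
  show "T i 4 \<noteq> T j 2" by (rule notI, drule step, simp)
  show "T i 4 \<noteq> T j 3" by (rule notI, drule step, simp)
qed

lemma T4_eq_iff [simp]: "T i 4 = T j 4 \<longleftrightarrow> (i + 1) mod int k = (j + 1) mod int k"
proof
  assume "T i 4 = T j 4"
  from step[OF this] show "(i + 1) mod int k = (j + 1) mod int k" by (simp add: T0_eq_iff)
next
  assume "(i + 1) mod int k = (j + 1) mod int k"
  then have "T (i + 1) 0 = T (j + 1) 0" by (simp add: T0_eq_iff)
  from step[OF this] show "T i 4 = T j 4"
    by - (simp (no_asm_use), elim conjE, (assumption | (rule sym, assumption)))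
qed

lemma org_Q2: "org (Q i 2) = z' i"
  using org_rot[of "Q i 2"] by (simp add: rot_def)

lemma org_Q3: "org (Q i 3) = z i"
  using org_rot[of "N i 2"] by (simp add: rot_def)

lemma a_P3': "z (i + 1) \<noteq> \<nu> \<Longrightarrow> a (P i 3) = Q (i + 1) 3"
  using a_P3[of "i + 1"] by simp

text \<open>If \<open>z i\<close> or \<open>z' i\<close> is \<open>\<nu>\<close>, the tile \<open>N i\<close> is one of the tiles at \<open>\<nu>\<close>, which gives a chord between
  two edges at \<open>\<nu>\<close>: \<open>N i 2 = T l 0\<close> joins the edges \<open>i\<close> and \<open>l + 1\<close>, and \<open>N j 3 = T q 0\<close>
  joins the edges \<open>j\<close> and \<open>q\<close>. The chords are realised by closed walks of length 3, so by the colouring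
  property \<open>cut\<close> they do not cross.\<close>

lemma chord_z_swap: "N i 2 = T l 0 \<Longrightarrow> N (l + 1) 2 = T (i - 1) 0"
proof -
  assume "N i 2 = T l 0"
  \<comment> \<open>The dart from x_i to y_i is the one from y_{l+1} to x_{l+1}. Reversing it shows
    the same chord from its other end.\<close>
  from step[OF this] have "N (l + 1) 0 = T (i - 1) 3"
    by - (simp (no_asm_use), elim conjE, (assumption | (rule sym, assumption)))
  from step[OF this] show ?thesis
    by - (simp (no_asm_use), elim conjE, (assumption | (rule sym, assumption)))
qed

lemma chord_z'_swap: "N j 3 = T q 0 \<Longrightarrow> N q 3 = T j 0"
proof -
  assume "N j 3 = T q 0"
  from step[OF this] have "N q 4 = T j 1"
    by - (simp (no_asm_use), elim conjE, (assumption | (rule sym, assumption)))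
  from step[OF this] show ?thesis
    by - (simp (no_asm_use), elim conjE, (assumption | (rule sym, assumption)))
qed

text \<open>A chord of span 0 would make \<open>N i 0\<close> equal to its own reversal
  \<open>T (i - 1) 3\<close>.\<close>

lemma chord_z_neq: "N i 2 \<noteq> T (i - 1) 0"
proof
  assume "N i 2 = T (i - 1) 0"
  from step[OF this] have "N i 0 = T (i - 1) 3"
    by - (simp (no_asm_use), elim conjE, (assumption | (rule sym, assumption)))
  then show False using a_neq_face[of "N i 0"] by simp
qed

lemma chord_z'_neq: "N i 3 \<noteq> T i 0"
proof
  assume "N i 3 = T i 0"
  from step[OF this] have "N i 4 = T i 1"
    by - (simp (no_asm_use), elim conjE, (assumption | (rule sym, assumption)))
  then show False using a_neq_face[of "N i 4"] by simp
qed

text \<open>The tiles are coloured by the winding number of the closed walk through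
  \<open>\<nu>\<close>, x_i and x_{l+1}. The tiles \<open>N p\<close> and \<open>T p\<close> share
  the edge x_p y'_p, which this walk avoids, so they have the same colour. If \<open>N p\<close> is
  also \<open>T q\<close>, then \<open>T p\<close> and \<open>T q\<close> lie on the same side of
  the chord.\<close>

lemma chord_z_colour:
  assumes A: "N i 2 = T l 0" and il: "i \<le> l" "l + 1 < i + int k"
    and p: "i \<le> p" "p < i + int k" and q: "i \<le> q" "q < i + int k"
    and pq: "N p 2 = T q 0 \<or> N p 3 = T q 0"
  shows "p \<le> l \<longleftrightarrow> q \<le> l"
proof -
  \<comment> \<open>The walk is written with darts of tiles at \<open>\<nu>\<close> only, so that
    \<open>T_neq_position\<close> decides which edges it uses.\<close>
  have N: "T l 3 = N i 0" "T l 4 = N i (Suc 0)" using step[OF A]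
    by - (simp (no_asm_use), elim conjE, (assumption | (rule sym, assumption)))+
  obtain c :: "'d \<Rightarrow> int" where c: "d \<in> D \<Longrightarrow> c (n d) = c d"
      "d \<in> D \<Longrightarrow> c d - c (a d) = int (count_list [T i 0, T l 3, T l 4] d) - int (count_list [T i 0, T l 3, T l 4] (a d))" for d
    unfolding N using cut[of "T i 0" "N i 0" "N i 1"] A org_N0[of i] org_a[of "T i 0"] by auto
  have cT: "c (T p 1) = c (T p 0)" "c (T p 2) = c (T p 0)" "c (T p 3) = c (T p 0)" "c (T p 4) = c (T p 0)"
    and cN: "c (N p 1) = c (N p 0)" "c (N p 2) = c (N p 0)" "c (N p 3) = c (N p 0)" "c (N p 4) = c (N p 0)" for p
    using c(1)[of "T p 0"] c(1)[of "T p 1"] c(1)[of "T p 2"] c(1)[of "T p 3"]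
      c(1)[of "N p 0"] c(1)[of "N p 1"] c(1)[of "N p 2"] c(1)[of "N p 3"] by simp_all
  have g: "c (T p 0) - c (T (p - 1) 0) = of_bool (p mod int k = i mod int k) - of_bool (p mod int k = (l + 1) mod int k)" for p
    using c(2)[of "T p 0"] cT[of "p - 1"] by (auto simp: T0_eq_iff)
  have "N (l + 1) 0 = T (i - 1) 3" using step[OF A]
    by - (simp (no_asm_use), elim conjE, (assumption | (rule sym, assumption)))
  then have "N p 4 \<noteq> T i 0" "N p 4 \<noteq> T l 3" "N p 4 \<noteq> T l 4" for p
    by - (rule notI, drule step, simp)+
  then have e: "c (N p 0) = c (T p 0)" for p
    using c(2)[of "T p 1"] cT[of p] cN[of p] by (auto simp: eq_commute[of _ "N p 4"])
  have "c (T p 0) = c (T q 0)" using e[of p] pq cN[of p] by auto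
  then show ?thesis
    using of_bool_arcs[of "\<lambda>p. c (T p 0)", OF g, of p] of_bool_arcs[of "\<lambda>p. c (T p 0)", OF g, of q] il p q
    by (auto split: if_splits)
qed

text \<open>Mirror image of \<open>chord_z_colour\<close>. Now the chord is the edge x_i y'_i, so
  \<open>N p\<close> has to be compared with its other neighbour \<open>T (p - 1)\<close> across x_p
  y_p. This shifts the range of \<open>p\<close> by one against that of \<open>q\<close>.\<close>

lemma chord_z'_colour:
  assumes B: "N i 3 = T l 0" and il: "i < l" "l < i + int k"
    and p: "i < p" "p \<le> i + int k" and q: "i \<le> q" "q < i + int k"
    and pq: "N p 2 = T q 0 \<or> N p 3 = T q 0"
  shows "p \<le> l \<longleftrightarrow> q < l"
proof -
  have B': "N i 4 = T l (Suc 0)" "P i (Suc 0) = T (l - 1) 4" using step[OF B]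
    by - (simp (no_asm_use), elim conjE, (assumption | (rule sym, assumption)))+
  obtain c :: "'d \<Rightarrow> int" where c: "d \<in> D \<Longrightarrow> c (n d) = c d"
      "d \<in> D \<Longrightarrow> c d - c (a d) = int (count_list [T i 0, T i 1, T (l - 1) 4] d) - int (count_list [T i 0, T i 1, T (l - 1) 4] (a d))" for d
    using cut[of "T i 0" "T i 1" "P i 1"] B B' org_a[of "N i 3"] org_a[of "T i 1"] org_a[of "N i 4"] org_a[of "P i 1"]
      org_rot[of "T i 2"] by (auto simp: rot_def)
  have cT: "c (T p 1) = c (T p 0)" "c (T p 2) = c (T p 0)" "c (T p 3) = c (T p 0)" "c (T p 4) = c (T p 0)"
    and cN: "c (N p 1) = c (N p 0)" "c (N p 2) = c (N p 0)" "c (N p 3) = c (N p 0)" "c (N p 4) = c (N p 0)" for p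
    using c(1)[of "T p 0"] c(1)[of "T p 1"] c(1)[of "T p 2"] c(1)[of "T p 3"]
      c(1)[of "N p 0"] c(1)[of "N p 1"] c(1)[of "N p 2"] c(1)[of "N p 3"] by simp_all
  have g: "c (T p 0) - c (T (p - 1) 0) = of_bool (p mod int k = i mod int k) - of_bool (p mod int k = l mod int k)" for p
    using c(2)[of "T p 0"] cT[of "p - 1"] by (auto simp: T0_eq_iff)
  have "N p 0 \<noteq> T i 0" "N p 0 \<noteq> T i (Suc 0)" "N p 0 \<noteq> T (l - 1) 4" for p
    using B' by - (rule notI, drule step, simp)+
  then have e: "c (N p 0) = c (T (p - 1) 0)" for p
    using c(2)[of "T (p - 1) 3"] cT[of "p - 1"] cN[of p] by (auto simp: eq_commute[of _ "N p 0"])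
  have "c (T (p - 1) 0) = c (T q 0)" using e[of p] pq cN[of p] by auto
  then show ?thesis
    using of_bool_arcs[of "\<lambda>p. c (T p 0)", OF g, of "p - 1"] of_bool_arcs[of "\<lambda>p. c (T p 0)", OF g, of q] il p q
    by (auto split: if_splits)
qed

text \<open>A vertex z or z' inside the arc that equals \<open>\<nu>\<close> would give a chord
  which, by non-crossing, stays inside and is shorter. So the gluing rules hold inside, and the
  coincidence of \<open>N i\<close> with \<open>T l\<close> spreads inward from both ends. Small
  gaps make a tile its own neighbour; otherwise a chord appears with both ends moved by
  three.\<close>

lemma chord_z_minimal:
  assumes A: "N i 2 = T l 0" and il: "i \<le> l" "l + 1 < i + int k"
    and IH: "\<And>j q. 0 \<le> q - j \<Longrightarrow> q - j < l - i \<Longrightarrow> N j 2 \<noteq> T q 0"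
      "\<And>j q. 0 < q - j \<Longrightarrow> q - j \<le> l - i \<Longrightarrow> N j 3 \<noteq> T q 0"
  shows False
proof -
  have z: "z p \<noteq> \<nu>" if "i < p" "p \<le> l" for p
  proof
    assume "z p = \<nu>"
    then obtain q where q: "i \<le> q" "q < i + int k" "N p 2 = T q 0"
      using org_eq_nuE[of "N p 2" i] by auto
    have "q \<le> l" using chord_z_colour[OF A il, of p q] q that il by auto
    \<comment> \<open>A chord is recorded once from each end; when \<open>q\<close> lies before
      \<open>p - 1\<close>, the swapped record is the one of nonnegative length that the hypothesis
      excludes.\<close>
    consider "p \<le> q" | "q = p - 1" | "q < p - 1" by linarith
    then show False
    proof cases
      case 1 then show False using IH(1)[of q p] q that \<open>q \<le> l\<close> by auto
    next
      case 2 then show False using chord_z_neq q by auto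
    next
      case 3 then show False using IH(1)[of "p - 1" "q + 1"] chord_z_swap[OF q(3)] q that by auto
    qed
  qed
  have z': "z' p \<noteq> \<nu>" if "i < p" "p \<le> l" for p
  proof
    assume "z' p = \<nu>"
    then obtain q where q: "i \<le> q" "q < i + int k" "N p 3 = T q 0"
      using org_eq_nuE[of "N p 3" i] by auto
    have "q \<le> l" using chord_z_colour[OF A il, of p q] q that il by auto
    then show False using IH(2)[of q p] IH(2)[of p q] chord_z'_swap[OF q(3)] chord_z'_neq[of p] q that
      by (cases p q rule: linorder_cases) auto
  qed
  have "P i 1 = N l 4" using step[OF A]
    by - (simp (no_asm_use), elim conjE, (assumption | (rule sym, assumption)))
  from step[OF this] have Pi: "P i 0 = N l 3"
    by - (simp (no_asm_use), elim conjE, (assumption | (rule sym, assumption)))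
  from step[OF this] have Ql: "Q l 2 = N (i + 1) 1"
    by - (simp (no_asm_use), elim conjE, (assumption | (rule sym, assumption)))
  consider "l = i" | "l = i + 1" | "l = i + 2" | "l \<ge> i + 3" using il by linarith
  then show False
  proof cases
    case 1
    from step[OF A] have "N i 4 = T l 2"
      by - (simp (no_asm_use), elim conjE, (assumption | (rule sym, assumption)))
    then show False using a_neq_face[of "T i 1"] 1 by simp
  next
    case 2
    from step[OF Pi] have "P i 4 = N l 2"
      by - (simp (no_asm_use), elim conjE, (assumption | (rule sym, assumption)))
    then have "a (N l 2) = N l 1" using 2 a_P4[of i] by simp
    then show False using a_neq_face[of "N l 2"] a_neq_face[of "N l 1"] a_a[of "N l 2"] by auto
  next
    case 3
    have zz: "z (i + 1) \<noteq> \<nu>" "z' (i + 1) \<noteq> \<nu>" using z z' 3 by simp_all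
    from step[OF Pi] have "Q (i + 1) 3 = P (l - 1) 4"
      by - (simp (no_asm_use) add: a_P3'[OF zz(1)], elim conjE, (assumption | (rule sym, assumption)))
    from step[OF this] have "Q (i + 1) 1 = P (l - 1) 2"
      by - (simp (no_asm_use), elim conjE, (assumption | (rule sym, assumption)))
    then show False using a_neq_face[of "P (i + 1) 2"] a_P2[OF zz(2)] 3 by (simp add: algebra_simps)
  next
    case 4
    have zz: "z (i + 1) \<noteq> \<nu>" "z (i + 2) \<noteq> \<nu>" "z' (i + 1) \<noteq> \<nu>" "z' (i + 2) \<noteq> \<nu>"
      "z l \<noteq> \<nu>" "z' (l - 1) \<noteq> \<nu>"
      using z z' 4 by simp_all
    from step[OF Pi] have Qi1: "Q (i + 1) 3 = P (l - 1) 4"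
      by - (simp (no_asm_use) add: a_P3'[OF zz(1)], elim conjE, (assumption | (rule sym, assumption)))
    from step[OF this] have "Q (i + 1) 2 = P (l - 1) 3"
      by - (simp (no_asm_use), elim conjE, (assumption | (rule sym, assumption)))
    \<comment> \<open>Closing the rotation at w_l requires that it is not \<open>\<nu>\<close>. By
      the coincidence just obtained, w_l is z'_{i+1}.\<close>
    then have wl: "w l \<noteq> \<nu>" using org_Q2[of "i + 1"] zz by simp
    from step[OF Ql] have Ql1: "Q (l - 1) 0 = P (i + 1) 1"
      by - (simp (no_asm_use) add: a_Q4(1)[OF zz(5,6) wl], elim conjE, (assumption | (rule sym, assumption)))
    from step[OF this] have "Q (l - 1) 2 = P (i + 1) 3"
      by - (simp (no_asm_use), elim conjE, (assumption | (rule sym, assumption)))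
    then have wi: "w (i + 2) \<noteq> \<nu>" using org_Q2[of "l - 1"] zz by (simp add: algebra_simps)
    have "z' (i + 2 - 1) \<noteq> \<nu>" using zz by (simp add: algebra_simps)
    note a_Q4(2)[OF zz(2) this wi]
    then have "a (Q (i + 1) 0) = Q (i + 2) 4" by (simp add: algebra_simps)
    moreover from step[OF Qi1] have "Q (i + 1) 0 = P (l - 1) 1"
      by - (simp (no_asm_use), elim conjE, (assumption | (rule sym, assumption)))
    ultimately have Qi2: "Q (i + 2) 4 = N (l - 1) 3" by simp
    from step[OF Qi2] have "P (i + 2) 2 = T (l - 2) 3"
      by - (simp (no_asm_use) add: a_Q1[OF zz(4)], elim conjE, (assumption | (rule sym, assumption)))
    from step[OF this] have "N (i + 3) 1 = T (l - 3) 4"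
      by - (simp (no_asm_use) add: algebra_simps, elim conjE, (assumption | (rule sym, assumption)))
    from step[OF this] have A3: "N (i + 3) 2 = T (l - 3) 0"
      by - (simp (no_asm_use) add: algebra_simps, elim conjE, (assumption | (rule sym, assumption)))
    from chord_z_swap[OF this] have A3': "N (l - 2) 2 = T (i + 2) 0" by (simp add: algebra_simps)
    \<comment> \<open>The two ends may have passed each other, and then the swapped record applies;
      if they meet, the chord has span 0.\<close>
    show False using IH(1)[of "l - 3" "i + 3"] IH(1)[of "i + 2" "l - 2"] A3 A3' chord_z_neq[of "i + 3"] 4 il
      by (cases "l - 3" "i + 2" rule: linorder_cases) (auto simp: algebra_simps)
  qed
qed

text \<open>The argument of \<open>chord_z_minimal\<close> for the other kind of chord. Here the
  ends are j and q, and the inner chord joins j + 3 and q - 3.\<close>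

lemma chord_z'_minimal:
  assumes B: "N j 3 = T q 0" and jq: "j < q" "q < j + int k"
    and IH: "\<And>i l. 0 < l - i \<Longrightarrow> l - i < q - j \<Longrightarrow> N i 3 \<noteq> T l 0"
      "\<And>i l. 0 \<le> l - i \<Longrightarrow> l - i + 1 < q - j \<Longrightarrow> N i 2 \<noteq> T l 0"
  shows False
proof -
  have z: "z p \<noteq> \<nu>" if "j < p" "p \<le> q" for p
  proof
    assume "z p = \<nu>"
    then obtain l where l: "j \<le> l" "l < j + int k" "N p 2 = T l 0"
      using org_eq_nuE[of "N p 2" j] by auto
    have "l < q" using chord_z'_colour[OF B jq, of p l] l that jq by auto
    consider "p \<le> l" | "l = p - 1" | "l < p - 1" by linarith
    then show False
    proof cases
      case 1 then show False using IH(2)[of l p] l that \<open>l < q\<close> by auto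
    next
      case 2 then show False using chord_z_neq l by auto
    next
      case 3 then show False using IH(2)[of "p - 1" "l + 1"] chord_z_swap[OF l(3)] l that by auto
    qed
  qed
  have z': "z' p \<noteq> \<nu>" if "j < p" "p < q" for p
  proof
    assume "z' p = \<nu>"
    then obtain l where l: "j \<le> l" "l < j + int k" "N p 3 = T l 0"
      using org_eq_nuE[of "N p 3" j] by auto
    have "l < q" using chord_z'_colour[OF B jq, of p l] l that jq by auto
    then show False using IH(1)[of l p] IH(1)[of p l] chord_z'_swap[OF l(3)] chord_z'_neq[of p] l that
      by (cases p l rule: linorder_cases) auto
  qed
  from step[OF chord_z'_swap[OF B]] have Pj: "P j 0 = T (q - 1) 3"
    by - (simp (no_asm_use), elim conjE, (assumption | (rule sym, assumption)))
  from step[OF chord_z'_swap[OF B]] have Pq1: "P (q - 1) 4 = N (j + 1) 0"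
    by - (simp (no_asm_use), elim conjE, (assumption | (rule sym, assumption)))
  consider "q = j + 1" | "q = j + 2" | "q = j + 3" | "q \<ge> j + 4" using jq by linarith
  then show False
  proof cases
    case 1
    then show False using Pj a_neq_face[of "T j 2"] by simp
  next
    case 2
    from step[OF Pq1] have "P (q - 1) 1 = N (j + 1) 2"
      by - (simp (no_asm_use), elim conjE, (assumption | (rule sym, assumption)))
    from step[OF this] have "N (q - 1) 3 = Q (j + 1) 2"
      by - (simp (no_asm_use), elim conjE, (assumption | (rule sym, assumption)))
    then show False using a_neq_face[of "N (j + 1) 2"] 2 by (simp add: algebra_simps)
  next
    case 3
    have zz: "z' (q - 1) \<noteq> \<nu>" "z (q - 1) \<noteq> \<nu>" using z z' 3 by simp_all
    from step[OF Pq1] have "Q (q - 1) 1 = P (j + 1) 1"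
      by - (simp (no_asm_use) add: a_P2[OF zz(1)], elim conjE, (assumption | (rule sym, assumption)))
    from step[OF this] have "Q (q - 1) 3 = P (j + 1) 3"
      by - (simp (no_asm_use), elim conjE, (assumption | (rule sym, assumption)))
    then show False using a_Q3[OF zz(2)] a_neq_face[of "Q (q - 1) 3"] 3 by (simp add: algebra_simps)
  next
    case 4
    have zz: "z' (q - 1) \<noteq> \<nu>" "z (q - 1) \<noteq> \<nu>" "z' (j + 2 - 1) \<noteq> \<nu>" "z (j + 2) \<noteq> \<nu>" "z' (q - 1 - 1) \<noteq> \<nu>" "z (q - 2) \<noteq> \<nu>"
      using z[of "q - 1"] z'[of "j + 1"] z[of "j + 2"] z'[of "q - 2"] z[of "q - 2"] z'[of "q - 1"] 4
      by (simp_all add: algebra_simps)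
    from step[OF Pq1] have Qq1: "Q (q - 1) 1 = P (j + 1) 1"
      by - (simp (no_asm_use) add: a_P2[OF zz(1)], elim conjE, (assumption | (rule sym, assumption)))
    from step[OF Pq1] have "Q (j + 1) 2 = N (q - 1) 3"
      by - (simp (no_asm_use), elim conjE, (assumption | (rule sym, assumption)))
    from step[OF this] have Qj1: "Q (j + 1) 0 = N (q - 1) 1"
      by - (simp (no_asm_use), elim conjE, (assumption | (rule sym, assumption)))
    from step[OF Qq1] have "Q (q - 1) 3 = P (j + 1) 3"
      by - (simp (no_asm_use), elim conjE, (assumption | (rule sym, assumption)))
    then have "w (j + 2) \<noteq> \<nu>" using org_Q3[of "q - 1"] zz by (simp add: algebra_simps)
    from a_Q4(2)[OF zz(4,3) this] have "a (Q (j + 1) 0) = Q (j + 2) 4" by (simp add: algebra_simps)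
    with arg_cong[OF Qj1, of a] have Qj2: "Q (j + 2) 4 = P (q - 2) 4" by simp
    from step[OF this] have "Q (j + 2) 3 = P (q - 2) 3"
      by - (simp (no_asm_use), elim conjE, (assumption | (rule sym, assumption)))
    then have wq: "w (q - 1) \<noteq> \<nu>" using org_Q3[of "j + 2"] zz by (simp add: algebra_simps)
    from step[OF Qq1] have "Q (q - 1) 4 = P (j + 1) 4"
      by - (simp (no_asm_use), elim conjE, (assumption | (rule sym, assumption)))
    with a_Q4(1)[OF zz(2,5) wq] have Qq2: "Q (q - 2) 0 = N (j + 2) 1"
      using arg_cong[of "Q (q - 1) 4" "P (j + 1) 4" a] by (simp add: algebra_simps)
    from step[OF this] have "Q (q - 2) 3 = N (j + 2) 4"
      by - (simp (no_asm_use), elim conjE, (assumption | (rule sym, assumption)))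
    from arg_cong[OF this, of a] have "P (q - 3) 3 = T (j + 2) 1" using a_Q3[OF zz(6)] by (simp add: algebra_simps)
    from step[OF this] have "P (q - 3) 1 = T (j + 2) 4"
      by - (simp (no_asm_use) add: algebra_simps, elim conjE, (assumption | (rule sym, assumption)))
    from step[OF this] have B3: "N (q - 3) 3 = T (j + 3) 0"
      by - (simp (no_asm_use) add: algebra_simps, elim conjE, (assumption | (rule sym, assumption)))
    from chord_z'_swap[OF this] have B3': "N (j + 3) 3 = T (q - 3) 0" .
    show False using IH(1)[of "j + 3" "q - 3"] IH(1)[of "q - 3" "j + 3"] B3 B3' chord_z'_neq[of "q - 3"] 4 jq
      by (cases "q - 3" "j + 3" rule: linorder_cases) (auto simp: algebra_simps)
  qed
qed

text \<open>Both kinds are excluded in one induction, since each minimality argument meets chords of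
  the other kind. \<open>L\<close> is the number of steps between the two edges at
  \<open>\<nu>\<close>: \<open>l - i + 1\<close> for the first kind, whose ends are i and l + 1, and
  \<open>q - j\<close> for the second.\<close>

lemma no_chord:
  "(\<forall>i l. 0 \<le> l - i \<and> l - i + 1 = int L \<and> L < k \<longrightarrow> N i 2 \<noteq> T l 0) \<and>
   (\<forall>j q. 0 < q - j \<and> q - j = int L \<and> L < k \<longrightarrow> N j 3 \<noteq> T q 0)"
proof (induction L rule: less_induct)
  case (less L)
  have IH: "N i 2 \<noteq> T l 0" if "0 \<le> l - i" "l - i + 1 < int L" "L < k" for i l
    using less.IH[of "nat (l - i + 1)"] that by auto
  have IH': "N j 3 \<noteq> T q 0" if "0 < q - j" "q - j < int L" "L < k" for j q
    using less.IH[of "nat (q - j)"] that by auto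
  show ?case
  proof (intro conjI allI impI notI; elim conjE)
    fix i l assume h: "0 \<le> l - i" "l - i + 1 = int L" "L < k" "N i 2 = T l 0"
    show False by (rule chord_z_minimal[OF h(4)]) (use h IH IH' in auto)
  next
    fix j q assume h: "0 < q - j" "q - j = int L" "L < k" "N j 3 = T q 0"
    show False by (rule chord_z'_minimal[OF h(4)]) (use h IH IH' in auto)
  qed
qed

lemma z_neq: "z i \<noteq> \<nu>"
proof
  assume "z i = \<nu>"
  then obtain q where q: "i \<le> q" "q < i + int k" "N i 2 = T q 0"
    using org_eq_nuE[of "N i 2" i] by auto
  show False
  \<comment> \<open>The last index of the window is i - 1 modulo k. This is the chord of span 0, for
    which \<open>L\<close> would reach k.\<close>
  proof (cases "q = i + int k - 1")
    case True
    then have "T q 0 = T (i - 1) 0" unfolding True using T_periodic[of "i - 1" 1 0] by (simp add: algebra_simps)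
    then show False using chord_z_neq[of i] q by simp
  next
    case False
    then show False using no_chord[of "nat (q - i + 1)"] q by auto
  qed
qed

lemma z'_neq: "z' i \<noteq> \<nu>"
proof
  assume "z' i = \<nu>"
  then obtain q where q: "i \<le> q" "q < i + int k" "N i 3 = T q 0"
    using org_eq_nuE[of "N i 3" i] by auto
  show False
    using no_chord[of "nat (q - i)"] chord_z'_neq[of i] q by (cases "q = i") auto
qed

section \<open>The vertices w and the south pole differ from the north pole\<close>

lemmas a_P2_simp [simp] = a_P2[OF z'_neq]
lemmas a_Q1_simp [simp] = a_Q1[OF z'_neq]
lemmas a_Q3_simp [simp] = a_Q3[OF z_neq]
lemmas a_P3_simp [simp] = a_P3'[OF z_neq]

lemma w_swap: "P (i - 1) 3 = T l 0 \<Longrightarrow> P l 3 = T (i - 1) 0"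
proof -
  assume "P (i - 1) 3 = T l 0"
  from step[OF this] have "P l 0 = T (i - 1) 2"
    by - (simp (no_asm_use) add: algebra_simps, elim conjE, (assumption | (rule sym, assumption)))
  from step[OF this] show ?thesis
    by - (simp (no_asm_use) add: algebra_simps, elim conjE, (assumption | (rule sym, assumption)))
qed

text \<open>If w_i is \<open>\<nu>\<close>, then \<open>P (i - 1)\<close> is the tile
  \<open>T l\<close>. All rules at z and z' are now unconditional, so this coincidence spreads
  freely. It yields the same situation with i raised and l lowered by three, unless the gap is so
  small that a tile meets itself.\<close>

lemma w_step:
  assumes C: "P (i - 1) 3 = T l 0"
  shows "l \<noteq> i" "l \<noteq> i + 1" "l \<noteq> i - 1" "l \<noteq> i + 2" "P (i + 2) 3 = T (l - 3) 0"
proof -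
  from step[OF C] have 1: "N i 1 = N l 4"
    by - (simp (no_asm_use) add: algebra_simps, elim conjE, (assumption | (rule sym, assumption)))
  show "l \<noteq> i" using 1 n_neq_face[of "N i 1"] by auto
  from step[OF 1] have 2: "P i 1 = P (l - 1) 4"
    by - (simp (no_asm_use) add: algebra_simps, elim conjE, (assumption | (rule sym, assumption)))
  show "l \<noteq> i + 1" using 2 n_neq_face[of "P i 1"] by auto
  from step[OF C] have 3: "P l 0 = T (i - 1) 2"
    by - (simp (no_asm_use) add: algebra_simps, elim conjE, (assumption | (rule sym, assumption)))
  from step[OF C] have 4: "P (i - 1) 0 = T l 2"
    by - (simp (no_asm_use) add: algebra_simps, elim conjE, (assumption | (rule sym, assumption)))
  show "l \<noteq> i - 1" using 3 4 a_neq_face[of "T l 2"] by auto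
  from step[OF 2] have 5: "Q (i + 1) 3 = N (l - 1) 3"
    by - (simp (no_asm_use) add: algebra_simps, elim conjE, (assumption | (rule sym, assumption)))
  from step[OF 5] have 6: "Q (i + 1) 2 = N (l - 1) 2"
    by - (simp (no_asm_use) add: algebra_simps, elim conjE, (assumption | (rule sym, assumption)))
  show "l \<noteq> i + 2" using 6 a_neq_face[of "N (i + 1) 2"] by (auto simp: algebra_simps)
  from step[OF 5] have 7: "P (i + 1) 2 = P (l - 2) 4"
    by - (simp (no_asm_use) add: algebra_simps, elim conjE, (assumption | (rule sym, assumption)))
  from step[OF 7] have "P (i + 1) 3 = P (l - 2) 0"
    by - (simp (no_asm_use) add: algebra_simps, elim conjE, (assumption | (rule sym, assumption)))
  then have "w (i + 2) \<noteq> \<nu>" using org_P0[of "l - 2"] T_neq by (simp add: algebra_simps)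
  from a_Q4(2)[OF z_neq z'_neq this] have "a (Q (i + 1) 0) = Q (i + 2) 4" by (simp add: algebra_simps)
  moreover from step[OF 5] have "Q (i + 1) 0 = N (l - 1) 0"
    by - (simp (no_asm_use) add: algebra_simps, elim conjE, (assumption | (rule sym, assumption)))
  ultimately have 8: "Q (i + 2) 4 = T (l - 2) 3" by (simp add: algebra_simps)
  from step[OF 8] have 9: "P (i + 2) 2 = T (l - 3) 4"
    by - (simp (no_asm_use) add: algebra_simps, elim conjE, (assumption | (rule sym, assumption)))
  from step[OF 9] show "P (i + 2) 3 = T (l - 3) 0"
    by - (simp (no_asm_use) add: algebra_simps, elim conjE, (assumption | (rule sym, assumption)))
qed

text \<open>Each step narrows the gap by six. Gaps too narrow for that are read from the other end
  by \<open>w_swap\<close>, which gives a pair already excluded. The offset 1 makes \<open>m\<close>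
  a natural number also for l = i - 1, which the step can produce.\<close>

lemma w_neq_aux: "l - i + 1 = int m \<Longrightarrow> P (i - 1) 3 \<noteq> T l 0"
proof (induction m arbitrary: i l rule: less_induct)
  case (less m)
  show ?case
  proof
    assume C: "P (i - 1) 3 = T l 0"
    have C3: "P (i + 3 - 1) 3 = T (l - 3) 0" using w_step(5)[OF C] by (simp add: algebra_simps)
    have C3': "P (l - 2 - 1) 3 = T (i + 2) 0" using w_swap[OF C3] by (simp add: algebra_simps)
    have "l \<ge> i + 3" using w_step(1-4)[OF C] less.prems by linarith
    then consider "l \<ge> i + 5" | "l = i + 3" | "l = i + 4" by linarith
    then show False
    proof cases
      case 1 then show False using less.IH[of "m - 6" "l - 3" "i + 3"] C3 less.prems by auto
    next
      case 2 then show False using less.IH[of 2 "i + 2" "l - 2"] C3' less.prems by auto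
    next
      case 3 then show False using less.IH[of 1 "i + 2" "l - 2"] C3' less.prems by auto
    qed
  qed
qed

lemma w_neq: "w i \<noteq> \<nu>"
proof
  assume "w i = \<nu>"
  then obtain l where "i \<le> l" "P (i - 1) 3 = T l 0"
    using org_eq_nuE[of "P (i - 1) 3" i] by auto
  then show False using w_neq_aux[of l i "nat (l - i + 1)"] by auto
qed

lemma a_Q4_simp [simp]: "a (Q i 4) = Q (i - 1) 0"
  by (rule a_Q4(1)[OF z_neq z'_neq w_neq])

lemma a_Q0_simp [simp]: "a (Q i 0) = Q (i + 1) 4"
  using a_Q4(2)[OF z_neq z'_neq w_neq, of "i + 1"] by simp

text \<open>Rotation raises the index of the tiles \<open>Q\<close> and lowers that of the tiles
  \<open>T\<close>. So from \<open>Q i\<close> = \<open>T l\<close> follows \<open>Q (i + 1)\<close>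
  = \<open>T (l - 1)\<close>, and the gap shrinks by two until it is 0 or 1, where a tile would be
  its own neighbour.\<close>

lemma org_Q0_neq_aux: "l - i = int m \<Longrightarrow> Q i 0 \<noteq> T l 0"
proof (induction m arbitrary: i l rule: less_induct)
  case (less m)
  show ?case
  proof
    assume F: "Q i 0 = T l 0"
    from step[OF F] have 1: "P i 2 = N l 4"
      by - (simp (no_asm_use) add: algebra_simps, elim conjE, (assumption | (rule sym, assumption)))
    from step[OF 1] have 2: "P i 1 = N l 3"
      by - (simp (no_asm_use) add: algebra_simps, elim conjE, (assumption | (rule sym, assumption)))
    have "l \<noteq> i" using 2 a_neq_face[of "N i 3"] by auto
    from step[OF 1] have 3: "P i 4 = N l 1"
      by - (simp (no_asm_use) add: algebra_simps, elim conjE, (assumption | (rule sym, assumption)))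
    have "l \<noteq> i + 1" using 3 a_neq_face[of "P i 4"] by auto
    from step[OF F] have "Q (i + 1) 4 = T (l - 1) 4"
      by - (simp (no_asm_use) add: algebra_simps, elim conjE, (assumption | (rule sym, assumption)))
    from step[OF this] have "Q (i + 1) 0 = T (l - 1) 0"
      by - (simp (no_asm_use) add: algebra_simps, elim conjE, (assumption | (rule sym, assumption)))
    then show False using less.IH[of "m - 2" "l - 1" "i + 1"] less.prems \<open>l \<noteq> i\<close> \<open>l \<noteq> i + 1\<close> by auto
  qed
qed

lemma org_Q0_neq: "org (Q i 0) \<noteq> \<nu>"
proof
  assume "org (Q i 0) = \<nu>"
  then obtain l where "i \<le> l" "Q i 0 = T l 0"
    using org_eq_nuE[of "Q i 0" i] by auto
  then show False using org_Q0_neq_aux[of l i "nat (l - i)"] by auto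
qed

section \<open>The covering of the tiling by the earth map\<close>

text \<open>The darts of the earth map tiling: \<open>(c, i, m)\<close> is the \<open>m\<close>-th dart of the \<open>i\<close>-th tile of the
  family \<open>T\<close>, \<open>N\<close>, \<open>P\<close>, \<open>Q\<close> for \<open>c = 0, 1, 2, 3\<close>.\<close>

definition model :: "(nat \<times> int \<times> nat) set" where
  "model = {..<4} \<times> {0..<int k} \<times> {..<5}"

definition tile_dart :: "nat \<Rightarrow> int \<Rightarrow> nat \<Rightarrow> 'd" where
  "tile_dart c i m = (if c = 0 then T i m else if c = 1 then N i m else if c = 2 then P i m else Q i m)"

definition place :: "nat \<times> int \<times> nat \<Rightarrow> 'd" where
  "place = (\<lambda>(c, i, m). tile_dart c i m)"

definition model_n :: "nat \<times> int \<times> nat \<Rightarrow> nat \<times> int \<times> nat" where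
  "model_n = (\<lambda>(c, i, m). (c, i, if m = 4 then 0 else m + 1))"

text \<open>Each entry gives family, index shift and position of the reversed dart. The table
  transcribes the gluing rules for \<open>a\<close> obtained above.\<close>

definition opp_tile :: "nat \<Rightarrow> nat \<Rightarrow> nat \<times> int \<times> nat" where
  "opp_tile c m =
     [[(0, -1, 4), (1, 0, 4), (2, 0, 0), (1, 1, 0), (0, 1, 0)],
      [(0, -1, 3), (2, -1, 4), (3, 0, 2), (2, 0, 1), (0, 0, 1)],
      [(0, 0, 2), (1, 0, 3), (3, 0, 1), (3, 1, 3), (1, 1, 1)],
      [(3, 1, 4), (2, 0, 2), (1, 0, 2), (2, -1, 3), (3, -1, 0)]] ! c ! m"

definition model_a :: "nat \<times> int \<times> nat \<Rightarrow> nat \<times> int \<times> nat" where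
  "model_a = (\<lambda>(c, i, m). case opp_tile c m of (c', s, m') \<Rightarrow> (c', (i + s) mod int k, m'))"

definition ix :: "int \<Rightarrow> nat" where
  "ix i = nat (i mod int k)"

definition dart_vertex :: "nat \<times> int \<times> nat \<Rightarrow> earth_vertex" where
  "dart_vertex = (\<lambda>(c, i, m).
     [[North_Pole, VX (ix i), VY' (ix i), VY (ix (i + 1)), VX (ix (i + 1))],
      [VX (ix i), VY (ix i), VZ (ix i), VZ' (ix i), VY' (ix i)],
      [VY (ix (i + 1)), VY' (ix i), VZ' (ix i), VW (ix (i + 1)), VZ (ix (i + 1))],
      [South_Pole, VW (ix (i + 1)), VZ' (ix i), VZ (ix i), VW (ix i)]] ! c ! m)"

definition south :: 'v where
  "south = org (Q 0 0)"

text \<open>One representative dart is chosen for each vertex; \<open>org_relations\<close> shows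
  that the other darts of the earth map at that vertex lead to the same point.\<close>

primrec position :: "earth_vertex \<Rightarrow> 'v" where
  "position North_Pole = \<nu>"
| "position South_Pole = south"
| "position (VX i) = org (N (int i) 0)"
| "position (VY i) = org (N (int i) 1)"
| "position (VY' i) = org (N (int i) 4)"
| "position (VZ i) = org (N (int i) 2)"
| "position (VZ' i) = org (N (int i) 3)"
| "position (VW i) = org (Q (int i) 4)"

lemma modelE:
  assumes "p \<in> model"
  obtains c i m where "p = (c, i, m)" "0 \<le> i" "i < int k" "c \<in> {0, 1, 2, 3}" "m \<in> {0, 1, 2, 3, 4}"
proof -
  obtain c i m where p: "p = (c, i, m)" by (cases p) auto
  have "c < 4" "m < 5" "0 \<le> i" "i < int k" using assms p by (auto simp: model_def)
  moreover have "c \<in> {0, 1, 2, 3}" using \<open>c < 4\<close> by auto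
  moreover have "m \<in> {0, 1, 2, 3, 4}" using \<open>m < 5\<close> by auto
  ultimately show thesis using that[OF p] by simp
qed

lemma opp_tile_simps:
  "opp_tile 0 0 = (0, -1, 4)" "opp_tile 0 (Suc 0) = (1, 0, 4)" "opp_tile 0 2 = (2, 0, 0)"
  "opp_tile 0 3 = (1, 1, 0)" "opp_tile 0 4 = (0, 1, 0)"
  "opp_tile (Suc 0) 0 = (0, -1, 3)" "opp_tile (Suc 0) (Suc 0) = (2, -1, 4)" "opp_tile (Suc 0) 2 = (3, 0, 2)"
  "opp_tile (Suc 0) 3 = (2, 0, 1)" "opp_tile (Suc 0) 4 = (0, 0, 1)"
  "opp_tile 2 0 = (0, 0, 2)" "opp_tile 2 (Suc 0) = (1, 0, 3)" "opp_tile 2 2 = (3, 0, 1)"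
  "opp_tile 2 3 = (3, 1, 3)" "opp_tile 2 4 = (1, 1, 1)"
  "opp_tile 3 0 = (3, 1, 4)" "opp_tile 3 (Suc 0) = (2, 0, 2)" "opp_tile 3 2 = (1, 0, 2)"
  "opp_tile 3 3 = (2, -1, 3)" "opp_tile 3 4 = (3, -1, 0)"
  by (simp_all add: opp_tile_def numeral_2_eq_2 numeral_3_eq_3 numeral_Bit0)

lemma dart_vertex_simps:
  "dart_vertex (0, i, 0) = North_Pole" "dart_vertex (0, i, Suc 0) = VX (ix i)"
  "dart_vertex (0, i, 2) = VY' (ix i)" "dart_vertex (0, i, 3) = VY (ix (i + 1))"
  "dart_vertex (0, i, 4) = VX (ix (i + 1))"
  "dart_vertex (Suc 0, i, 0) = VX (ix i)" "dart_vertex (Suc 0, i, Suc 0) = VY (ix i)"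
  "dart_vertex (Suc 0, i, 2) = VZ (ix i)" "dart_vertex (Suc 0, i, 3) = VZ' (ix i)"
  "dart_vertex (Suc 0, i, 4) = VY' (ix i)"
  "dart_vertex (2, i, 0) = VY (ix (i + 1))" "dart_vertex (2, i, Suc 0) = VY' (ix i)"
  "dart_vertex (2, i, 2) = VZ' (ix i)" "dart_vertex (2, i, 3) = VW (ix (i + 1))"
  "dart_vertex (2, i, 4) = VZ (ix (i + 1))"
  "dart_vertex (3, i, 0) = South_Pole" "dart_vertex (3, i, Suc 0) = VW (ix (i + 1))"
  "dart_vertex (3, i, 2) = VZ' (ix i)" "dart_vertex (3, i, 3) = VZ (ix i)"
  "dart_vertex (3, i, 4) = VW (ix i)"
  by (simp_all add: dart_vertex_def numeral_2_eq_2 numeral_3_eq_3 numeral_Bit0)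

lemma tile_dart_simps:
  "tile_dart 0 i m = T i m" "tile_dart (Suc 0) i m = N i m" "tile_dart 2 i m = P i m" "tile_dart 3 i m = Q i m"
  by (simp_all add: tile_dart_def)

lemma face_mod: "T (i mod int k) m = T i m" "N (i mod int k) m = N i m" "P (i mod int k) m = P i m" "Q (i mod int k) m = Q i m"
proof -
  have i: "i = i mod int k + int k * (i div int k)" for i by simp
  show T: "T (i mod int k) m = T i m" for i m
    using T_periodic[of "i mod int k" "i div int k" m] by simp
  have "T (i mod int k - 1) m = T (i - 1) m" for i m
    using T[of "i mod int k - 1" m] T[of "i - 1" m] by (simp add: mod_simps)
  then show N: "N (i mod int k) m = N i m" for i m unfolding N_def by (simp only:)
  show "P (i mod int k) m = P i m" unfolding P_def by (simp only: T)
  show "Q (i mod int k) m = Q i m" unfolding Q_def by (simp only: N)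
qed

lemma model_n_in: "p \<in> model \<Longrightarrow> model_n p \<in> model"
  by (auto simp: model_def model_n_def)

lemma model_a_in: "p \<in> model \<Longrightarrow> model_a p \<in> model"
proof -
  assume "p \<in> model"
  then show ?thesis using k_pos
    by (elim modelE insertE emptyE; simp add: model_def model_a_def opp_tile_simps)
qed

lemma place_n: "p \<in> model \<Longrightarrow> place (model_n p) = n (place p)"
  by (elim modelE insertE emptyE; simp add: place_def model_n_def tile_dart_simps flip: numeral_2_eq_2)

lemma place_a: "p \<in> model \<Longrightarrow> place (model_a p) = a (place p)"
  by (elim modelE insertE emptyE; simp add: place_def model_a_def opp_tile_simps tile_dart_simps face_mod)

lemma model_n5: "p \<in> model \<Longrightarrow> model_n (model_n (model_n (model_n (model_n p)))) = p"
  by (elim modelE insertE emptyE; simp add: model_n_def flip: numeral_2_eq_2)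

lemma model_a_a: "p \<in> model \<Longrightarrow> model_a (model_a p) = p"
  by (elim modelE insertE emptyE; simp add: model_a_def opp_tile_simps mod_simps)

lemma place_D: "p \<in> model \<Longrightarrow> place p \<in> D"
  by (cases p) (simp add: place_def tile_dart_def)

lemma org_relations:
  "org (Q i 0) = south" "org (T i 4) = org (N (i + 1) 0)" "org (T i 3) = org (N (i + 1) (Suc 0))" "org (T i 2) = org (N i 4)"
  "org (T i (Suc 0)) = org (N i 0)" "org (P i 0) = org (N (i + 1) (Suc 0))" "org (P i (Suc 0)) = org (N i 4)"
  "org (P i 2) = z' i" "org (P i 3) = org (Q (i + 1) 4)" "org (P i 4) = z (i + 1)"
  "org (Q i (Suc 0)) = org (Q (i + 1) 4)" "org (Q i 2) = z' i" "org (Q i 3) = z i"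
proof -
  show 1: "org (T i 4) = org (N (i + 1) 0)" using org_N0[of "i + 1"] by simp
  show 2: "org (T i 3) = org (N (i + 1) (Suc 0))" using org_rot[of "T i 3"] by (simp add: rot_def)
  show 3: "org (T i 2) = org (N i 4)" using org_rot[of "N i 4"] by (simp add: rot_def)
  show 4: "org (T i (Suc 0)) = org (N i 0)" using org_rot[of "T (i - 1) 4"] org_N0[of i] by (simp add: rot_def)
  show "org (P i 0) = org (N (i + 1) (Suc 0))" using org_P0[of i] 2 by simp
  show "org (P i (Suc 0)) = org (N i 4)" using org_rot[of "T i 2"] 3 by (simp add: rot_def)
  show "org (P i 2) = z' i" using org_rot[of "N i 3"] by (simp add: rot_def)
  show 5: "org (P i 3) = org (Q (i + 1) 4)" using org_rot[of "P i 3"] by (simp add: rot_def)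
  show "org (P i 4) = z (i + 1)" using org_P4[of "i + 1"] by simp
  show "org (Q i (Suc 0)) = org (Q (i + 1) 4)" using org_rot[of "Q i (Suc 0)"] 5 by (simp add: rot_def)
  show "org (Q i 2) = z' i" "org (Q i 3) = z i" by (rule org_Q2, rule org_Q3)
  \<comment> \<open>Rotation passes from \<open>Q i\<close> to \<open>Q (i + 1)\<close> at the south
    pole; induction upwards and downwards from 0 makes that vertex common to all integers i.\<close>
  have s: "org (Q (i + 1) 0) = org (Q i 0)" for i using org_rot[of "Q i 0"] by (simp add: rot_def)
  have "org (Q i 0) = org (Q 0 0)"
  proof (cases "i \<ge> 0")
    case True then show ?thesis by (induction i rule: int_ge_induct) (simp_all add: s)
  next
    case False then have "i \<le> 0" by simp
    then show ?thesis by (induction i rule: int_le_induct) (use s[of "_ - 1"] in simp_all)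
  qed
  then show "org (Q i 0) = south" by (simp add: south_def)
qed

text \<open>All darts of the tiles \<open>N\<close>, \<open>P\<close>, \<open>Q\<close> start away
  from \<open>\<nu>\<close>; this is where the exclusion of z, z', w and the south pole is used. It
  provides the one fibre known to be a single point.\<close>

lemma place_eq_t0: "p \<in> model \<Longrightarrow> place p = T 0 0 \<longleftrightarrow> p = (0, 0, 0)"
proof -
  assume p: "p \<in> model"
  have N: "org (N i 0) \<noteq> \<nu>" "org (N i (Suc 0)) \<noteq> \<nu>" "org (N i 2) \<noteq> \<nu>" "org (N i 3) \<noteq> \<nu>" "org (N i 4) \<noteq> \<nu>" for i
    using T_neq(1,2)[of i, unfolded org_relations] T_neq(3)[of "i - 1", unfolded org_relations] z_neq[of i] z'_neq[of i]
    by simp_all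
  have Q4: "org (Q i 4) \<noteq> \<nu>" for i using w_neq[of i, unfolded org_relations] by simp
  have P: "org (P i 0) \<noteq> \<nu>" "org (P i (Suc 0)) \<noteq> \<nu>" "org (P i 2) \<noteq> \<nu>" "org (P i 3) \<noteq> \<nu>" "org (P i 4) \<noteq> \<nu>" for i
    unfolding org_relations by (rule N Q4)+
  have Q: "org (Q i 0) \<noteq> \<nu>" "org (Q i (Suc 0)) \<noteq> \<nu>" "org (Q i 2) \<noteq> \<nu>" "org (Q i 3) \<noteq> \<nu>" "org (Q i 4) \<noteq> \<nu>" for i
    using org_Q0_neq[of i] N[of i] Q4[of "i + 1"] Q4[of i] org_relations(11-13)[of i] by simp_all
  have "N i m \<noteq> T 0 0" "P i m \<noteq> T 0 0" "Q i m \<noteq> T 0 0" if "m \<in> {0, 1, 2, 3, 4}" for i m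
    using that P[of i] N[of i] Q[of i] org_T0[of 0] by (elim insertE emptyE; metis One_nat_def)+
  then show ?thesis using p
    by (elim modelE insertE emptyE; simp add: place_def tile_dart_simps T0_eq_iff)
qed

text \<open>On the model, \<open>model_n\<close> and \<open>model_a\<close> are invertible and lie
  over \<open>n\<close> and \<open>a\<close>, so having exactly one preimage is inherited along
  both. By \<open>place_eq_t0\<close> some dart has this property, and \<open>conn\<close> extends
  it to all.\<close>

lemma place_bij: "bij_betw place model D"
proof -
  define S where "S = {d \<in> D. \<exists>!p. p \<in> model \<and> place p = d}"
  have "S = D"
  proof (rule conn)
    have "(0, 0, 0) \<in> model" using k_pos by (simp add: model_def)
    then have "T 0 0 \<in> S" using place_eq_t0 by (auto simp: S_def)
    then show "S \<noteq> {}" by auto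
  next
    fix d assume "d \<in> S"
    then obtain p where p: "d \<in> D" "p \<in> model" "place p = d" "\<And>p'. p' \<in> model \<Longrightarrow> place p' = d \<Longrightarrow> p' = p"
      unfolding S_def by blast
    show "n d \<in> S" unfolding S_def
    proof (intro CollectI conjI ex1I)
      show "n d \<in> D" by (rule n_D[OF p(1)])
      show "model_n p \<in> model" by (rule model_n_in[OF p(2)])
      show "place (model_n p) = n d" unfolding place_n[OF p(2)] p(3) ..
    next
      fix p' assume p': "p' \<in> model \<and> place p' = n d"
      let ?q = "model_n (model_n (model_n (model_n p')))"
      have "place ?q = d" "?q \<in> model" using p' n5[OF p(1)] by (simp_all add: place_n model_n_in)
      then have "?q = p" using p(4) by blast
      then show "p' = model_n p" using p' model_n5[of p'] by simp
    qed
    show "a d \<in> S" unfolding S_def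
    proof (intro CollectI conjI ex1I)
      show "a d \<in> D" by (rule a_D[OF p(1)])
      show "model_a p \<in> model" by (rule model_a_in[OF p(2)])
      show "place (model_a p) = a d" unfolding place_a[OF p(2)] p(3) ..
    next
      fix p' assume p': "p' \<in> model \<and> place p' = a d"
      have "place (model_a p') = d" "model_a p' \<in> model" using p' a_a[OF p(1)] by (simp_all add: place_a model_a_in)
      then have "model_a p' = p" using p(4) by blast
      then show "p' = model_a p" using p' model_a_a[of p'] by simp
    qed
  qed (auto simp: S_def)
  have *: "\<exists>!p. p \<in> model \<and> place p = d" if "d \<in> D" for d
  proof -
    have "d \<in> S" by (rule subsetD[OF equalityD2[OF \<open>S = D\<close>] that])
    then have "d \<in> D \<and> (\<exists>!p. p \<in> model \<and> place p = d)" unfolding S_def by (rule CollectD)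
    then show ?thesis by (rule conjunct2)
  qed
  show ?thesis unfolding bij_betw_def
  proof
    show "inj_on place model"
    proof (rule inj_onI)
      fix p q assume pq: "p \<in> model" "q \<in> model" "place p = place q"
      from *[OF place_D[OF pq(1)]] show "p = q"
      proof (rule ex1E)
        fix r assume "\<forall>y. y \<in> model \<and> place y = place p \<longrightarrow> y = r"
        from spec[OF this, of p] spec[OF this, of q] pq show "p = q" by simp
      qed
    qed
    show "place ` model = D"
    proof
      show "D \<subseteq> place ` model"
      proof
        fix d assume "d \<in> D"
        from *[OF this] obtain p where "p \<in> model" "place p = d" by (elim ex1E conjE)
        then show "d \<in> place ` model" by (intro image_eqI[of d place p]) simp_all
      qed
      show "place ` model \<subseteq> D" by (intro image_subsetI place_D)
    qed
  qed
qed

section \<open>Vertices and edges of the labelled tiling\<close>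

lemma ix_mod: "ix (i mod int k) = ix i" "ix (i mod int k + 1) = ix (i + 1)"
  by (simp_all add: ix_def mod_simps)

lemma dart_vertex_rot: "p \<in> model \<Longrightarrow> dart_vertex (model_n (model_a p)) = dart_vertex p"
  by (elim modelE insertE emptyE; simp add: model_n_def model_a_def opp_tile_simps dart_vertex_simps ix_mod flip: numeral_2_eq_2)

lemma int_ix: "int (ix i) = i mod int k"
  using k_pos by (simp add: ix_def)

lemma position_dart_vertex: "p \<in> model \<Longrightarrow> position (dart_vertex p) = org (place p)"
  by (elim modelE insertE emptyE; simp add: place_def tile_dart_simps dart_vertex_simps int_ix face_mod org_relations)

definition dart_label :: "'d \<Rightarrow> earth_vertex" where
  "dart_label d = dart_vertex (inv_into model place d)"

lemma dart_label_place: "p \<in> model \<Longrightarrow> dart_label (place p) = dart_vertex p"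
  using place_bij by (simp add: dart_label_def bij_betw_def)

lemma place_surjE:
  assumes "d \<in> D" obtains p where "p \<in> model" "d = place p"
  using assms place_bij unfolding bij_betw_def by blast

lemma position_dart_label: "d \<in> D \<Longrightarrow> position (dart_label d) = org d"
  by (elim place_surjE) (simp add: dart_label_place position_dart_vertex)

lemma dart_label_rot: "d \<in> D \<Longrightarrow> dart_label (rot d) = dart_label d"
  by (elim place_surjE)
    (simp add: rot_def dart_label_place model_n_in model_a_in dart_vertex_rot flip: place_a place_n)

text \<open>The label is invariant under \<open>rot\<close>, and by \<open>link\<close> the darts at
  a vertex form one orbit of \<open>rot\<close>. So labels belong to vertices, which makes
  \<open>position\<close> injective.\<close>

lemma dart_label_eq_iff:
  assumes d: "d \<in> D" "d' \<in> D"
  shows "dart_label d = dart_label d' \<longleftrightarrow> org d = org d'"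
proof
  assume "org d = org d'"
  with rot_link[OF d] obtain m where m: "(rot ^^ m) d = d'" by blast
  have "dart_label ((rot ^^ m) d) = dart_label d" for m
    by (induction m) (simp_all add: dart_label_rot rot_pow_D d(1))
  from this[of m] show "dart_label d = dart_label d'" unfolding m by simp
next
  assume "dart_label d = dart_label d'"
  then show "org d = org d'" using position_dart_label[OF d(1)] position_dart_label[OF d(2)] by simp
qed

lemma dart_label_image: "dart_label ` D = earth_vertices k"
proof -
  have "dart_label ` D = dart_label ` place ` model"
    using place_bij by (simp add: bij_betw_def)
  also have "\<dots> = dart_vertex ` model"
    unfolding image_image by (rule image_cong) (simp_all add: dart_label_place)
  also have "\<dots> = earth_vertices k"
  proof
    show "dart_vertex ` model \<subseteq> earth_vertices k"
      by (intro image_subsetI, elim modelE insertE emptyE;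
          simp add: earth_vertices_def dart_vertex_simps ix_def nat_less_iff k_pos)
    have 1: "v \<in> dart_vertex ` model" if "dart_vertex (c, i, m) = v" "(c, i, m) \<in> model" for v c i m
      using that(2) unfolding that(1)[symmetric] by (rule imageI)
    have "North_Pole \<in> dart_vertex ` model" "South_Pole \<in> dart_vertex ` model"
      using k_pos 1[of 0 0 0] 1[of 3 0 0] by (auto simp: model_def dart_vertex_simps)
    moreover have "{VX i, VY i, VY' i, VZ i, VZ' i, VW i} \<subseteq> dart_vertex ` model" if "i < k" for i
      using that 1[of 1 "int i" 0] 1[of 1 "int i" 1] 1[of 1 "int i" 2] 1[of 1 "int i" 3] 1[of 1 "int i" 4] 1[of 3 "int i" 4]
      by (auto simp: model_def dart_vertex_simps ix_def)
    ultimately show "earth_vertices k \<subseteq> dart_vertex ` model" by (auto simp: earth_vertices_def)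
  qed
  finally show ?thesis .
qed

lemma position_bij: "bij_betw position (earth_vertices k) (org ` D)"
proof -
  have "inj_on position (dart_label ` D)"
  proof (rule inj_onI, elim imageE)
    fix u v d d' assume d: "d \<in> D" "d' \<in> D" and uv: "u = dart_label d" "v = dart_label d'" "position u = position v"
    have "org d = org d'" using uv(3) unfolding uv(1,2) position_dart_label[OF d(1)] position_dart_label[OF d(2)] .
    then show "u = v" unfolding uv dart_label_eq_iff[OF d] .
  qed
  moreover have "position ` dart_label ` D = org ` D"
    unfolding image_image by (rule image_cong) (simp_all add: position_dart_label)
  ultimately show ?thesis by (simp add: bij_betw_def dart_label_image)
qed

text \<open>The ten families of edges join ten different pairs of vertex kinds, so the labels of
  both ends determine a dart. Its index is read from an end carrying the index of the tile, or
  lowered by one from an end of index i + 1. The value \<open>undefined\<close> belongs to pairs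
  that are not joined.\<close>

definition decode :: "earth_vertex \<Rightarrow> earth_vertex \<Rightarrow> nat \<times> int \<times> nat" where
  "decode u v = (case u of
     North_Pole \<Rightarrow> (case v of VX i \<Rightarrow> (0, int i, 0) | _ \<Rightarrow> undefined)
   | VX i \<Rightarrow> (case v of VY' j \<Rightarrow> (0, int i, 1) | North_Pole \<Rightarrow> (0, (int i - 1) mod int k, 4) | VY j \<Rightarrow> (1, int i, 0) | _ \<Rightarrow> undefined)
   | VY' i \<Rightarrow> (case v of VY j \<Rightarrow> (0, int i, 2) | VX j \<Rightarrow> (1, int i, 4) | VZ' j \<Rightarrow> (2, int i, 1) | _ \<Rightarrow> undefined)
   | VY i \<Rightarrow> (case v of VX j \<Rightarrow> (0, (int i - 1) mod int k, 3) | VZ j \<Rightarrow> (1, int i, 1) | VY' j \<Rightarrow> (2, int j, 0) | _ \<Rightarrow> undefined)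
   | VZ i \<Rightarrow> (case v of VZ' j \<Rightarrow> (1, int i, 2) | VY j \<Rightarrow> (2, (int i - 1) mod int k, 4) | VW j \<Rightarrow> (3, int i, 3) | _ \<Rightarrow> undefined)
   | VZ' i \<Rightarrow> (case v of VY' j \<Rightarrow> (1, int i, 3) | VW j \<Rightarrow> (2, int i, 2) | VZ j \<Rightarrow> (3, int j, 2) | _ \<Rightarrow> undefined)
   | VW i \<Rightarrow> (case v of VZ j \<Rightarrow> (2, (int i - 1) mod int k, 3) | VZ' j \<Rightarrow> (3, int j, 1) | South_Pole \<Rightarrow> (3, int i, 4) | _ \<Rightarrow> undefined)
   | South_Pole \<Rightarrow> (case v of VW i \<Rightarrow> (3, (int i - 1) mod int k, 0) | _ \<Rightarrow> undefined))"

lemma mod_pred: "((i + 1) mod int k - 1) mod int k = i mod int k"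
  by (simp add: mod_diff_left_eq)

lemma decode: "p \<in> model \<Longrightarrow> decode (dart_vertex p) (dart_vertex (model_n p)) = p"
  by (elim modelE insertE emptyE; simp add: model_n_def dart_vertex_simps flip: numeral_2_eq_2;
      simp only: decode_def earth_vertex.case; simp add: int_ix mod_pred)

lemma dart_label_n: "p \<in> model \<Longrightarrow> dart_label (n (place p)) = dart_vertex (model_n p)"
  using dart_label_place[OF model_n_in, of p] place_n[of p] by simp

text \<open>Multiple edges are thereby excluded, so that an edge can be recovered from its two ends,
  as \<open>earth_map_tiling\<close> demands.\<close>

lemma no_parallel_darts:
  assumes d: "d \<in> D" "d' \<in> D" and org: "org d = org d'" "org (n d) = org (n d')"
  shows "d = d'"
proof -
  obtain p where p: "p \<in> model" "d = place p" by (rule place_surjE[OF d(1)])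
  obtain p' where p': "p' \<in> model" "d' = place p'" by (rule place_surjE[OF d(2)])
  have "dart_vertex p = dart_vertex p'"
    using dart_label_eq_iff[OF d, THEN iffD2, OF org(1)]
    unfolding p(2) p'(2) dart_label_place[OF p(1)] dart_label_place[OF p'(1)] .
  moreover have "dart_vertex (model_n p) = dart_vertex (model_n p')"
    using dart_label_eq_iff[OF n_D[OF d(1)] n_D[OF d(2)], THEN iffD2, OF org(2)]
    unfolding p(2) p'(2) dart_label_n[OF p(1)] dart_label_n[OF p'(1)] .
  ultimately have "decode (dart_vertex p) (dart_vertex (model_n p)) = decode (dart_vertex p') (dart_vertex (model_n p'))"
    by simp
  then have "p = p'" unfolding decode[OF p(1)] decode[OF p'(1)] .
  then show ?thesis unfolding p(2) p'(2) by simp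
qed

lemma ix_simps: "i < k \<Longrightarrow> ix (int i) = i" "ix (int i + 1) = (i + 1) mod k" "ix (1 + int i) = (i + 1) mod k"
  by (simp_all add: ix_def nat_mod_as_int add.commute)

lemma earth_edges_model: "earth_edges k = (\<lambda>p. {dart_vertex p, dart_vertex (model_n p)}) ` model"
proof
  have 1: "e \<in> (\<lambda>p. {dart_vertex p, dart_vertex (model_n p)}) ` model" if "e = {dart_vertex (c, i, m), dart_vertex (model_n (c, i, m))}" "(c, i, m) \<in> model" for e c i m
    unfolding that(1) using that(2) by (rule imageI)
  show "earth_edges k \<subseteq> (\<lambda>p. {dart_vertex p, dart_vertex (model_n p)}) ` model"
  proof
    fix e assume "e \<in> earth_edges k"
    then obtain i where i: "i < k" "e \<in> (let j = (i + 1) mod k in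
        {{North_Pole, VX i}, {VX i, VY i}, {VX i, VY' i}, {VY' i, VY j}, {VY i, VZ i},
         {VY' i, VZ' i}, {VZ i, VZ' i}, {VZ i, VW i}, {VZ' i, VW j}, {VW i, South_Pole}})"
      by (auto simp: earth_edges_def)
    note s = model_def model_n_def dart_vertex_simps ix_simps(1)[OF i(1)] ix_simps(2,3) i(1)
    show "e \<in> (\<lambda>p. {dart_vertex p, dart_vertex (model_n p)}) ` model"
      using i(2) 1[of e 0 "int i" 0] 1[of e 1 "int i" 0] 1[of e 0 "int i" 1] 1[of e 0 "int i" 2] 1[of e 1 "int i" 1]
        1[of e 1 "int i" 2] 1[of e 1 "int i" 3] 1[of e 3 "int i" 3] 1[of e 2 "int i" 2] 1[of e 3 "int i" 4]
      unfolding Let_def insert_iff empty_iff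
      by (elim disjE) (simp_all add: s insert_commute flip: numeral_2_eq_2)
  qed
  show "(\<lambda>p. {dart_vertex p, dart_vertex (model_n p)}) ` model \<subseteq> earth_edges k"
  proof (intro image_subsetI)
    fix p assume "p \<in> model"
    then obtain c i m where p: "p = (c, i, m)" "0 \<le> i" "i < int k"
      "c \<in> {0, 1, 2, 3}" "m \<in> {0, 1, 2, 3, 4}"
      by (elim modelE)
    define l where "l = nat i"
    have l: "i = int l" "l < k" using p by (auto simp: l_def)
    have E: "{North_Pole, VX j} \<in> earth_edges k" "{VX j, VY j} \<in> earth_edges k" "{VX j, VY' j} \<in> earth_edges k"
      "{VY' j, VY ((j + 1) mod k)} \<in> earth_edges k" "{VY j, VZ j} \<in> earth_edges k" "{VY' j, VZ' j} \<in> earth_edges k"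
      "{VZ j, VZ' j} \<in> earth_edges k" "{VZ j, VW j} \<in> earth_edges k" "{VZ' j, VW ((j + 1) mod k)} \<in> earth_edges k"
      "{VW j, South_Pole} \<in> earth_edges k" "{VX j, North_Pole} \<in> earth_edges k" "{VY j, VX j} \<in> earth_edges k"
      "{VY' j, VX j} \<in> earth_edges k" "{VY ((j + 1) mod k), VY' j} \<in> earth_edges k" "{VZ j, VY j} \<in> earth_edges k"
      "{VZ' j, VY' j} \<in> earth_edges k" "{VZ' j, VZ j} \<in> earth_edges k" "{VW j, VZ j} \<in> earth_edges k"
      "{VW ((j + 1) mod k), VZ' j} \<in> earth_edges k" "{South_Pole, VW j} \<in> earth_edges k" if "j < k" for j
      unfolding earth_edges_def Let_def using that
      by (intro UN_I[of j]; simp add: doubleton_eq_iff)+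
    have l': "(l + 1) mod k < k" using k_pos by simp
    show "{dart_vertex p, dart_vertex (model_n p)} \<in> earth_edges k"
      using p(4,5) unfolding p(1) l(1)
      by (elim insertE emptyE; simp add: model_n_def dart_vertex_simps ix_simps(1)[OF l(2)] ix_simps(2,3)
          E[OF l(2), simplified] E[OF l', simplified] flip: numeral_2_eq_2)
  qed
qed

lemma earth_edges_darts: "earth_edges k = (\<lambda>d. {dart_label d, dart_label (n d)}) ` D"
proof -
  have "(\<lambda>d. {dart_label d, dart_label (n d)}) ` D = (\<lambda>d. {dart_label d, dart_label (n d)}) ` place ` model"
    using place_bij by (simp add: bij_betw_def)
  also have "\<dots> = earth_edges k"
    unfolding earth_edges_model image_image
    by (rule image_cong) (simp_all add: dart_label_place dart_label_n)
  finally show ?thesis ..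
qed

lemma position_edges: "(\<lambda>e. position ` e) ` earth_edges k = (\<lambda>d. {org d, org (n d)}) ` D"
  unfolding earth_edges_darts image_image
  by (rule image_cong) (simp_all add: position_dart_label n_D)

end

section \<open>Arcs and Jordan curves in the plane\<close>

text \<open>The inverse of the arc embeds its interior into the real axis of the complex plane. By
  invariance of domain the image is open, but every ball around a real point contains points off the
  axis.\<close>

lemma interior_arc_image:
  fixes g :: "real \<Rightarrow> complex"
  assumes "arc g"
  shows "interior (path_image g) = {}"
proof (rule ccontr)
  let ?U = "interior (path_image g)"
  assume ne: "?U \<noteq> {}"
  obtain h where h: "homeomorphism {0..1} (path_image g) g h"
    using homeomorphism_arc[OF assms] by blast
  have sub: "?U \<subseteq> path_image g" by (rule interior_subset)
  have "open ((\<lambda>z. complex_of_real (h z)) ` ?U)"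
  proof (rule invariance_of_domain)
    show "continuous_on ?U (\<lambda>z. complex_of_real (h z))"
      using homeomorphism_cont2[OF h] sub by (intro continuous_intros) (rule continuous_on_subset)
    show "inj_on (\<lambda>z. complex_of_real (h z)) ?U"
    proof (rule inj_onI)
      fix x y assume "x \<in> ?U" "y \<in> ?U" "complex_of_real (h x) = complex_of_real (h y)"
      then have "x \<in> path_image g" "y \<in> path_image g" "h x = h y" using sub by auto
      then show "x = y" using homeomorphism_apply2[OF h] by metis
    qed
  qed simp
  moreover obtain z where "z \<in> ?U" using ne by blast
  ultimately obtain e where e: "e > 0" "ball (complex_of_real (h z)) e \<subseteq> (\<lambda>z. complex_of_real (h z)) ` ?U"
    by (metis image_eqI openE)
  have "complex_of_real (h z) + \<i> * of_real (e / 2) \<in> ball (complex_of_real (h z)) e"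
    using e(1) by (simp add: dist_norm norm_mult)
  then obtain x where "complex_of_real (h z) + \<i> * of_real (e / 2) = complex_of_real (h x)"
    using e(2) by blast
  then have "e / 2 = 0" by (metis Im_complex_of_real Im_i_times add.left_neutral plus_complex.sel(2) Re_complex_of_real)
  then show False using e(1) by simp
qed

lemma interior_Union_closed:
  assumes "finite F" "\<And>S. S \<in> F \<Longrightarrow> closed S \<and> interior S = {}"
  shows "interior (\<Union>F) = {}"
  using assms
proof (induction F)
  case (insert S F)
  then have "interior (S \<union> \<Union>F) = interior S"
    by (intro interior_closed_Un_empty_interior) auto
  then show ?case using insert by simp
qed simp

lemma continuous_at_closure_const:
  fixes f :: "'a::metric_space \<Rightarrow> 'b::t1_space"
  assumes "continuous (at z) f" "z \<in> closure A" "\<And>x. x \<in> A \<Longrightarrow> f x = c"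
  shows "f z = c"
proof (rule ccontr)
  assume ne: "f z \<noteq> c"
  obtain U where U: "open U" "f z \<in> U" "c \<notin> U" using t1_space[OF ne] by blast
  from assms(1)[unfolded continuous_at_open, rule_format, OF conjI[OF U(1,2)]]
  obtain S where S: "open S" "z \<in> S" "\<And>x. x \<in> S \<Longrightarrow> f x \<in> U" by blast
  then obtain x where "x \<in> A" "x \<in> S" using assms(2) closure_iff_nhds_not_empty[of z A] by blast
  then show False using S(3)[of x] assms(3)[of x] U(3) by simp
qed

text \<open>Closing \<open>U\<close> adds only points of the curve, so \<open>U\<close> is open and
  closed in the complement of the curve, hence one of its two components.\<close>

lemma Jordan_component:
  fixes c :: "real \<Rightarrow> complex"
  assumes c: "simple_path c" "pathfinish c = pathstart c"
    and U: "open U" "connected U" "U \<noteq> {}" "closure U - U = path_image c"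
  shows "U = inside (path_image c) \<or> U = outside (path_image c)"
proof -
  let ?I = "inside (path_image c)" and ?O = "outside (path_image c)"
  note J = Jordan_inside_outside[OF c]
  have disj: "U \<inter> path_image c = {}" using U(4) by blast
  have sub: "U \<subseteq> ?I \<union> ?O" using J disj by blast
  have clopen: "S \<subseteq> U" if "connected S" "S \<inter> path_image c = {}" "S \<inter> U \<noteq> {}" for S
  proof (rule ccontr)
    assume "\<not> S \<subseteq> U"
    moreover have "S \<subseteq> U \<union> - closure U" using that U(4) by blast
    ultimately show False
      using connectedD[OF that(1) U(1), of "- closure U"] that(3) closure_subset[of U] by auto
  qed
  have "U \<subseteq> ?I \<or> U \<subseteq> ?O"
    using connectedD[OF U(2), of ?I ?O] J sub by blast
  then show ?thesis
  proof
    assume *: "U \<subseteq> ?I"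
    have "?I \<subseteq> U" by (rule clopen) (use J * U(3) in \<open>auto simp: inside_no_overlap\<close>)
    then show ?thesis using * by auto
  next
    assume *: "U \<subseteq> ?O"
    have "?O \<subseteq> U" by (rule clopen) (use J * U(3) in \<open>auto simp: outside_no_overlap\<close>)
    then show ?thesis using * by auto
  qed
qed

lemma length5E:
  assumes "length xs = 5"
  obtains a b c d e where "xs = [a, b, c, d, e]"
proof -
  have "length xs = Suc (Suc (Suc (Suc (Suc 0))))" using assms by simp
  then show thesis using that unfolding length_Suc_conv length_0_conv by blast
qed

lemma all_less5: "(\<forall>i<5. P (i::nat)) \<longleftrightarrow> P 0 \<and> P 1 \<and> P 2 \<and> P 3 \<and> P 4"
proof -
  have "i < 5 \<longleftrightarrow> i \<in> {0, 1, 2, 3, 4}" for i :: nat by auto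
  then have "(\<forall>i<5. P i) \<longleftrightarrow> (\<forall>i\<in>{0, 1, 2, 3, 4}. P i)" by blast
  then show ?thesis by simp
qed

section \<open>Pentagonal graphs in the plane\<close>

text \<open>A dart \<open>(e, b)\<close> is the edge \<open>e\<close>, directed along the arc \<open>G e\<close> if \<open>b\<close> holds and against it otherwise.\<close>

locale plane_pentagons =
  fixes V :: "complex set" and Es :: "'e set" and G :: "'e \<Rightarrow> real \<Rightarrow> complex"
    and Rs :: "'r set" and R :: "'r \<Rightarrow> complex set"
  assumes finite_V: "finite V" and finite_Es: "finite Es"
    and arc_G: "e \<in> Es \<Longrightarrow> arc (G e)"
    and G_V: "e \<in> Es \<Longrightarrow> path_image (G e) \<inter> V = {pathstart (G e), pathfinish (G e)}"
    and G_Int: "e \<in> Es \<Longrightarrow> e' \<in> Es \<Longrightarrow> e \<noteq> e' \<Longrightarrow> path_image (G e) \<inter> path_image (G e') \<subseteq> V"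
    and R_open: "r \<in> Rs \<Longrightarrow> open (R r)"
    and R_connected: "r \<in> Rs \<Longrightarrow> connected (R r)"
    and R_nonempty: "r \<in> Rs \<Longrightarrow> R r \<noteq> {}"
    and R_disjoint: "r \<in> Rs \<Longrightarrow> r' \<in> Rs \<Longrightarrow> r \<noteq> r' \<Longrightarrow> R r \<inter> R r' = {}"
    and R_cover: "(\<Union>r\<in>Rs. R r) = - (V \<union> (\<Union>e\<in>Es. path_image (G e)))"
    and boundary: "r \<in> Rs \<Longrightarrow> \<exists>vs es. length vs = 5 \<and> distinct vs \<and> length es = 5 \<and> distinct es \<and> set es \<subseteq> Es \<and>
      (\<forall>i<5. path_image (G (es ! i)) \<inter> V = {vs ! i, vs ! ((i + 1) mod 5)}) \<and>
      closure (R r) - R r = (\<Union>e\<in>set es. path_image (G e))"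
    and incident: "v \<in> V \<Longrightarrow> \<exists>e\<in>Es. v \<in> path_image (G e)"
begin

definition darts :: "('e \<times> bool) set" where
  "darts = Es \<times> UNIV"

definition opp :: "'e \<times> bool \<Rightarrow> 'e \<times> bool" where
  "opp d = (fst d, \<not> snd d)"

definition org :: "'e \<times> bool \<Rightarrow> complex" where
  "org d = (if snd d then pathstart (G (fst d)) else pathfinish (G (fst d)))"

definition \<gamma> :: "'e \<times> bool \<Rightarrow> real \<Rightarrow> complex" where
  "\<gamma> d = (if snd d then G (fst d) else reversepath (G (fst d)))"

lemma opp_opp [simp]: "opp (opp d) = d" by (simp add: opp_def)
lemma fst_opp [simp]: "fst (opp d) = fst d" by (simp add: opp_def)
lemma opp_neq [simp]: "opp d \<noteq> d" "d \<noteq> opp d" by (cases d; simp add: opp_def)+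
lemma opp_darts [simp]: "opp d \<in> darts \<longleftrightarrow> d \<in> darts" by (cases d) (simp add: opp_def darts_def)
lemma fst_eq_iff: "fst d = fst d' \<longleftrightarrow> d' = d \<or> d' = opp d" by (cases d; cases d') (auto simp: opp_def)
lemma fst_darts: "d \<in> darts \<Longrightarrow> fst d \<in> Es" by (auto simp: darts_def)
lemma finite_darts: "finite darts" by (simp add: darts_def finite_Es)

lemma pathstart_\<gamma> [simp]: "pathstart (\<gamma> d) = org d"
  by (simp add: \<gamma>_def org_def)
lemma pathfinish_\<gamma> [simp]: "pathfinish (\<gamma> d) = org (opp d)"
  by (simp add: \<gamma>_def org_def opp_def)
lemma path_image_\<gamma> [simp]: "path_image (\<gamma> d) = path_image (G (fst d))"
  by (simp add: \<gamma>_def)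
lemma arc_\<gamma>: "d \<in> darts \<Longrightarrow> arc (\<gamma> d)"
  using arc_G[OF fst_darts] by (simp add: \<gamma>_def arc_reversepath)
lemma path_\<gamma>: "d \<in> darts \<Longrightarrow> path (\<gamma> d)"
  by (simp add: arc_\<gamma> arc_imp_path)
lemma org_neq: "d \<in> darts \<Longrightarrow> org (opp d) \<noteq> org d"
  using arc_distinct_ends[OF arc_\<gamma>, of d] by simp
lemma edge_V: "d \<in> darts \<Longrightarrow> path_image (G (fst d)) \<inter> V = {org d, org (opp d)}"
  using G_V[OF fst_darts, of d] by (auto simp: org_def opp_def)
lemma org_in_V: "d \<in> darts \<Longrightarrow> org d \<in> V"
  using edge_V by blast

text \<open>Interior in the sense of the edge, not of the plane. Such a point determines its edge,
  since distinct edges meet only in vertices.\<close>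

definition interior_point :: "'e \<Rightarrow> complex \<Rightarrow> bool" where
  "interior_point e z \<longleftrightarrow> z \<in> path_image (G e) \<and> z \<notin> V"

lemma interior_point_unique:
  "interior_point e z \<Longrightarrow> e \<in> Es \<Longrightarrow> e' \<in> Es \<Longrightarrow> z \<in> path_image (G e') \<Longrightarrow> e' = e"
  using G_Int[of e e'] by (auto simp: interior_point_def)

text \<open>Nearness to the origin places these points inside the small punctured disc used for the
  link of a vertex.\<close>

lemma interior_points_near_org:
  assumes "d \<in> darts" "0 < \<epsilon>"
  obtains z where "interior_point (fst d) z" "dist (org d) z < \<epsilon>"
proof -
  have "continuous_on {0..1} (\<gamma> d)" using path_\<gamma>[OF assms(1)] by (simp add: path_def)
  then have "\<exists>\<delta>>0. \<forall>x'\<in>{0..1}. dist x' 0 < \<delta> \<longrightarrow> dist (\<gamma> d x') (\<gamma> d 0) < \<epsilon>"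
    using assms(2) unfolding continuous_on_iff by force
  then obtain \<delta> where \<delta>: "\<delta> > 0" "\<And>x. 0 \<le> x \<Longrightarrow> x \<le> 1 \<Longrightarrow> dist x 0 < \<delta> \<Longrightarrow> dist (\<gamma> d x) (\<gamma> d 0) < \<epsilon>" by auto
  define x where "x = min (\<delta> / 2) (1 / 2)"
  have x: "0 < x" "x < 1" "dist x 0 < \<delta>" using \<delta>(1) by (auto simp: x_def)
  have inj: "inj_on (\<gamma> d) {0..1}" using arc_\<gamma>[OF assms(1)] by (simp add: arc_def)
  have img: "\<gamma> d x \<in> path_image (G (fst d))"
    using x path_image_\<gamma>[of d] unfolding path_image_def by force
  have "\<gamma> d x \<noteq> \<gamma> d 0" "\<gamma> d x \<noteq> \<gamma> d 1"
    using x inj_onD[OF inj, of x 0] inj_onD[OF inj, of x 1] by auto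
  then have "\<gamma> d x \<noteq> org d" "\<gamma> d x \<noteq> org (opp d)"
    using pathstart_\<gamma>[of d] pathfinish_\<gamma>[of d] by (auto simp: pathstart_def pathfinish_def)
  then have "interior_point (fst d) (\<gamma> d x)"
    using img edge_V[OF assms(1)] unfolding interior_point_def by blast
  moreover have "dist (org d) (\<gamma> d x) < \<epsilon>"
    using \<delta>(2)[of x] x pathstart_\<gamma>[of d] by (simp add: pathstart_def dist_commute)
  ultimately show thesis by (rule that)
qed

lemma interior_point_exists: "e \<in> Es \<Longrightarrow> \<exists>z. interior_point e z"
  using interior_points_near_org[of "(e, True)" 1] by (auto simp: darts_def)

section \<open>Oriented tile boundaries and winding numbers\<close>

definition face_list :: "'r \<Rightarrow> ('e \<times> bool) list \<Rightarrow> bool" where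
  "face_list r ds \<longleftrightarrow> length ds = 5 \<and> set ds \<subseteq> darts \<and> distinct (map org ds) \<and> distinct (map fst ds) \<and>
     (\<forall>i<5. org (opp (ds ! i)) = org (ds ! ((i + 1) mod 5))) \<and>
     closure (R r) - R r = (\<Union>d\<in>set ds. path_image (G (fst d)))"

lemma face_list5:
  "face_list r [a, b, c, d, e] \<longleftrightarrow> {a, b, c, d, e} \<subseteq> darts \<and> distinct [org a, org b, org c, org d, org e] \<and>
     distinct [fst a, fst b, fst c, fst d, fst e] \<and>
     org (opp a) = org b \<and> org (opp b) = org c \<and> org (opp c) = org d \<and> org (opp d) = org e \<and> org (opp e) = org a \<and>
     closure (R r) - R r = (\<Union>d\<in>{a, b, c, d, e}. path_image (G (fst d)))"
  unfolding face_list_def all_less5 by simp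

lemma face_list_exists:
  assumes "r \<in> Rs"
  shows "\<exists>ds. face_list r ds"
proof -
  from boundary[OF assms] obtain vs es where *: "length vs = 5" "distinct vs" "length es = 5" "distinct es" "set es \<subseteq> Es"
      "\<forall>i<5. path_image (G (es ! i)) \<inter> V = {vs ! i, vs ! ((i + 1) mod 5)}"
      "closure (R r) - R r = (\<Union>e\<in>set es. path_image (G e))" by blast
  obtain v0 v1 v2 v3 v4 where v: "vs = [v0, v1, v2, v3, v4]" using length5E[OF *(1)] .
  obtain e0 e1 e2 e3 e4 where e: "es = [e0, e1, e2, e3, e4]" using length5E[OF *(3)] .
  have ev: "path_image (G e0) \<inter> V = {v0, v1}" "path_image (G e1) \<inter> V = {v1, v2}"
      "path_image (G e2) \<inter> V = {v2, v3}" "path_image (G e3) \<inter> V = {v3, v4}" "path_image (G e4) \<inter> V = {v4, v0}"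
    using *(6) unfolding all_less5 v e by simp_all
  have "\<exists>d. fst d = e' \<and> d \<in> darts \<and> org d = u \<and> org (opp d) = u'"
    if "e' \<in> Es" "path_image (G e') \<inter> V = {u, u'}" "u \<noteq> u'" for e' u u'
  proof -
    have "{pathstart (G e'), pathfinish (G e')} = {u, u'}" using G_V[OF that(1)] that(2) by simp
    then have "org (e', True) = u \<and> org (opp (e', True)) = u' \<or> org (e', False) = u \<and> org (opp (e', False)) = u'"
      by (auto simp: org_def opp_def doubleton_eq_iff)
    then show ?thesis using that(1) by (auto simp: darts_def)
  qed
  note ex = this
  have dv: "v0 \<noteq> v1" "v1 \<noteq> v2" "v2 \<noteq> v3" "v3 \<noteq> v4" "v4 \<noteq> v0" using *(2) v by auto
  have de: "e0 \<in> Es" "e1 \<in> Es" "e2 \<in> Es" "e3 \<in> Es" "e4 \<in> Es" using *(5) e by auto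
  obtain d0 where d0: "fst d0 = e0 \<and> d0 \<in> darts \<and> org d0 = v0 \<and> org (opp d0) = v1" using ex[OF de(1) ev(1) dv(1)] by blast
  obtain d1 where d1: "fst d1 = e1 \<and> d1 \<in> darts \<and> org d1 = v1 \<and> org (opp d1) = v2" using ex[OF de(2) ev(2) dv(2)] by blast
  obtain d2 where d2: "fst d2 = e2 \<and> d2 \<in> darts \<and> org d2 = v2 \<and> org (opp d2) = v3" using ex[OF de(3) ev(3) dv(3)] by blast
  obtain d3 where d3: "fst d3 = e3 \<and> d3 \<in> darts \<and> org d3 = v3 \<and> org (opp d3) = v4" using ex[OF de(4) ev(4) dv(4)] by blast
  obtain d4 where d4: "fst d4 = e4 \<and> d4 \<in> darts \<and> org d4 = v4 \<and> org (opp d4) = v0" using ex[OF de(5) ev(5) dv(5)] by blast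
  have "face_list r [d0, d1, d2, d3, d4]"
    unfolding face_list5 using d0 d1 d2 d3 d4 *(2,4,7) v e by auto
  then show ?thesis by blast
qed

lemma face_list_reverse:
  assumes "face_list r ds"
  shows "face_list r (rev (map opp ds))"
proof -
  have "length ds = 5" using assms by (simp add: face_list_def)
  then obtain a b c d e where ds: "ds = [a, b, c, d, e]" by (rule length5E)
  note f = assms[unfolded ds face_list5]
  have "face_list r [opp e, opp d, opp c, opp b, opp a]"
    unfolding face_list5
  proof (intro conjI)
    show "{opp e, opp d, opp c, opp b, opp a} \<subseteq> darts" using f by simp
    show "distinct [org (opp e), org (opp d), org (opp c), org (opp b), org (opp a)]" using f by simp metis
    show "distinct [fst (opp e), fst (opp d), fst (opp c), fst (opp b), fst (opp a)]" using f by simp metis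
    show "closure (R r) - R r = (\<Union>d\<in>{opp e, opp d, opp c, opp b, opp a}. path_image (G (fst d)))"
      using f by (simp add: Un_ac)
  qed (use f in simp_all)
  then show ?thesis by (simp add: ds)
qed

text \<open>The summands are winding numbers of arcs and in general no integers; integrality holds
  for closed walks. Splitting the sum by edges allows the contribution of one edge to be
  isolated.\<close>

definition W :: "('e \<times> bool) list \<Rightarrow> complex \<Rightarrow> complex" where
  "W ds z = (\<Sum>d\<leftarrow>ds. winding_number (\<gamma> d) z)"

lemma winding_number_opp:
  "d \<in> darts \<Longrightarrow> z \<notin> path_image (G (fst d)) \<Longrightarrow> winding_number (\<gamma> (opp d)) z = - winding_number (\<gamma> d) z"
proof -
  assume d: "d \<in> darts" and z: "z \<notin> path_image (G (fst d))"
  have "path (G (fst d))" using arc_G[OF fst_darts[OF d]] by (rule arc_imp_path)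
  from winding_number_reversepath[OF this z] show ?thesis
    by (cases "snd d") (simp_all add: \<gamma>_def opp_def)
qed

text \<open>The sides meet only in vertices, and the five vertices are distinct, so consecutive
  sides share one point and other pairs none. The joined path is therefore a Jordan curve.\<close>

lemma loop_of_face:
  assumes "face_list r ds"
  obtains c where "simple_path c" "pathfinish c = pathstart c" "path_image c = (\<Union>d\<in>set ds. path_image (G (fst d)))"
    "\<forall>z. z \<notin> path_image c \<longrightarrow> winding_number c z = W ds z"
proof -
  have "length ds = 5" using assms by (simp add: face_list_def)
  then obtain d0 d1 d2 d3 d4 where ds: "ds = [d0, d1, d2, d3, d4]" by (rule length5E)
  from assms[unfolded ds face_list5]
  have D: "d0 \<in> darts" "d1 \<in> darts" "d2 \<in> darts" "d3 \<in> darts" "d4 \<in> darts"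
    and dist: "distinct [org d0, org d1, org d2, org d3, org d4]"
    and fd: "distinct [fst d0, fst d1, fst d2, fst d3, fst d4]"
    and hd: "org (opp d0) = org d1" "org (opp d1) = org d2" "org (opp d2) = org d3" "org (opp d3) = org d4" "org (opp d4) = org d0"
    by auto
  have I: "path_image (G (fst d)) \<inter> path_image (G (fst d')) \<subseteq> {org d, org (opp d)} \<inter> {org d', org (opp d')}"
    if "d \<in> darts" "d' \<in> darts" "fst d \<noteq> fst d'" for d d'
    using G_Int[OF fst_darts[OF that(1)] fst_darts[OF that(2)] that(3)] edge_V[OF that(1)] edge_V[OF that(2)] by blast
  have fne: "fst d0 \<noteq> fst d1" "fst d0 \<noteq> fst d2" "fst d0 \<noteq> fst d3" "fst d0 \<noteq> fst d4" "fst d1 \<noteq> fst d2"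
      "fst d1 \<noteq> fst d3" "fst d1 \<noteq> fst d4" "fst d2 \<noteq> fst d3" "fst d2 \<noteq> fst d4" "fst d3 \<noteq> fst d4"
    using fd by simp_all
  have vne: "org d0 \<noteq> org d1" "org d0 \<noteq> org d2" "org d0 \<noteq> org d3" "org d0 \<noteq> org d4" "org d1 \<noteq> org d2"
      "org d1 \<noteq> org d3" "org d1 \<noteq> org d4" "org d2 \<noteq> org d3" "org d2 \<noteq> org d4" "org d3 \<noteq> org d4"
    using dist by simp_all
  have I01: "path_image (G (fst d0)) \<inter> path_image (G (fst d1)) \<subseteq> {org d1}"
    using I[OF D(1) D(2) fne(1)] vne unfolding hd by auto
  have I02: "path_image (G (fst d0)) \<inter> path_image (G (fst d2)) \<subseteq> {}"
    using I[OF D(1) D(3) fne(2)] vne unfolding hd by auto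
  have I03: "path_image (G (fst d0)) \<inter> path_image (G (fst d3)) \<subseteq> {}"
    using I[OF D(1) D(4) fne(3)] vne unfolding hd by auto
  have I04: "path_image (G (fst d0)) \<inter> path_image (G (fst d4)) \<subseteq> {org d0}"
    using I[OF D(1) D(5) fne(4)] vne unfolding hd by auto
  have I12: "path_image (G (fst d1)) \<inter> path_image (G (fst d2)) \<subseteq> {org d2}"
    using I[OF D(2) D(3) fne(5)] vne unfolding hd by auto
  have I13: "path_image (G (fst d1)) \<inter> path_image (G (fst d3)) \<subseteq> {}"
    using I[OF D(2) D(4) fne(6)] vne unfolding hd by auto
  have I14: "path_image (G (fst d1)) \<inter> path_image (G (fst d4)) \<subseteq> {}"
    using I[OF D(2) D(5) fne(7)] vne unfolding hd by auto
  have I23: "path_image (G (fst d2)) \<inter> path_image (G (fst d3)) \<subseteq> {org d3}"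
    using I[OF D(3) D(4) fne(8)] vne unfolding hd by auto
  have I24: "path_image (G (fst d2)) \<inter> path_image (G (fst d4)) \<subseteq> {}"
    using I[OF D(3) D(5) fne(9)] vne unfolding hd by auto
  have I34: "path_image (G (fst d3)) \<inter> path_image (G (fst d4)) \<subseteq> {org d4}"
    using I[OF D(4) D(5) fne(10)] vne unfolding hd by auto
  define c3 where "c3 = \<gamma> d3 +++ \<gamma> d4"
  define c2 where "c2 = \<gamma> d2 +++ c3"
  define c1 where "c1 = \<gamma> d1 +++ c2"
  define c where "c = \<gamma> d0 +++ c1"
  have [simp]: "pathstart c3 = org d3" "pathfinish c3 = org d0" "pathstart c2 = org d2" "pathfinish c2 = org d0"
    "pathstart c1 = org d1" "pathfinish c1 = org d0" "pathstart c = org d0" "pathfinish c = org d0"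
    by (simp_all add: c_def c1_def c2_def c3_def hd)
  have p3: "path_image c3 = path_image (G (fst d3)) \<union> path_image (G (fst d4))"
    by (simp add: c3_def path_image_join hd)
  have p2: "path_image c2 = path_image (G (fst d2)) \<union> path_image c3"
    by (simp add: c2_def path_image_join hd)
  have p1: "path_image c1 = path_image (G (fst d1)) \<union> path_image c2"
    by (simp add: c1_def path_image_join hd)
  have p0: "path_image c = path_image (G (fst d0)) \<union> path_image c1"
    by (simp add: c_def path_image_join hd)
  have a3: "arc c3" unfolding c3_def using I34 by (intro arc_join arc_\<gamma> D) (simp_all add: hd)
  have a2: "arc c2" unfolding c2_def using I23 I24 a3 by (intro arc_join arc_\<gamma> D) (auto simp: hd p3)
  have a1: "arc c1" unfolding c1_def using I12 I13 I14 a2 by (intro arc_join arc_\<gamma> D) (auto simp: hd p2 p3)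
  have a0: "simple_path c" unfolding c_def using I01 I02 I03 I04 a1
    by (intro simple_path_join_loop arc_\<gamma> D) (auto simp: hd p1 p2 p3)
  show thesis
  proof (rule that[OF a0])
    show "pathfinish c = pathstart c" by simp
    show "path_image c = (\<Union>d\<in>set ds. path_image (G (fst d)))" by (simp add: ds p0 p1 p2 p3)
    show "\<forall>z. z \<notin> path_image c \<longrightarrow> winding_number c z = W ds z"
    proof (intro allI impI)
    fix z assume z: "z \<notin> path_image c"
    then have z': "z \<notin> path_image (G (fst d0))" "z \<notin> path_image (G (fst d1))" "z \<notin> path_image (G (fst d2))"
      "z \<notin> path_image (G (fst d3))" "z \<notin> path_image (G (fst d4))" "z \<notin> path_image c1" "z \<notin> path_image c2" "z \<notin> path_image c3"
      by (simp_all add: p0 p1 p2 p3)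
    have "winding_number c z = winding_number (\<gamma> d0) z + winding_number c1 z"
      unfolding c_def using z' a1 D by (intro winding_number_join) (simp_all add: hd path_\<gamma> arc_imp_path)
    moreover have "winding_number c1 z = winding_number (\<gamma> d1) z + winding_number c2 z"
      unfolding c1_def using z' a2 D by (intro winding_number_join) (simp_all add: hd path_\<gamma> arc_imp_path)
    moreover have "winding_number c2 z = winding_number (\<gamma> d2) z + winding_number c3 z"
      unfolding c2_def using z' a3 D by (intro winding_number_join) (simp_all add: hd path_\<gamma> arc_imp_path)
    moreover have "winding_number c3 z = winding_number (\<gamma> d3) z + winding_number (\<gamma> d4) z"
      unfolding c3_def using z' D by (intro winding_number_join) (simp_all add: hd path_\<gamma>)
    ultimately show "winding_number c z = W ds z" by (simp add: W_def ds)
    qed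
  qed
qed

text \<open>The orientation is normalised by the jump into the tile. The constant \<open>c\<close>
  is 0 if the tile is the bounded side of its boundary and -1 if it is the unbounded side, so both
  cases are treated alike.\<close>

definition positive_face :: "'r \<Rightarrow> ('e \<times> bool) list \<Rightarrow> bool" where
  "positive_face r ds \<longleftrightarrow> face_list r ds \<and>
     (\<exists>c. (\<forall>z\<in>R r. W ds z = c + 1) \<and> (\<forall>z. z \<notin> closure (R r) \<longrightarrow> W ds z = c))"

lemma face_in_out:
  assumes "r \<in> Rs" "face_list r ds"
  shows "R r = inside (\<Union>d\<in>set ds. path_image (G (fst d))) \<or> R r = outside (\<Union>d\<in>set ds. path_image (G (fst d)))"
proof -
  obtain c where c: "simple_path c" "pathfinish c = pathstart c" "path_image c = (\<Union>d\<in>set ds. path_image (G (fst d)))"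
    by (rule loop_of_face[OF assms(2)])
  show ?thesis unfolding c(3)[symmetric]
    using assms(2) c(3) by (intro Jordan_component c R_open R_connected R_nonempty assms(1)) (simp add: face_list_def)
qed

lemma positive_face_exists:
  assumes r: "r \<in> Rs"
  shows "\<exists>ds. positive_face r ds"
proof -
  obtain ds where ds: "face_list r ds" using face_list_exists[OF r] by blast
  obtain c where c: "simple_path c" "pathfinish c = pathstart c" "path_image c = (\<Union>d\<in>set ds. path_image (G (fst d)))"
    and c4: "\<forall>z. z \<notin> path_image c \<longrightarrow> winding_number c z = W ds z"
    by (rule loop_of_face[OF ds])
  let ?B = "path_image c"
  have un: "inside ?B \<union> outside ?B = - ?B" using Jordan_inside_outside[OF c(1,2)] by (elim conjE)
  have Bd: "closure (R r) - R r = ?B" unfolding c(3) using ds unfolding face_list_def by (elim conjE)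
  from Bd have cl: "closure (R r) = R r \<union> ?B" using closure_subset[of "R r"] by blast
  have io: "R r = inside ?B \<or> R r = outside ?B" unfolding c(3) by (rule face_in_out[OF r ds])
  have disj: "inside ?B \<inter> ?B = {}" "outside ?B \<inter> ?B = {}" by (simp_all add: inside_no_overlap outside_no_overlap)
  have in_W: "winding_number c z = W ds z" if "z \<in> inside ?B" for z
    using c4 that disj(1) by blast
  obtain s :: complex where s: "s \<in> {1, -1}" "\<And>z. z \<in> inside ?B \<Longrightarrow> W ds z = s"
  proof (rule simple_closed_path_winding_number_inside[OF c(1)])
    assume "\<And>z. z \<in> inside ?B \<Longrightarrow> winding_number c z = 1"
    then show thesis using that[of 1] in_W by simp
  next
    assume "\<And>z. z \<in> inside ?B \<Longrightarrow> winding_number c z = - 1"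
    then show thesis using that[of "- 1"] in_W by simp
  qed
  have out: "\<And>z. z \<in> outside ?B \<Longrightarrow> W ds z = 0"
  proof -
    fix z assume z: "z \<in> outside ?B"
    then have "z \<notin> ?B" using disj(2) by blast
    then show "W ds z = 0"
      using winding_number_zero_in_outside[OF simple_path_imp_path[OF c(1)] c(2) z] c4 by simp
  qed
  have "\<exists>k t. t \<in> {1, -1} \<and> (\<forall>z\<in>R r. W ds z = k + t) \<and> (\<forall>z. z \<notin> closure (R r) \<longrightarrow> W ds z = k)"
    using io
  proof
    assume r_in: "R r = inside ?B"
    have "z \<in> outside ?B" if "z \<notin> closure (R r)" for z using that cl un r_in by blast
    then have "\<forall>z. z \<notin> closure (R r) \<longrightarrow> W ds z = 0" using out by blast
    moreover have "\<forall>z\<in>R r. W ds z = 0 + s" using s(2) r_in by simp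
    ultimately show ?thesis using s(1) by blast
  next
    assume r_out: "R r = outside ?B"
    have "z \<in> inside ?B" if "z \<notin> closure (R r)" for z using that cl un r_out by blast
    then have "\<forall>z. z \<notin> closure (R r) \<longrightarrow> W ds z = s" using s(2) by blast
    moreover have "\<forall>z\<in>R r. W ds z = s + - s" using out r_out by simp
    moreover have "- s \<in> {1, -1}" using s(1) by auto
    ultimately show ?thesis by blast
  qed
  then obtain k t where kt: "t \<in> {1, -1}" "\<And>z. z \<in> R r \<Longrightarrow> W ds z = k + t" "\<And>z. z \<notin> closure (R r) \<Longrightarrow> W ds z = k"
    by blast
  show ?thesis
  proof (cases "t = 1")
    case True
    then show ?thesis using ds kt unfolding positive_face_def by blast
  next
    case False
    then have t: "t = -1" using kt by simp
    have D: "set ds \<subseteq> darts" using ds by (simp add: face_list_def)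
    have "W (rev (map opp ds)) z = - W ds z" if "z \<notin> ?B" for z
    proof -
      have "W (rev (map opp ds)) z = (\<Sum>d\<leftarrow>ds. winding_number (\<gamma> (opp d)) z)"
        unfolding W_def by (simp add: rev_map[symmetric] sum_list_rev o_def)
      also have "\<dots> = (\<Sum>d\<leftarrow>ds. - winding_number (\<gamma> d) z)"
        using that c(3) D by (intro arg_cong[of _ _ sum_list] map_cong refl winding_number_opp) auto
      finally show ?thesis by (simp add: W_def uminus_sum_list_map o_def)
    qed
    moreover have "\<And>z. z \<in> R r \<Longrightarrow> z \<notin> ?B" "\<And>z. z \<notin> closure (R r) \<Longrightarrow> z \<notin> ?B" using Bd by blast+
    ultimately have "(\<forall>z\<in>R r. W (rev (map opp ds)) z = - k + 1) \<and> (\<forall>z. z \<notin> closure (R r) \<longrightarrow> W (rev (map opp ds)) z = - k)"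
      using kt t by auto
    then show ?thesis using face_list_reverse[OF ds] unfolding positive_face_def by blast
  qed
qed

end

section \<open>Every dart lies in exactly one oriented tile\<close>

context plane_pentagons
begin

definition graph :: "complex set" where
  "graph = (\<Union>e\<in>Es. path_image (G e))"

lemma V_graph: "V \<subseteq> graph"
  using incident by (auto simp: graph_def)

lemma R_cover': "(\<Union>r\<in>Rs. R r) = - graph"
  using R_cover V_graph unfolding graph_def by blast

lemma R_graph: "r \<in> Rs \<Longrightarrow> R r \<inter> graph = {}"
  using R_cover' by blast

definition FL :: "'r \<Rightarrow> ('e \<times> bool) list" where
  "FL r = (SOME ds. positive_face r ds)"

lemma positive_FL: "r \<in> Rs \<Longrightarrow> positive_face r (FL r)"
  unfolding FL_def by (rule someI_ex[OF positive_face_exists])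

lemma face_list_FL: "r \<in> Rs \<Longrightarrow> face_list r (FL r)"
  using positive_FL by (simp add: positive_face_def)

lemma FL_facts:
  assumes "r \<in> Rs"
  shows "length (FL r) = 5" "set (FL r) \<subseteq> darts" "distinct (map org (FL r))" "distinct (map fst (FL r))"
    "\<And>i. i < 5 \<Longrightarrow> org (opp (FL r ! i)) = org (FL r ! ((i + 1) mod 5))"
    "closure (R r) - R r = (\<Union>d\<in>set (FL r). path_image (G (fst d)))"
  using face_list_FL[OF assms] unfolding face_list_def by blast+

text \<open>A region is the inside or the outside of the union of its boundary edges, and there are
  only finitely many sets of edges.\<close>

lemma finite_Rs: "finite Rs"
proof (rule finite_imageD)
  let ?B = "\<lambda>F. (\<Union>e\<in>F. path_image (G e))"
  have "R r \<in> (\<lambda>F. inside (?B F)) ` Pow Es \<union> (\<lambda>F. outside (?B F)) ` Pow Es" if "r \<in> Rs" for r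
  proof -
    have "fst ` set (FL r) \<in> Pow Es" using FL_facts(2)[OF that] fst_darts by auto
    moreover have "(\<Union>d\<in>set (FL r). path_image (G (fst d))) = ?B (fst ` set (FL r))" by simp
    ultimately show ?thesis using face_in_out[OF that face_list_FL[OF that]] by (simp only:) blast
  qed
  then show "finite (R ` Rs)"
    using finite_subset[OF image_subsetI[of Rs R "(\<lambda>F. inside (?B F)) ` Pow Es \<union> (\<lambda>F. outside (?B F)) ` Pow Es"]]
      finite_Es by simp
  show "inj_on R Rs"
  proof (rule inj_onI, rule ccontr)
    fix r r' assume "r \<in> Rs" "r' \<in> Rs" "R r = R r'" "r \<noteq> r'"
    then show False using R_disjoint[of r r'] R_nonempty[of r] by simp
  qed
qed

lemma closed_edge: "e \<in> Es \<Longrightarrow> closed (path_image (G e))"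
  by (simp add: arc_G closed_arc_image)

lemma closed_graph: "closed graph"
  unfolding graph_def by (intro closed_UN finite_Es ballI closed_edge)

lemma interior_graph: "interior graph = {}"
  unfolding graph_def
  by (rule interior_Union_closed) (auto simp: finite_Es closed_edge interior_arc_image arc_G)

lemma closure_regions: "A \<subseteq> Rs \<Longrightarrow> closure (\<Union>r\<in>A. R r) \<subseteq> (\<Union>r\<in>A. closure (R r))"
  using finite_Rs closure_subset by (intro closure_minimal closed_UN) (auto intro: finite_subset)

lemma regions_dense: "open S \<Longrightarrow> S \<subseteq> closure (S - graph)"
proof -
  assume "open S"
  then have "S \<inter> closure (- graph) \<subseteq> closure (S \<inter> - graph)" by (rule open_Int_closure_subset)
  then show ?thesis by (simp add: closure_complement interior_graph Diff_eq)
qed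

lemma in_closure_region: "\<exists>r\<in>Rs. z \<in> closure (R r)"
proof -
  have "UNIV \<subseteq> closure (\<Union>r\<in>Rs. R r)"
    using regions_dense[of UNIV] unfolding R_cover' Compl_eq_Diff_UNIV by simp
  also have "\<dots> \<subseteq> (\<Union>r\<in>Rs. closure (R r))" by (rule closure_regions) simp
  finally show ?thesis by blast
qed

lemma interior_point_in_face:
  assumes "r \<in> Rs" "e \<in> Es" "interior_point e z"
  shows "z \<in> closure (R r) \<longleftrightarrow> e \<in> fst ` set (FL r)"
proof
  have z: "z \<in> path_image (G e)" using assms(3) by (simp add: interior_point_def)
  then have "z \<in> graph" using assms(2) by (auto simp: graph_def)
  then have nR: "z \<notin> R r" using R_graph[OF assms(1)] by blast
  {
    assume "z \<in> closure (R r)"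
    then obtain d where d: "d \<in> set (FL r)" "z \<in> path_image (G (fst d))" using FL_facts(6)[OF assms(1)] nR by blast
    then have "fst d \<in> Es" using FL_facts(2)[OF assms(1)] fst_darts by blast
    from interior_point_unique[OF assms(3,2) this d(2)] d(1) show "e \<in> fst ` set (FL r)" by blast
  next
    assume "e \<in> fst ` set (FL r)"
    then show "z \<in> closure (R r)" using FL_facts(6)[OF assms(1)] z by blast
  }
qed

text \<open>The complement of the closed tile is the other side of the Jordan curve and has the same
  frontier. The second fact later supplies a point off a given tile from which to project.\<close>

lemma region_complement:
  assumes r: "r \<in> Rs"
  shows "closure (R r) - R r \<subseteq> closure (- closure (R r))" "closure (R r) \<noteq> UNIV"
proof -
  obtain c where c: "simple_path c" "pathfinish c = pathstart c" "path_image c = (\<Union>d\<in>set (FL r). path_image (G (fst d)))"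
    by (rule loop_of_face[OF face_list_FL[OF r]])
  let ?B = "path_image c" and ?O = "- closure (R r)"
  from Jordan_inside_outside[OF c(1,2)]
  have J: "inside ?B \<union> outside ?B = - ?B" "inside ?B \<inter> outside ?B = {}" "frontier (inside ?B) = ?B" "frontier (outside ?B) = ?B"
    "inside ?B \<noteq> {}" "outside ?B \<noteq> {}"
    by simp_all
  have Bd: "closure (R r) - R r = ?B" using FL_facts(6)[OF r] unfolding c(3) .
  have io: "R r = inside ?B \<or> R r = outside ?B" unfolding c(3) by (rule face_in_out[OF r face_list_FL[OF r]])
  have cl: "closure (R r) = R r \<union> ?B" using Bd closure_subset[of "R r"] by blast
  have O: "?O = inside ?B \<or> ?O = outside ?B"
    using io J(1,2) unfolding cl by blast
  then have "frontier ?O = ?B" using J(3,4) by metis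
  then have "?B \<subseteq> closure ?O" using frontier_def[of ?O] by blast
  then show "closure (R r) - R r \<subseteq> closure ?O" unfolding Bd .
  show "closure (R r) \<noteq> UNIV" using O J(5,6) by auto
qed

text \<open>Arbitrarily close to a boundary point of \<open>r1\<close> there are points outside its
  tile, and among these the points off the graph are dense. As there are only finitely many regions,
  the closure of one of the others contains the point.\<close>

lemma two_faces_at_edge:
  assumes e: "e \<in> Es" and z: "interior_point e z"
  obtains r1 r2 where "r1 \<in> Rs" "r2 \<in> Rs" "r1 \<noteq> r2" "z \<in> closure (R r1)" "z \<in> closure (R r2)"
proof -
  obtain r1 where r1: "r1 \<in> Rs" "z \<in> closure (R r1)" using in_closure_region by blast
  have "z \<in> path_image (G e)" using z by (simp add: interior_point_def)
  then have "z \<in> graph" using e by (auto simp: graph_def)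
  then have "z \<in> closure (R r1) - R r1" using r1 R_graph[OF r1(1)] by blast
  then have "z \<in> closure (- closure (R r1))" using region_complement(1)[OF r1(1)] by blast
  also have "closure (- closure (R r1)) \<subseteq> closure (closure ((- closure (R r1)) - graph))" by (intro closure_mono regions_dense open_Compl closed_closure)
  also have "\<dots> \<subseteq> closure (\<Union>r\<in>Rs - {r1}. R r)"
    unfolding closure_closure
  proof (rule closure_mono)
    show "(- closure (R r1)) - graph \<subseteq> (\<Union>r\<in>Rs - {r1}. R r)"
    proof
      fix y assume y: "y \<in> (- closure (R r1)) - graph"
      then obtain r where "r \<in> Rs" "y \<in> R r" using R_cover' by blast
      moreover have "y \<notin> R r1" using y closure_subset[of "R r1"] by blast
      ultimately show "y \<in> (\<Union>r\<in>Rs - {r1}. R r)" by blast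
    qed
  qed
  also have "\<dots> \<subseteq> (\<Union>r\<in>Rs - {r1}. closure (R r))" by (rule closure_regions) blast
  finally obtain r2 where "r2 \<in> Rs" "r2 \<noteq> r1" "z \<in> closure (R r2)" by blast
  then show thesis using that r1 by blast
qed

text \<open>Reversing an arc negates its winding number, so the passages of a walk through one edge
  combine to their net number.\<close>

lemma W_split:
  assumes "set ds \<subseteq> darts" "z \<notin> path_image (G (fst d))"
  shows "W ds z = of_int (int (count_list ds d) - int (count_list ds (opp d))) * winding_number (\<gamma> d) z
    + W (filter (\<lambda>x. fst x \<noteq> fst d) ds) z"
  using assms(1)
proof (induction ds)
  case (Cons x ds)
  then have IH: "W ds z = of_int (int (count_list ds d) - int (count_list ds (opp d))) * winding_number (\<gamma> d) z
    + W (filter (\<lambda>x. fst x \<noteq> fst d) ds) z" by simp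
  have W: "W (y # l) z = winding_number (\<gamma> y) z + W l z" for y l by (simp add: W_def)
  consider "fst x \<noteq> fst d" | "x = d" | "x = opp d" using fst_eq_iff[of d x] by auto
  then show ?case
  proof cases
    case 1
    then have "x \<noteq> d" "x \<noteq> opp d" by auto
    then show ?thesis using 1 IH by (simp add: W)
  next
    case 2
    then show ?thesis using IH by (simp add: W algebra_simps)
  next
    case 3
    then have "d \<in> darts" using Cons.prems by simp
    from winding_number_opp[OF this assms(2)] 3 show ?thesis using IH by (simp add: W algebra_simps)
  qed
qed (simp add: W_def)

lemma continuous_W:
  assumes "set ds \<subseteq> darts" "\<And>d. d \<in> set ds \<Longrightarrow> z \<notin> path_image (G (fst d))"
  shows "continuous (at z) (W ds)"
  using assms
proof (induction ds)
  case Nil then show ?case by (simp add: W_def)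
next
  case (Cons x ds)
  have "W (x # ds) = (\<lambda>y. winding_number (\<gamma> x) y + W ds y)" by (auto simp: W_def)
  moreover have "continuous (at z) (winding_number (\<gamma> x))"
    using Cons.prems by (intro continuous_at_winding_number path_\<gamma>) auto
  moreover have "continuous (at z) (W ds)" using Cons by auto
  ultimately show ?case by (simp add: continuous_add)
qed

text \<open>The contributions of the edge cancel, and what remains is continuous at its interior points.\<close>
lemma winding_jump:
  assumes ds: "set ds \<subseteq> darts" "set ds' \<subseteq> darts"
    and m: "int (count_list ds d) - int (count_list ds (opp d)) = m * (int (count_list ds' d) - int (count_list ds' (opp d)))"
    and d: "d \<in> darts" and z: "interior_point (fst d) z"
    and r: "r1 \<in> Rs" "r2 \<in> Rs" "z \<in> closure (R r1)" "z \<in> closure (R r2)"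
    and H: "\<And>x. x \<in> R r1 \<Longrightarrow> W ds x - of_int m * W ds' x = \<alpha>" "\<And>x. x \<in> R r2 \<Longrightarrow> W ds x - of_int m * W ds' x = \<beta>"
  shows "\<alpha> = \<beta>"
proof -
  let ?f = "filter (\<lambda>x. fst x \<noteq> fst d)"
  define H' where "H' x = W (?f ds) x - of_int m * W (?f ds') x" for x
  have H': "W ds x - of_int m * W ds' x = H' x" if "x \<in> R r" "r \<in> Rs" for x r
  proof -
    have "path_image (G (fst d)) \<subseteq> graph" using fst_darts[OF d] by (auto simp: graph_def)
    then have x: "x \<notin> path_image (G (fst d))" using R_graph[OF that(2)] that(1) by blast
    show ?thesis unfolding H'_def W_split[OF ds(1) x] W_split[OF ds(2) x] m by (simp add: algebra_simps)
  qed
  have nz: "z \<notin> path_image (G (fst x))" if "x \<in> darts" "fst x \<noteq> fst d" for x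
    using interior_point_unique[OF z fst_darts[OF d] fst_darts[OF that(1)]] that(2) by blast
  have "continuous (at z) (W (?f ds))" "continuous (at z) (W (?f ds'))"
    using ds nz by (intro continuous_W; auto)+
  then have c: "continuous (at z) H'" unfolding H'_def by (intro continuous_intros)
  have "H' z = \<alpha>" using continuous_at_closure_const[OF c r(3)] H'[OF _ r(1)] H(1) by simp
  moreover have "H' z = \<beta>" using continuous_at_closure_const[OF c r(4)] H'[OF _ r(2)] H(2) by simp
  ultimately show ?thesis by simp
qed

lemma count_FL:
  assumes "r \<in> Rs" "d \<in> set (FL r)"
  shows "count_list (FL r) d = 1" "count_list (FL r) (opp d) = 0"
proof -
  have "distinct (FL r)" using FL_facts(3)[OF assms(1)] by (simp add: distinct_map)
  then show "count_list (FL r) d = 1" using assms(2) by (simp add: count_list_eq_length_filter distinct_length_filter)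
  have "opp d \<notin> set (FL r)"
    using FL_facts(4)[OF assms(1)] assms(2) opp_neq(2)[of d] fst_opp[of d] unfolding distinct_map inj_on_def by metis
  then show "count_list (FL r) (opp d) = 0" by (rule count_notin)
qed

lemma other_region_closure:
  assumes "r \<in> Rs" "r' \<in> Rs" "r \<noteq> r'" "x \<in> R r"
  shows "x \<notin> closure (R r')"
proof -
  have "R r \<inter> closure (R r') = {}"
    using open_Int_closure_eq_empty[OF R_open[OF assms(1)], of "R r'"] R_disjoint[OF assms(1-3)] by simp
  then show ?thesis using assms(4) by blast
qed

lemma W_FL:
  assumes "r \<in> Rs"
  obtains c where "\<And>x. x \<in> R r \<Longrightarrow> W (FL r) x = c + 1" "\<And>x r'. r' \<in> Rs \<Longrightarrow> r' \<noteq> r \<Longrightarrow> x \<in> R r' \<Longrightarrow> W (FL r) x = c"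
proof -
  obtain c where c: "\<forall>z\<in>R r. W (FL r) z = c + 1" "\<forall>z. z \<notin> closure (R r) \<longrightarrow> W (FL r) z = c"
    using positive_FL[OF assms] unfolding positive_face_def by blast
  show thesis
    by (rule that[of c]) (use c other_region_closure[OF _ assms] in auto)
qed

text \<open>If two tiles ran through an edge in the same direction, the difference of their winding
  functions would not jump there. Yet it falls by 2 from one tile to the other.\<close>

lemma FL_inj:
  assumes r: "r1 \<in> Rs" "r2 \<in> Rs" and d: "d \<in> set (FL r1)" "d \<in> set (FL r2)"
  shows "r1 = r2"
proof (rule ccontr)
  assume ne: "r1 \<noteq> r2"
  have dd: "d \<in> darts" using d FL_facts(2)[OF r(1)] by blast
  obtain z where z: "interior_point (fst d) z" using interior_point_exists[OF fst_darts[OF dd]] by blast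
  have zr: "z \<in> closure (R r1)" "z \<in> closure (R r2)"
    using interior_point_in_face[OF r(1) fst_darts[OF dd] z] interior_point_in_face[OF r(2) fst_darts[OF dd] z] d by auto
  obtain c1 where c1: "\<And>x. x \<in> R r1 \<Longrightarrow> W (FL r1) x = c1 + 1" "\<And>x r'. r' \<in> Rs \<Longrightarrow> r' \<noteq> r1 \<Longrightarrow> x \<in> R r' \<Longrightarrow> W (FL r1) x = c1"
    using W_FL[OF r(1)] by metis
  obtain c2 where c2: "\<And>x. x \<in> R r2 \<Longrightarrow> W (FL r2) x = c2 + 1" "\<And>x r'. r' \<in> Rs \<Longrightarrow> r' \<noteq> r2 \<Longrightarrow> x \<in> R r' \<Longrightarrow> W (FL r2) x = c2"
    using W_FL[OF r(2)] by metis
  have "c1 + 1 - c2 = c1 - (c2 + 1)"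
  proof (rule winding_jump[OF FL_facts(2)[OF r(1)] FL_facts(2)[OF r(2)] _ dd z r zr, of 1])
    show "int (count_list (FL r1) d) - int (count_list (FL r1) (opp d)) = 1 * (int (count_list (FL r2) d) - int (count_list (FL r2) (opp d)))"
      using count_FL[OF r(1) d(1)] count_FL[OF r(2) d(2)] by simp
    show "W (FL r1) x - of_int 1 * W (FL r2) x = c1 + 1 - c2" if "x \<in> R r1" for x
      using c1(1)[OF that] c2(2)[OF r(1) ne that] by simp
    show "W (FL r1) x - of_int 1 * W (FL r2) x = c1 - (c2 + 1)" if "x \<in> R r2" for x
      using c1(2)[OF r(2) ne[symmetric] that] c2(1)[OF that] by simp
  qed
  then show False by (simp add: algebra_simps)
qed

text \<open>Two different tiles contain the edge, and by \<open>FL_inj\<close> they run through it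
  in opposite directions, so both of its darts occur.\<close>

lemma dart_in_face:
  assumes d: "d \<in> darts"
  shows "\<exists>!r. r \<in> Rs \<and> d \<in> set (FL r)"
proof (rule ex_ex1I)
  obtain z where z: "interior_point (fst d) z" using interior_point_exists[OF fst_darts[OF d]] by blast
  obtain r1 r2 where r: "r1 \<in> Rs" "r2 \<in> Rs" "r1 \<noteq> r2" "z \<in> closure (R r1)" "z \<in> closure (R r2)"
    by (rule two_faces_at_edge[OF fst_darts[OF d] z])
  obtain d1 where d1: "d1 \<in> set (FL r1)" "fst d = fst d1"
    using interior_point_in_face[OF r(1) fst_darts[OF d] z] r(4) by blast
  obtain d2 where d2: "d2 \<in> set (FL r2)" "fst d = fst d2"
    using interior_point_in_face[OF r(2) fst_darts[OF d] z] r(5) by blast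
  have "d1 \<noteq> d2" using FL_inj[OF r(1,2)] d1(1) d2(1) r(3) by blast
  then have "d = d1 \<or> d = d2" using d1(2) d2(2) unfolding fst_eq_iff by metis
  then show "\<exists>r. r \<in> Rs \<and> d \<in> set (FL r)" using d1(1) d2(1) r(1,2) by blast
qed (use FL_inj in blast)

definition reg :: "'e \<times> bool \<Rightarrow> 'r" where
  "reg d = (THE r. r \<in> Rs \<and> d \<in> set (FL r))"

definition next_dart :: "'e \<times> bool \<Rightarrow> 'e \<times> bool" where
  "next_dart d = FL (reg d) ! (((THE i. i < 5 \<and> FL (reg d) ! i = d) + 1) mod 5)"

lemma reg: "d \<in> darts \<Longrightarrow> reg d \<in> Rs" "d \<in> darts \<Longrightarrow> d \<in> set (FL (reg d))"
  using theI'[OF dart_in_face, of d] by (simp_all add: reg_def)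

lemma dartE:
  assumes "d \<in> darts"
  obtains r i where "r \<in> Rs" "i < 5" "d = FL r ! i"
  using reg[OF assms] FL_facts(1)[OF reg(1)[OF assms]] unfolding in_set_conv_nth by metis

lemma FL_nth_dart: "r \<in> Rs \<Longrightarrow> i < 5 \<Longrightarrow> FL r ! i \<in> darts"
  using FL_facts(1,2) by (metis nth_mem subsetD)

lemma reg_nth: "r \<in> Rs \<Longrightarrow> i < 5 \<Longrightarrow> reg (FL r ! i) = r"
  using FL_inj[OF _ reg(1), of r "FL r ! i" "FL r ! i"] FL_nth_dart[of r i] reg(2)[of "FL r ! i"] FL_facts(1)[of r] nth_mem[of i "FL r"]
  by metis

lemma next_nth: "r \<in> Rs \<Longrightarrow> i < 5 \<Longrightarrow> next_dart (FL r ! i) = FL r ! ((i + 1) mod 5)"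
proof -
  assume r: "r \<in> Rs" "i < 5"
  have "distinct (FL r)" using FL_facts(3)[OF r(1)] by (simp add: distinct_map)
  then have "(THE j. j < 5 \<and> FL r ! j = FL r ! i) = i"
    using r FL_facts(1)[OF r(1)] by (intro the_equality) (auto simp: nth_eq_iff_index_eq)
  then show ?thesis by (simp add: next_dart_def reg_nth[OF r])
qed

lemma next_dart_darts: "d \<in> darts \<Longrightarrow> next_dart d \<in> darts"
  by (elim dartE) (simp add: next_nth FL_nth_dart)

lemma reg_next: "d \<in> darts \<Longrightarrow> reg (next_dart d) = reg d"
  by (elim dartE) (simp add: next_nth reg_nth)

lemma org_opp: "d \<in> darts \<Longrightarrow> org (opp d) = org (next_dart d)"
  by (elim dartE) (simp add: next_nth FL_facts(5))

lemma next5: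
  assumes "d \<in> darts"
  shows "next_dart (next_dart (next_dart (next_dart (next_dart d)))) = d"
    "distinct [org d, org (next_dart d), org (next_dart (next_dart d)), org (next_dart (next_dart (next_dart d))),
      org (next_dart (next_dart (next_dart (next_dart d))))]"
proof -
  obtain r i where r: "r \<in> Rs" "i < 5" "d = FL r ! i" by (rule dartE[OF assms])
  obtain a b c d' e where f: "FL r = [a, b, c, d', e]" by (rule length5E[OF FL_facts(1)[OF r(1)]])
  have n: "next_dart a = b" "next_dart b = c" "next_dart c = d'" "next_dart d' = e" "next_dart e = a"
    using next_nth[OF r(1), of 0] next_nth[OF r(1), of 1] next_nth[OF r(1), of 2] next_nth[OF r(1), of 3] next_nth[OF r(1), of 4]
    unfolding f by simp_all
  have dist: "distinct [org a, org b, org c, org d', org e]" using FL_facts(3)[OF r(1)] unfolding f by simp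
  have "i \<in> {0, 1, 2, 3, 4}" using r(2) by auto
  then have "d \<in> {a, b, c, d', e}" unfolding r(3) f by auto
  then have "next_dart (next_dart (next_dart (next_dart (next_dart d)))) = d \<and>
    distinct [org d, org (next_dart d), org (next_dart (next_dart d)), org (next_dart (next_dart (next_dart d))),
      org (next_dart (next_dart (next_dart (next_dart d))))]"
  proof (elim insertE emptyE)
    assume d: "d = a" show ?thesis unfolding d n using dist by simp
  next
    assume d: "d = b" show ?thesis unfolding d n using dist by auto
  next
    assume d: "d = c" show ?thesis unfolding d n using dist by auto
  next
    assume d: "d = d'" show ?thesis unfolding d n using dist by auto
  next
    assume d: "d = e" show ?thesis unfolding d n using dist by auto
  qed
  then show "next_dart (next_dart (next_dart (next_dart (next_dart d)))) = d"
    "distinct [org d, org (next_dart d), org (next_dart (next_dart d)), org (next_dart (next_dart (next_dart d))),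
      org (next_dart (next_dart (next_dart (next_dart d))))]"
    by (rule conjunct1, rule conjunct2)
qed

section \<open>Connectedness, vertex links and colourings by winding numbers\<close>

lemma reg_eq_next:
  assumes d: "d \<in> darts" "d' \<in> darts" and r: "reg d = reg d'" and S: "d \<in> S" "\<And>x. x \<in> S \<Longrightarrow> next_dart x \<in> S"
  shows "d' \<in> S"
proof -
  obtain r i where ri: "r \<in> Rs" "i < 5" "d = FL r ! i" by (rule dartE[OF d(1)])
  obtain r' j where rj: "r' \<in> Rs" "j < 5" "d' = FL r' ! j" by (rule dartE[OF d(2)])
  have rr: "r' = r" using r ri rj reg_nth by metis
  have "FL r ! ((i + m) mod 5) \<in> S" for m
  proof (induction m)
    case 0 then show ?case using S(1) ri by simp
  next
    case (Suc m)
    then have "next_dart (FL r ! ((i + m) mod 5)) \<in> S" by (rule S(2))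
    then show ?case using next_nth[OF ri(1), of "(i + m) mod 5"] by (simp add: mod_simps)
  qed
  from this[of "j + 5 - i"] show ?thesis using ri(2) rj rr by simp
qed

lemma reg_org_inj:
  assumes "d \<in> darts" "d' \<in> darts" "reg d = reg d'" "org d = org d'"
  shows "d = d'"
proof -
  have "inj_on org (set (FL (reg d)))" using FL_facts(3)[OF reg(1)[OF assms(1)]] by (simp add: distinct_map)
  then show ?thesis using reg(2)[OF assms(1)] reg(2)[OF assms(2)] assms(3,4) by (simp add: inj_on_eq_iff)
qed

text \<open>The closed tiles in \<open>A\<close> and the remaining ones form two closed sets
  covering \<open>U\<close>. If both meet \<open>U\<close>, they share a point of \<open>U\<close>.
  This point is no vertex, so it lies inside one region or on a single edge, and
  \<open>cross\<close> forbids that the two tiles at that edge are divided between the sets. The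
  cases needed are the plane without the vertices and a small punctured disc.\<close>

lemma separation:
  assumes U: "connected U" "U \<inter> V = {}" and A: "A \<subseteq> Rs"
    and cross: "\<And>d z. d \<in> darts \<Longrightarrow> z \<in> U \<Longrightarrow> z \<in> path_image (G (fst d)) \<Longrightarrow> reg d \<in> A \<Longrightarrow> reg (opp d) \<in> A"
    and r: "r1 \<in> A" "z1 \<in> U" "z1 \<in> closure (R r1)" "r2 \<in> Rs" "z2 \<in> U" "z2 \<in> closure (R r2)"
  shows "r2 \<in> A"
proof (rule ccontr)
  assume r2: "r2 \<notin> A"
  let ?X = "\<Union>r\<in>A. closure (R r)" and ?Y = "\<Union>r\<in>Rs - A. closure (R r)"
  have cl: "closed ?X" "closed ?Y"
    using finite_subset[OF A finite_Rs] finite_Rs by (auto intro!: closed_UN)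
  have cov: "U \<subseteq> ?X \<union> ?Y" using in_closure_region by blast
  have ne: "?X \<inter> U \<noteq> {}" "?Y \<inter> U \<noteq> {}" using r(1-6) r2 by blast+
  have "?X \<inter> ?Y \<inter> U \<noteq> {}"
  proof
    assume "?X \<inter> ?Y \<inter> U = {}"
    from connected_closedD[OF U(1) this cov cl] ne show False by (simp only: simp_thms)
  qed
  then obtain z r r' where z: "z \<in> U" "r \<in> A" "r' \<in> Rs" "r' \<notin> A" "z \<in> closure (R r)" "z \<in> closure (R r')" by blast
  have rr: "r \<in> Rs" "r \<noteq> r'" using z A by auto
  show False
  proof (cases "z \<in> graph")
    case False
    then obtain r'' where r'': "r'' \<in> Rs" "z \<in> R r''" using R_cover' by blast
    have "r'' = r" using other_region_closure[OF r''(1) rr(1) _ r''(2)] z(5) by blast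
    moreover have "r'' = r'" using other_region_closure[OF r''(1) z(3) _ r''(2)] z(6) by blast
    ultimately show False using rr by simp
  next
    case True
    then obtain e where e: "e \<in> Es" "z \<in> path_image (G e)" by (auto simp: graph_def)
    have zi: "interior_point e z" using e z(1) U(2) by (auto simp: interior_point_def)
    obtain d where d: "d \<in> set (FL r)" "e = fst d" using interior_point_in_face[OF rr(1) e(1) zi] z(5) by blast
    obtain d' where d': "d' \<in> set (FL r')" "e = fst d'" using interior_point_in_face[OF z(3) e(1) zi] z(6) by blast
    have D: "d \<in> darts" "d' \<in> darts" using d d' FL_facts(2) rr z by blast+
    have R: "reg d = r" "reg d' = r'" using FL_inj[OF reg(1) _ reg(2)] D d d' rr z by blast+
    have "d' = opp d" using fst_eq_iff[of d d'] d(2) d'(2) R rr(2) by auto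
    moreover have "reg (opp d) \<in> A" using cross[OF D(1) z(1)] e(2) d(2) R z(2) by simp
    ultimately show False using R z(4) by simp
  qed
qed

lemma interior_point_closure_reg: "d \<in> darts \<Longrightarrow> interior_point (fst d) z \<Longrightarrow> z \<in> closure (R (reg d))"
  using interior_point_in_face[OF reg(1) fst_darts] reg(2) by blast

text \<open>Removing the finite set \<open>V\<close> leaves the plane connected, and there one
  passes between tiles only across edges, that is by \<open>opp\<close>.\<close>

lemma darts_connected:
  assumes S: "S \<subseteq> darts" "S \<noteq> {}" "\<And>d. d \<in> S \<Longrightarrow> next_dart d \<in> S" "\<And>d. d \<in> S \<Longrightarrow> opp d \<in> S"
  shows "S = darts"
proof
  show "darts \<subseteq> S"
  proof
    fix d' assume d': "d' \<in> darts"
    obtain d where d: "d \<in> S" "d \<in> darts" using S by blast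
    obtain z z' where z: "interior_point (fst d) z" "interior_point (fst d') z'"
      using interior_point_exists fst_darts d(2) d' by metis
    have V: "connected (- V)"
      using connected_open_diff_countable[of UNIV V] finite_V convex_connected[OF convex_UNIV] by (simp add: countable_finite Compl_eq_Diff_UNIV)
    have mem: "x \<in> S" if x: "x \<in> darts" "reg x \<in> reg ` S" for x
    proof -
      obtain y where y: "y \<in> S" "reg y = reg x" using x(2) by (metis imageE)
      show ?thesis by (rule reg_eq_next[OF _ x(1) y(2) y(1) S(3)]) (use y S(1) in auto)
    qed
    have "reg d' \<in> reg ` S"
    proof (rule separation[OF V])
      show "reg d \<in> reg ` S" using d(1) by (rule imageI)
      show "z \<in> closure (R (reg d))" "z' \<in> closure (R (reg d'))"
        by (rule interior_point_closure_reg; use d d' z in simp)+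
      show "z \<in> - V" "z' \<in> - V" using z by (simp_all add: interior_point_def)
      show "reg ` S \<subseteq> Rs" using S(1) reg(1) by auto
      show "reg d' \<in> Rs" by (rule reg(1)[OF d'])
      fix x y assume "x \<in> darts" "reg x \<in> reg ` S"
      then have "opp x \<in> S" using mem S(4) by simp
      then show "reg (opp x) \<in> reg ` S" by (rule imageI)
    qed simp
    then show "d' \<in> S" by (rule mem[OF d'])
  qed
qed (rule S(1))

text \<open>\<open>separation\<close> is applied to a punctured disc around the vertex v and the
  tiles met by the orbit S of \<open>d\<close>. A tile has only one dart starting at v. An edge
  crossed in the disc has v as an end: if x starts at v, then \<open>rot x\<close> lies in the tile
  across; if x ends at v, then \<open>next_dart x\<close> is \<open>rot (opp x)\<close>, and S is
  closed under preimages of \<open>rot\<close>.\<close>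

lemma vertex_link:
  assumes d: "d \<in> darts" "d' \<in> darts" and o: "org d = org d'"
  shows "\<exists>m. ((\<lambda>d. next_dart (opp d)) ^^ m) d = d'"
proof -
  define rot where "rot x = next_dart (opp x)" for x
  define v where "v = org d"
  define S where "S = range (\<lambda>m. (rot ^^ m) d)"
  have rot_D: "rot x \<in> darts" if "x \<in> darts" for x using that by (simp add: rot_def next_dart_darts)
  have rot_org: "org (rot x) = org x" if "x \<in> darts" for x using org_opp[of "opp x"] that by (simp add: rot_def)
  have pow: "(rot ^^ m) d \<in> darts \<and> org ((rot ^^ m) d) = v" for m
    by (induction m) (simp_all add: d rot_D rot_org v_def)
  then have S_D: "x \<in> darts" "org x = v" if "x \<in> S" for x using that by (auto simp: S_def)
  have S_rot: "rot x \<in> S" if x: "x \<in> S" for x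
  proof -
    obtain m where "x = (rot ^^ m) d" using x unfolding S_def by blast
    then have "rot x = (rot ^^ Suc m) d" by simp
    then show ?thesis unfolding S_def by blast
  qed
  have n_inj: "x = y" if "x \<in> darts" "y \<in> darts" "next_dart x = next_dart y" for x y
    using arg_cong[OF that(3), of "\<lambda>d. next_dart (next_dart (next_dart (next_dart d)))"]
    unfolding next5(1)[OF that(1)] next5(1)[OF that(2)] .
  have finS: "finite S" by (rule finite_subset[OF _ finite_darts]) (rule subsetI, erule S_D(1))
  have rot_inj: "x = y" if "x \<in> darts" "y \<in> darts" "rot x = rot y" for x y
  proof -
    have "opp x = opp y" by (rule n_inj) (use that in \<open>simp_all add: rot_def\<close>)
    from arg_cong[OF this, of opp] show ?thesis by simp
  qed
  have surj: "rot ` S = S"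
  proof (rule endo_inj_surj[OF finS])
    show "rot ` S \<subseteq> S" using S_rot by blast
    show "inj_on rot S" by (rule inj_onI) (rule rot_inj[OF S_D(1) S_D(1)])
  qed
  have S_pre: "x \<in> S" if "x \<in> darts" "rot x \<in> S" for x
  proof -
    have "rot x \<in> rot ` S" using that(2) surj by simp
    then obtain y where y: "y \<in> S" "rot x = rot y" by (elim imageE) simp
    have "x = y" by (rule rot_inj[OF that(1) S_D(1)[OF y(1)] y(2)])
    then show ?thesis using y(1) by simp
  qed
  \<comment> \<open>A disc avoiding \<open>C\<close> contains no other vertex and meets only edges
    ending at v.\<close>
  define C where "C = (V - {v}) \<union> (\<Union>e\<in>{e \<in> Es. v \<notin> path_image (G e)}. path_image (G e))"
  have "closed C" unfolding C_def
    using finite_V finite_Es by (intro closed_Un finite_imp_closed closed_UN) (auto intro: closed_edge)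
  moreover have "v \<notin> C" by (auto simp: C_def)
  ultimately obtain \<delta> where \<delta>: "\<delta> > 0" "ball v \<delta> \<subseteq> - C"
    using open_contains_ball[of "- C"] by (auto simp: open_Compl)
  define U where "U = ball v \<delta> - {v}"
  have Uc: "connected U" unfolding U_def
    by (rule connected_open_diff_countable) simp_all
  have UV: "U \<inter> V = {}" using \<delta>(2) by (auto simp: U_def C_def)
  have Ue: "v \<in> path_image (G e)" if "e \<in> Es" "z \<in> U" "z \<in> path_image (G e)" for e z
    using that \<delta>(2) by (auto simp: U_def C_def)
  have near: "\<exists>z. z \<in> U \<and> interior_point (fst x) z" if x: "x \<in> darts" "org x = v" for x
  proof -
    obtain z where z: "interior_point (fst x) z" "dist (org x) z < \<delta>" by (rule interior_points_near_org[OF x(1) \<delta>(1)])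
    have "v \<in> V" using org_in_V[OF x(1)] x(2) by simp
    then have "z \<noteq> v" using z(1) by (auto simp: interior_point_def)
    then show ?thesis using z x(2) by (intro exI[of _ z]) (simp add: U_def)
  qed
  have mem: "x \<in> S" if x: "x \<in> darts" "org x = v" "reg x \<in> reg ` S" for x
  proof -
    obtain y where y: "y \<in> S" "reg y = reg x" using x(3) by (metis imageE)
    have "y = x" by (rule reg_org_inj) (use x y S_D in auto)
    then show ?thesis using y by simp
  qed
  obtain z z' where z: "z \<in> U" "interior_point (fst d) z" "z' \<in> U" "interior_point (fst d') z'"
    using near[of d] near[of d'] d o v_def by metis
  have dS: "d \<in> S" unfolding S_def using rangeI[of "\<lambda>m. (rot ^^ m) d" 0] by simp
  have "reg d' \<in> reg ` S"
  proof (rule separation[OF Uc UV])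
    show "reg d \<in> reg ` S" using dS by (rule imageI)
    show "z \<in> closure (R (reg d))" "z' \<in> closure (R (reg d'))"
      by (rule interior_point_closure_reg; use d z in simp)+
    show "z \<in> U" "z' \<in> U" by (rule z)+
    show "reg ` S \<subseteq> Rs" using S_D reg(1) by auto
    show "reg d' \<in> Rs" by (rule reg(1)[OF d(2)])
    fix x y assume x: "x \<in> darts" "y \<in> U" "y \<in> path_image (G (fst x))" "reg x \<in> reg ` S"
    have "v \<in> path_image (G (fst x)) \<inter> V" using Ue[OF fst_darts[OF x(1)] x(2,3)] org_in_V[OF d(1)] by (simp add: v_def)
    then have "org x = v \<or> org (opp x) = v" using edge_V[OF x(1)] by auto
    then show "reg (opp x) \<in> reg ` S"
    proof
      assume "org x = v"
      then have "rot x \<in> S" using mem[OF x(1) _ x(4)] S_rot by blast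
      moreover have "reg (rot x) = reg (opp x)" unfolding rot_def by (rule reg_next) (simp add: x(1))
      ultimately show ?thesis by (metis imageI)
    next
      assume "org (opp x) = v"
      then have "org (next_dart x) = v" using org_opp[OF x(1)] by simp
      then have "next_dart x \<in> S" using mem[OF next_dart_darts[OF x(1)]] reg_next[OF x(1)] x(4) by simp
      then have "rot (opp x) \<in> S" by (simp add: rot_def)
      then have "opp x \<in> S" by (rule S_pre[rotated]) (simp add: x(1))
      then show ?thesis by (rule imageI)
    qed
  qed
  then have "d' \<in> S" using mem[OF d(2)] o v_def by simp
  then have "\<exists>m. (rot ^^ m) d = d'" unfolding S_def by blast
  moreover have "rot = (\<lambda>d. next_dart (opp d))" by (rule ext) (rule rot_def)
  ultimately show ?thesis by simp
qed

text \<open>The winding number of the walk is an integer constant on each tile. Its jump at an edge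
  is measured against the boundary of the tile of d, whose winding number jumps by exactly 1 there:
  subtracting it m times, with m the net number of passages, removes the jump.\<close>

lemma closed_walk_colouring:
  assumes d: "d0 \<in> darts" "d1 \<in> darts" "d2 \<in> darts"
    and h: "org (opp d0) = org d1" "org (opp d1) = org d2" "org (opp d2) = org d0"
  shows "\<exists>c :: 'e \<times> bool \<Rightarrow> int. \<forall>d\<in>darts. c (next_dart d) = c d \<and>
    c d - c (opp d) = int (count_list [d0, d1, d2] d) - int (count_list [d0, d1, d2] (opp d))"
proof -
  let ?ds = "[d0, d1, d2]"
  define p where "p = \<gamma> d0 +++ (\<gamma> d1 +++ \<gamma> d2)"
  have p: "path p" "pathfinish p = pathstart p" unfolding p_def using d h by (simp_all add: path_\<gamma>)
  have im: "path_image p = path_image (G (fst d0)) \<union> (path_image (G (fst d1)) \<union> path_image (G (fst d2)))"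
    unfolding p_def using h by (simp add: path_image_join)
  then have img: "path_image p \<subseteq> graph" using d fst_darts unfolding graph_def by blast
  have Wp: "W ?ds z = winding_number p z" if "z \<notin> graph" for z
  proof -
    have "z \<notin> path_image p" using that img by blast
    then have z: "z \<notin> path_image (G (fst d0))" "z \<notin> path_image (G (fst d1))" "z \<notin> path_image (G (fst d2))"
      unfolding im by simp_all
    have "winding_number (\<gamma> d1 +++ \<gamma> d2) z = winding_number (\<gamma> d1) z + winding_number (\<gamma> d2) z"
      using z d h by (intro winding_number_join) (simp_all add: path_\<gamma>)
    moreover have "winding_number p z = winding_number (\<gamma> d0) z + winding_number (\<gamma> d1 +++ \<gamma> d2) z"
      unfolding p_def using z d h by (intro winding_number_join) (simp_all add: path_\<gamma> path_image_join)
    ultimately show ?thesis by (simp add: W_def)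
  qed
  have "\<exists>k :: int. \<forall>z\<in>R r. W ?ds z = of_int k" if r: "r \<in> Rs" for r
  proof -
    have disj: "R r \<inter> path_image p = {}" using R_graph[OF r] img by blast
    obtain x where x: "x \<in> R r" using R_nonempty[OF r] by blast
    then have "x \<notin> path_image p" using disj by blast
    then have "winding_number p x \<in> \<int>" by (rule integer_winding_number[OF p])
    then obtain k where k: "winding_number p x = of_int k" by (auto elim: Ints_cases)
    have "W ?ds z = of_int k" if "z \<in> R r" for z
    proof -
      have "z \<notin> graph" using R_graph[OF r] that by blast
      then show ?thesis using Wp[of z] winding_number_eq[OF p that x R_connected[OF r] disj] k by simp
    qed
    then show ?thesis by blast
  qed
  then obtain k :: "'r \<Rightarrow> int" where k: "\<And>r z. r \<in> Rs \<Longrightarrow> z \<in> R r \<Longrightarrow> W ?ds z = of_int (k r)" by metis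
  show ?thesis
  proof (intro exI[of _ "\<lambda>d. k (reg d)"] ballI conjI)
    fix d assume D: "d \<in> darts"
    show "k (reg (next_dart d)) = k (reg d)" by (simp add: reg_next[OF D])
    define m where "m = int (count_list ?ds d) - int (count_list ?ds (opp d))"
    let ?r = "reg d" and ?r' = "reg (opp d)"
    have D': "opp d \<in> darts" using D by simp
    have r: "?r \<in> Rs" "?r' \<in> Rs" using reg(1) D D' by blast+
    have ne: "?r' \<noteq> ?r"
    proof
      assume eq: "?r' = ?r"
      have "inj_on fst (set (FL ?r))" using FL_facts(4)[OF r(1)] by (simp add: distinct_map)
      from inj_onD[OF this fst_opp[of d]] show False using reg(2)[OF D] reg(2)[OF D'] eq by simp
    qed
    obtain z where z: "interior_point (fst d) z" using interior_point_exists[OF fst_darts[OF D]] by blast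
    obtain c where c: "\<And>x. x \<in> R ?r \<Longrightarrow> W (FL ?r) x = c + 1" "\<And>x r'. r' \<in> Rs \<Longrightarrow> r' \<noteq> ?r \<Longrightarrow> x \<in> R r' \<Longrightarrow> W (FL ?r) x = c"
      using W_FL[OF r(1)] by metis
    have "of_int (k ?r) - of_int m * (c + 1) = of_int (k ?r') - of_int m * c"
    proof (rule winding_jump[OF _ FL_facts(2)[OF r(1)] _ D z r])
      show "set ?ds \<subseteq> darts" using d by simp
      show "int (count_list ?ds d) - int (count_list ?ds (opp d)) = m * (int (count_list (FL ?r) d) - int (count_list (FL ?r) (opp d)))"
        using count_FL[OF r(1) reg(2)[OF D]] by (simp only: m_def) simp
      show "z \<in> closure (R ?r)" by (rule interior_point_closure_reg[OF D z])
      show "z \<in> closure (R ?r')" using interior_point_closure_reg[OF D'] z by simp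
      show "W ?ds x - of_int m * W (FL ?r) x = of_int (k ?r) - of_int m * (c + 1)" if "x \<in> R ?r" for x
        using k[OF r(1) that] c(1)[OF that] by simp
      show "W ?ds x - of_int m * W (FL ?r) x = of_int (k ?r') - of_int m * c" if "x \<in> R ?r'" for x
        using k[OF r(2) that] c(2)[OF r(2) ne that] by simp
    qed
    then have "of_int (k ?r - k ?r') = (of_int m :: complex)" by (simp add: algebra_simps)
    then have "k ?r - k ?r' = m" by (simp only: of_int_eq_iff)
    then show "k ?r - k ?r' = int (count_list ?ds d) - int (count_list ?ds (opp d))" by (simp only: m_def)
  qed
qed

theorem pentagonal_map_darts: "pentagonal_map darts next_dart opp org"
proof
  show "finite darts" by (rule finite_darts)
  show "next_dart d \<in> darts" if "d \<in> darts" for d by (rule next_dart_darts[OF that])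
  show "opp d \<in> darts" if "d \<in> darts" for d using that by simp
  show "next_dart (next_dart (next_dart (next_dart (next_dart d)))) = d" if "d \<in> darts" for d by (rule next5(1)[OF that])
  show "opp (opp d) = d" for d by simp
  show "org (opp d) = org (next_dart d)" if "d \<in> darts" for d by (rule org_opp[OF that])
  show "distinct [org d, org (next_dart d), org (next_dart (next_dart d)), org (next_dart (next_dart (next_dart d))),
      org (next_dart (next_dart (next_dart (next_dart d))))]" if "d \<in> darts" for d by (rule next5(2)[OF that])
  show "\<exists>m. ((\<lambda>d. next_dart (opp d)) ^^ m) d = d'" if "d \<in> darts" "d' \<in> darts" "org d = org d'" for d d'
    by (rule vertex_link[OF that])
  show "S = darts" if "S \<subseteq> darts" "S \<noteq> {}" "\<And>d. d \<in> S \<Longrightarrow> next_dart d \<in> S" "\<And>d. d \<in> S \<Longrightarrow> opp d \<in> S" for S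
    by (rule darts_connected[OF that])
  show "\<exists>c :: 'e \<times> bool \<Rightarrow> int. \<forall>d\<in>darts. c (next_dart d) = c d \<and>
      c d - c (opp d) = int (count_list [d0, d1, d2] d) - int (count_list [d0, d1, d2] (opp d))"
    if "d0 \<in> darts" "d1 \<in> darts" "d2 \<in> darts" "org (next_dart d0) = org d1" "org (next_dart d1) = org d2"
      "org (next_dart d2) = org d0" for d0 d1 d2
    using that by (intro closed_walk_colouring) (simp_all add: org_opp)
qed

lemma interior_closure_region:
  assumes r: "r \<in> Rs"
  shows "interior (closure (R r)) \<subseteq> R r"
proof (rule ccontr)
  assume "\<not> interior (closure (R r)) \<subseteq> R r"
  then obtain x where x: "x \<in> interior (closure (R r))" "x \<notin> R r" by blast
  then have "x \<in> closure (- closure (R r))" using region_complement(1)[OF r] interior_subset by blast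
  then have "interior (closure (R r)) \<inter> - closure (R r) \<noteq> {}"
    using x(1) open_Int_closure_eq_empty[OF open_interior, of "closure (R r)" "- closure (R r)"] by blast
  then show False using interior_subset by blast
qed

end

section \<open>Tilings of the sphere\<close>

lemma stereographic:
  assumes "w \<in> S2"
  shows "\<exists>f g. homeomorphism (S2 - {w}) (UNIV :: complex set) f g"
proof -
  have "(S2 - {w}) homeomorphic (UNIV :: complex set)"
    by (rule homeomorphic_punctured_sphere_affine) (use assms in auto)
  then show ?thesis by (simp add: homeomorphic_def)
qed

lemma open_image_sphere:
  fixes f :: "real^3 \<Rightarrow> 'b::euclidean_space"
  assumes "openin (top_of_set S2) U" "continuous_on U f" "inj_on f U" "DIM('b) < 3"
  shows "open (f ` U)"
proof -
  have "openin (top_of_set UNIV) (f ` U)"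
    by (rule invariance_of_domain_sphere_affine_set[OF assms(2,3) _ _ _ _ assms(1)]) (use assms(4) in auto)
  then show ?thesis by simp
qed

lemma openin_punctured_sphere: "openin (top_of_set (S2 - {w})) U \<Longrightarrow> openin (top_of_set S2) U"
  by (erule openin_trans) (simp add: openin_delete)

text \<open>Needed for the region containing the centre of projection, which loses that point.
  Projecting from a point outside \<open>r\<close> turns \<open>r\<close> into a plane domain, where
  deleting a point is harmless.\<close>

lemma connected_delete_sphere:
  assumes r: "openin (top_of_set S2) r" "connected r" "r \<noteq> S2"
  shows "connected (r - {w})"
proof -
  have sub: "r \<subseteq> S2" by (rule openin_imp_subset[OF r(1)])
  then obtain w' where w': "w' \<in> S2" "w' \<notin> r" using r(3) by blast
  obtain f g where fg: "homeomorphism (S2 - {w'}) (UNIV :: complex set) f g" using stereographic[OF w'(1)] by blast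
  have rs: "r \<subseteq> S2 - {w'}" using sub w'(2) by blast
  have cf: "continuous_on r f" using continuous_on_subset[OF homeomorphism_cont1[OF fg] rs] .
  have gf: "g (f x) = x" if "x \<in> r" for x using homeomorphism_apply1[OF fg] that rs by blast
  have "inj_on f r" by (rule inj_on_inverseI[of _ g]) (rule gf)
  then have "open (f ` r)" by (intro open_image_sphere[OF r(1) cf]) simp_all
  then have c: "connected (f ` r - f ` ({w} \<inter> r))"
    using connected_continuous_image[OF cf r(2)] by (intro connected_open_diff_countable) (simp_all add: countable_finite)
  have "r - {w} = g ` (f ` r - f ` ({w} \<inter> r))"
  proof (intro set_eqI iffI)
    fix x assume x: "x \<in> r - {w}"
    have "f x \<notin> f ` ({w} \<inter> r)"
    proof
      assume "f x \<in> f ` ({w} \<inter> r)"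
      then have "w \<in> r" "f x = f w" by auto
      then have "x = w" using gf[of x] gf[of w] x by simp
      then show False using x by simp
    qed
    then show "x \<in> g ` (f ` r - f ` ({w} \<inter> r))" using x gf by (intro image_eqI[of _ _ "f x"]) auto
  next
    fix x assume "x \<in> g ` (f ` r - f ` ({w} \<inter> r))"
    then obtain y where "y \<in> r" "f y \<notin> f ` ({w} \<inter> r)" "x = g (f y)" by blast
    then show "x \<in> r - {w}" using gf by auto
  qed
  moreover have "connected (g ` (f ` r - f ` ({w} \<inter> r)))"
    by (rule connected_continuous_image[OF continuous_on_subset[OF homeomorphism_cont2[OF fg]] c]) simp
  ultimately show ?thesis by simp
qed

section \<open>Transfer to the plane by stereographic projection\<close>

locale pent_tiling =
  fixes V :: "(real^3) set" and E :: "(real^3) set set"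
  assumes tiling: "pentagonal_tiling V E" and V_nonempty: "V \<noteq> {}"
begin

definition edge_arc :: "(real^3) set \<Rightarrow> real \<Rightarrow> real^3" where
  "edge_arc e = (SOME g. arc g \<and> path_image g = e \<and> e \<inter> V = {pathstart g, pathfinish g})"

lemma embedded: "embedded_graph V E"
  using tiling by (simp add: pentagonal_tiling_def)

lemma finite_VE: "finite V" "finite E"
  using embedded by (simp_all add: embedded_graph_def)

lemma V_sub: "V \<subseteq> S2" and E_sub: "e \<in> E \<Longrightarrow> e \<subseteq> S2"
  using embedded by (simp_all add: embedded_graph_def)

lemma edge_arc: "e \<in> E \<Longrightarrow> arc (edge_arc e)" "e \<in> E \<Longrightarrow> path_image (edge_arc e) = e"
  "e \<in> E \<Longrightarrow> e \<inter> V = {pathstart (edge_arc e), pathfinish (edge_arc e)}"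
proof -
  assume "e \<in> E"
  then have "\<exists>g. arc g \<and> path_image g = e \<and> e \<inter> V = {pathstart g, pathfinish g}"
    using embedded by (simp add: embedded_graph_def)
  from someI_ex[OF this] show "arc (edge_arc e)" "path_image (edge_arc e) = e"
    "e \<inter> V = {pathstart (edge_arc e), pathfinish (edge_arc e)}"
    unfolding edge_arc_def by blast+
qed

lemma edges_Int: "e \<in> E \<Longrightarrow> e' \<in> E \<Longrightarrow> e \<noteq> e' \<Longrightarrow> e \<inter> e' \<subseteq> V"
  using embedded by (simp add: embedded_graph_def)

lemma closed_edge: "e \<in> E \<Longrightarrow> closed e"
  using closed_arc_image[OF edge_arc(1)] edge_arc(2) by simp

lemma degree: "v \<in> V \<Longrightarrow> vertex_degree E v \<ge> 3"
  using tiling by (simp add: pentagonal_tiling_def)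

lemma vertex_edge: "v \<in> V \<Longrightarrow> \<exists>e\<in>E. v \<in> e"
proof (rule ccontr)
  assume v: "v \<in> V" "\<not> (\<exists>e\<in>E. v \<in> e)"
  then have "{e \<in> E. v \<in> e} = {}" by blast
  then have "vertex_degree E v = 0" unfolding vertex_degree_def by (simp only: card.empty)
  then show False using degree[OF v(1)] by simp
qed

lemma graph_eq: "V \<union> \<Union>E = \<Union>E"
  using vertex_edge by blast

lemma closed_graph: "closed (\<Union>E)"
  using finite_VE(2) closed_edge by (intro closed_Union) auto

text \<open>Provides a centre of projection off the graph. Otherwise a point of an edge that is no
  vertex would have a neighbourhood in the sphere contained in that edge, and the inverse arc would
  map this onto an open subset of the plane lying in the real axis.\<close>

lemma graph_neq_sphere: "\<Union>E \<noteq> S2"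
proof
  assume eq: "\<Union>E = S2"
  obtain v where v: "v \<in> V" using V_nonempty by blast
  obtain e where e: "e \<in> E" "v \<in> e" using vertex_edge[OF v] by blast
  have "infinite e"
  proof
    assume "finite e"
    then have "finite (edge_arc e ` {0..1})" using edge_arc(2)[OF e(1)] by (simp add: path_image_def)
    moreover have "inj_on (edge_arc e) {0..1}" using edge_arc(1)[OF e(1)] by (simp add: arc_def)
    ultimately have "finite {0..1 :: real}" by (rule finite_imageD)
    then show False using infinite_Icc[of 0 "1 :: real"] by simp
  qed
  then obtain p where p: "p \<in> e" "p \<notin> V" using finite_VE(1) finite_subset[of e V] by blast
  define U where "U = S2 - (V \<union> \<Union>(E - {e}))"
  have cl: "closed (V \<union> \<Union>(E - {e}))"
    using finite_VE closed_edge by (intro closed_Un closed_Union finite_imp_closed) auto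
  have U: "openin (top_of_set S2) U"
  proof -
    have "U = S2 \<inter> - (V \<union> \<Union>(E - {e}))" by (auto simp: U_def)
    then show ?thesis using openin_open_Int[OF open_Compl[OF cl], of S2] by simp
  qed
  have Ue: "U \<subseteq> e" using eq by (auto simp: U_def)
  have "p \<in> U" using p edges_Int[OF e(1)] E_sub[OF e(1)] by (auto simp: U_def)
  obtain h where h: "homeomorphism {0..1} e (edge_arc e) h"
    using homeomorphism_arc[OF edge_arc(1)[OF e(1)]] edge_arc(2)[OF e(1)] by metis
  let ?h = "\<lambda>x. complex_of_real (h x)"
  have "open (?h ` U)"
  proof (rule open_image_sphere[OF U])
    show "continuous_on U ?h"
      by (intro continuous_on_of_real continuous_on_subset[OF homeomorphism_cont2[OF h] Ue])
    show "inj_on ?h U"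
    proof (rule inj_onI)
      fix x y assume xy: "x \<in> U" "y \<in> U" "?h x = ?h y"
      then have "edge_arc e (h x) = edge_arc e (h y)" by simp
      moreover have "x \<in> e" "y \<in> e" using xy(1,2) Ue by blast+
      ultimately show "x = y" by (simp only: homeomorphism_apply2[OF h])
    qed
  qed simp
  moreover have "?h p \<in> ?h ` U" using \<open>p \<in> U\<close> by (rule imageI)
  ultimately obtain \<epsilon> where \<epsilon>: "\<epsilon> > 0" "ball (?h p) \<epsilon> \<subseteq> ?h ` U" using openE by blast
  have "?h p + \<i> * of_real (\<epsilon> / 2) \<in> ball (?h p) \<epsilon>" using \<epsilon>(1) by (simp add: dist_norm norm_mult)
  then obtain x where "?h p + \<i> * of_real (\<epsilon> / 2) = ?h x" using \<epsilon>(2) by blast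
  from arg_cong[OF this, of Im] show False using \<epsilon>(1) by simp
qed

lemma regions_eq: "regions V E = components (S2 - \<Union>E)"
  by (simp add: regions_def graph_eq)

lemma region_open: "r \<in> regions V E \<Longrightarrow> openin (top_of_set S2) r"
proof -
  assume r: "r \<in> regions V E"
  have o: "openin (top_of_set S2) (S2 - \<Union>E)"
    unfolding Diff_eq using closed_graph by (intro openin_open_Int open_Compl)
  have "locally connected (S2 - \<Union>E)"
    by (rule locally_open_subset[OF locally_connected_sphere o])
  then have "openin (top_of_set (S2 - \<Union>E)) r"
    using openin_components_locally_connected r by (metis regions_eq)
  then show ?thesis using o openin_trans by blast
qed

lemma region_connected: "r \<in> regions V E \<Longrightarrow> connected r"
  unfolding regions_def by (rule in_components_connected)

lemma region_sub: "r \<in> regions V E \<Longrightarrow> r \<subseteq> S2 - \<Union>E"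
  unfolding regions_eq by (rule in_components_subset)

lemma region_boundary:
  assumes "r \<in> regions V E"
  obtains vs es where "length vs = 5" "distinct vs" "set vs \<subseteq> V" "length es = 5" "distinct es" "set es \<subseteq> E"
    "\<forall>i<5. es ! i \<inter> V = {vs ! i, vs ! ((i + 1) mod 5)}" "closure r - r = \<Union>(set es)"
proof -
  obtain vs where "length vs = 5" "boundary_cycle V E r vs"
    using tiling assms unfolding pentagonal_tiling_def by blast
  then show thesis using that unfolding boundary_cycle_def by metis
qed

end

locale sphere_tiling = pent_tiling +
  fixes w :: "real^3" and f :: "real^3 \<Rightarrow> complex" and g :: "complex \<Rightarrow> real^3"
  assumes w: "w \<in> S2" "w \<notin> \<Union>E"
    and fg: "homeomorphism (S2 - {w}) UNIV f g"
begin

lemma gf: "x \<in> S2 \<Longrightarrow> x \<noteq> w \<Longrightarrow> g (f x) = x"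
  using homeomorphism_apply1[OF fg] by blast

lemma f_g: "f (g z) = z"
  using homeomorphism_apply2[OF fg] by blast

lemma g_in: "g z \<in> S2 - {w}"
  using homeomorphism_image2[OF fg] by blast

lemma edge_punctured: "e \<in> E \<Longrightarrow> e \<subseteq> S2 - {w}"
  using E_sub w by blast

lemma V_punctured: "V \<subseteq> S2 - {w}"
  using V_sub w graph_eq by blast

lemma f_inj: "inj_on f (S2 - {w})"
  by (rule inj_on_inverseI[of _ g]) (simp add: gf)

text \<open>This is the closure relative to the punctured sphere; \<open>w\<close> is removed on
  both sides because one region contains it.\<close>

lemma closure_region_image:
  assumes r: "r \<subseteq> S2"
  shows "closure (f ` (r - {w})) = f ` (closure r - {w})"
proof
  have cr: "closure r \<subseteq> S2" by (rule closure_minimal[OF r]) simp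
  have "f ` (closure r - {w}) = g -` closure r"
  proof (intro set_eqI iffI)
    fix z assume "z \<in> f ` (closure r - {w})"
    then obtain x where x: "x \<in> closure r" "x \<noteq> w" "z = f x" by blast
    then have "g z = x" using gf cr by blast
    then show "z \<in> g -` closure r" using x(1) by simp
  next
    fix z assume "z \<in> g -` closure r"
    then show "z \<in> f ` (closure r - {w})" using f_g[of z] g_in[of z] by (intro image_eqI[of _ f "g z"]) auto
  qed
  moreover have "closed (g -` closure r)"
    using homeomorphism_cont2[OF fg] by (intro closed_vimage closed_closure)
  ultimately have "closed (f ` (closure r - {w}))" by simp
  then show "closure (f ` (r - {w})) \<subseteq> f ` (closure r - {w})"
    using closure_subset[of r] by (intro closure_minimal image_mono) auto
  let ?C = "closure (f ` (r - {w}))"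
  have "closedin (top_of_set (S2 - {w})) ((S2 - {w}) \<inter> f -` ?C)"
    by (rule continuous_closedin_preimage[OF homeomorphism_cont1[OF fg]]) simp
  then obtain K where K: "closed K" "(S2 - {w}) \<inter> f -` ?C = (S2 - {w}) \<inter> K"
    unfolding closedin_closed by blast
  have "r - {w} \<subseteq> K" using K(2) r closure_subset[of "f ` (r - {w})"] by blast
  then have "closure (r - {w}) \<subseteq> K" by (rule closure_minimal) (rule K(1))
  moreover have "closure r \<subseteq> closure (r - {w}) \<union> {w}"
    by (rule closure_minimal) (use closure_subset[of "r - {w}"] in auto)
  ultimately have "closure r - {w} \<subseteq> K" by blast
  then show "f ` (closure r - {w}) \<subseteq> ?C" using cr K(2) by blast
qed

lemma region_boundary_image:
  assumes "r \<in> regions V E"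
  shows "closure (f ` (r - {w})) - f ` (r - {w}) = f ` (closure r - r)"
proof -
  have r: "r \<subseteq> S2" using region_sub[OF assms] by blast
  have cr: "closure r \<subseteq> S2" by (rule closure_minimal[OF r]) simp
  obtain es where "set es \<subseteq> E" "closure r - r = \<Union>(set es)" using region_boundary[OF assms] by metis
  then have "w \<notin> closure r - r" using w(2) by blast
  then have "closure r - r = (closure r - {w}) - (r - {w})" by blast
  moreover have "f ` ((closure r - {w}) - (r - {w})) = f ` (closure r - {w}) - f ` (r - {w})"
    by (rule inj_on_image_set_diff[OF f_inj]) (use cr r in auto)
  ultimately show ?thesis by (simp only: closure_region_image[OF r])
qed

text \<open>The regions of the sphere serve as indices for their images. The one that contains
  \<open>w\<close> loses this point and becomes the unbounded region.\<close>

sublocale plane: plane_pentagons "f ` V" E "\<lambda>e. f \<circ> edge_arc e" "regions V E" "\<lambda>r. f ` (r - {w})"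
proof
  show "finite (f ` V)" "finite E" using finite_VE by simp_all
  have pim: "path_image (f \<circ> edge_arc e) = f ` e" if "e \<in> E" for e
    using edge_arc(2)[OF that] by (simp add: path_image_compose)
  show "arc (f \<circ> edge_arc e)" if e: "e \<in> E" for e
  proof -
    have "continuous_on (path_image (edge_arc e)) f" unfolding edge_arc(2)[OF e]
      by (rule continuous_on_subset[OF homeomorphism_cont1[OF fg] edge_punctured[OF e]])
    then have "path (f \<circ> edge_arc e)"
      by (rule path_continuous_image[OF arc_imp_path[OF edge_arc(1)[OF e]]])
    moreover have "inj_on f (edge_arc e ` {0..1})" using edge_arc(2)[OF e] unfolding path_image_def
      by (simp add: inj_on_subset[OF f_inj edge_punctured[OF e]])
    moreover have "inj_on (edge_arc e) {0..1}" using edge_arc(1)[OF e] by (simp add: arc_def)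
    ultimately show ?thesis unfolding arc_def using comp_inj_on by blast
  qed
  show "path_image (f \<circ> edge_arc e) \<inter> f ` V = {pathstart (f \<circ> edge_arc e), pathfinish (f \<circ> edge_arc e)}" if e: "e \<in> E" for e
  proof -
    have "f ` e \<inter> f ` V = f ` (e \<inter> V)" by (rule inj_on_image_Int[OF f_inj edge_punctured[OF e] V_punctured, symmetric])
    then show ?thesis unfolding pim[OF e] edge_arc(3)[OF e] by (simp add: pathstart_def pathfinish_def)
  qed
  show "path_image (f \<circ> edge_arc e) \<inter> path_image (f \<circ> edge_arc e') \<subseteq> f ` V" if e: "e \<in> E" "e' \<in> E" "e \<noteq> e'" for e e'
  proof -
    have "f ` e \<inter> f ` e' = f ` (e \<inter> e')" by (rule inj_on_image_Int[OF f_inj edge_punctured[OF e(1)] edge_punctured[OF e(2)], symmetric])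
    then show ?thesis unfolding pim[OF e(1)] pim[OF e(2)] using edges_Int[OF e] by blast
  qed
  show "open (f ` (r - {w}))" if r: "r \<in> regions V E" for r
  proof (rule open_image_sphere)
    show "openin (top_of_set S2) (r - {w})" by (rule openin_delete[OF region_open[OF r]])
    have "r - {w} \<subseteq> S2 - {w}" using region_sub[OF r] by blast
    then show "continuous_on (r - {w}) f" "inj_on f (r - {w})"
      by (rule continuous_on_subset[OF homeomorphism_cont1[OF fg]], rule inj_on_subset[OF f_inj])
  qed simp
  show "connected (f ` (r - {w}))" if r: "r \<in> regions V E" for r
  proof (rule connected_continuous_image)
    have "r - {w} \<subseteq> S2 - {w}" using region_sub[OF r] by blast
    then show "continuous_on (r - {w}) f" by (rule continuous_on_subset[OF homeomorphism_cont1[OF fg]])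
    have "r \<noteq> S2" using region_sub[OF r] V_sub V_nonempty graph_eq by blast
    then show "connected (r - {w})" by (rule connected_delete_sphere[OF region_open[OF r] region_connected[OF r]])
  qed
  show "f ` (r - {w}) \<noteq> {}" if r: "r \<in> regions V E" for r
  proof
    assume "f ` (r - {w}) = {}"
    then have "r \<subseteq> {w}" by blast
    moreover have "r \<noteq> {}" using r in_components_nonempty unfolding regions_def by blast
    ultimately have "r = {w}" by blast
    then have "open ((\<lambda>_. 0 :: complex) ` {w})" using region_open[OF r] by (intro open_image_sphere) simp_all
    then show False using not_open_singleton[of "0 :: complex"] by simp
  qed
  show "f ` (r - {w}) \<inter> f ` (r' - {w}) = {}" if r: "r \<in> regions V E" "r' \<in> regions V E" "r \<noteq> r'" for r r'
  proof -
    have "r \<inter> r' = {}" using components_nonoverlap[of r "S2 - \<Union>E" r'] r unfolding regions_eq by blast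
    moreover have "f ` (r - {w}) \<inter> f ` (r' - {w}) = f ` ((r - {w}) \<inter> (r' - {w}))"
      by (rule inj_on_image_Int[OF f_inj, symmetric]) (use region_sub r in blast)+
    moreover have "(r - {w}) \<inter> (r' - {w}) = {}" using calculation(1) by blast
    ultimately show ?thesis by (simp only: image_empty)
  qed
  show "(\<Union>r\<in>regions V E. f ` (r - {w})) = - (f ` V \<union> (\<Union>e\<in>E. path_image (f \<circ> edge_arc e)))"
  proof -
    have U: "\<Union>(regions V E) = S2 - \<Union>E" unfolding regions_eq by (rule Union_components)
    have "(\<Union>r\<in>regions V E. f ` (r - {w})) = f ` (\<Union>(regions V E) - {w})" by blast
    also have "\<dots> = f ` ((S2 - {w}) - \<Union>E)" unfolding U by (rule arg_cong[of _ _ "\<lambda>A. f ` A"]) blast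
    also have "\<dots> = f ` (S2 - {w}) - f ` \<Union>E"
      by (rule inj_on_image_set_diff[OF f_inj]) (use edge_punctured in blast)+
    also have "\<dots> = - (f ` (V \<union> \<Union>E))" unfolding graph_eq homeomorphism_image1[OF fg] by blast
    also have "\<dots> = - (f ` V \<union> (\<Union>e\<in>E. f ` e))" by blast
    finally show ?thesis using pim by simp
  qed
  show "\<exists>vs es. length vs = 5 \<and> distinct vs \<and> length es = 5 \<and> distinct es \<and> set es \<subseteq> E \<and>
      (\<forall>i<5. path_image (f \<circ> edge_arc (es ! i)) \<inter> f ` V = {vs ! i, vs ! ((i + 1) mod 5)}) \<and>
      closure (f ` (r - {w})) - f ` (r - {w}) = (\<Union>e\<in>set es. path_image (f \<circ> edge_arc e))" if r: "r \<in> regions V E" for r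
  proof -
    obtain vs es where b: "length vs = 5" "distinct vs" "set vs \<subseteq> V" "length es = 5" "distinct es" "set es \<subseteq> E"
      "\<forall>i<5. es ! i \<inter> V = {vs ! i, vs ! ((i + 1) mod 5)}" "closure r - r = \<Union>(set es)"
      by (rule region_boundary[OF r])
    have "path_image (f \<circ> edge_arc (es ! i)) \<inter> f ` V = {map f vs ! i, map f vs ! ((i + 1) mod 5)}" if i: "i < 5" for i
    proof -
      have e: "es ! i \<in> E" using b(4,6) i by (simp add: nth_mem subsetD)
      have "f ` (es ! i) \<inter> f ` V = f ` (es ! i \<inter> V)" by (rule inj_on_image_Int[OF f_inj edge_punctured[OF e] V_punctured, symmetric])
      then show ?thesis using b(1,7) i by (simp add: pim[OF e])
    qed
    moreover have "distinct (map f vs)"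
      using b(2,3) inj_on_subset[OF f_inj V_punctured] by (simp add: distinct_map inj_on_subset)
    moreover have "closure (f ` (r - {w})) - f ` (r - {w}) = (\<Union>e\<in>set es. path_image (f \<circ> edge_arc e))"
    proof -
      have "(\<Union>e\<in>set es. path_image (f \<circ> edge_arc e)) = (\<Union>e\<in>set es. f ` e)" using pim b(6) by (intro SUP_cong) auto
      also have "\<dots> = f ` \<Union>(set es)" by blast
      finally show ?thesis unfolding region_boundary_image[OF r] b(8) by simp
    qed
    ultimately show ?thesis using b by (intro exI[of _ "map f vs"] exI[of _ es]) simp
  qed
  show "\<exists>e\<in>E. v \<in> path_image (f \<circ> edge_arc e)" if v: "v \<in> f ` V" for v
  proof -
    obtain u where u: "u \<in> V" "v = f u" using v by blast
    then obtain e where "e \<in> E" "u \<in> e" using vertex_edge by blast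
    then show ?thesis using pim u by blast
  qed
qed

lemma open_in_closure_region:
  assumes r: "r \<in> regions V E" and A: "openin (top_of_set S2) A" "A \<subseteq> closure r"
  shows "A \<subseteq> r"
proof (rule ccontr)
  assume "\<not> A \<subseteq> r"
  then obtain p where p: "p \<in> A" "p \<in> closure r - r" using A(2) by blast
  obtain es where "set es \<subseteq> E" "closure r - r = \<Union>(set es)" using region_boundary[OF r] by metis
  then have "p \<in> \<Union>E" using p by blast
  then have pw: "p \<noteq> w" using w(2) by blast
  have rs: "r \<subseteq> S2" using region_sub[OF r] by blast
  have "A - {w} \<subseteq> S2 - {w}" using openin_imp_subset[OF A(1)] by blast
  then have "open (f ` (A - {w}))"
    by (intro open_image_sphere[OF openin_delete[OF A(1)]] continuous_on_subset[OF homeomorphism_cont1[OF fg]] inj_on_subset[OF f_inj]) simp_all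
  moreover have "f ` (A - {w}) \<subseteq> closure (f ` (r - {w}))" unfolding closure_region_image[OF rs] using A(2) by blast
  ultimately have "f ` (A - {w}) \<subseteq> f ` (r - {w})"
    using interior_maximal plane.interior_closure_region[OF r] by blast
  then have "f p \<in> f ` (r - {w})" using p(1) pw by blast
  then have "p \<in> r - {w}"
    using inj_on_image_mem_iff[OF f_inj, of p "r - {w}"] rs p(1) pw openin_imp_subset[OF A(1)] by blast
  then show False using p(2) by blast
qed

text \<open>A tiling only asserts that a closed tile is some disc, not that its boundary corresponds
  to the circle. Invariance of domain gives this: the image of \<open>r\<close> is open, hence
  inside the open disc, and the preimage of the open disc is open in the sphere, hence inside
  \<open>r\<close> by \<open>open_in_closure_region\<close>.\<close>

lemma region_disc:
  assumes r: "r \<in> regions V E"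
  shows "\<exists>h h'. homeomorphism (closure r) (cball (0::real^2) 1) h h' \<and> h ` r = ball 0 1"
proof -
  have "closure r homeomorphic cball (0::real^2) 1" using tiling r by (simp add: pentagonal_tiling_def)
  then obtain h h' where h: "homeomorphism (closure r) (cball (0::real^2) 1) h h'" by (auto simp: homeomorphic_def)
  have rc: "r \<subseteq> closure r" by (rule closure_subset)
  have rs: "r \<subseteq> S2" using region_sub[OF r] by blast
  have cr: "closure r \<subseteq> S2" by (rule closure_minimal[OF rs]) simp
  have inj: "inj_on h (closure r)" by (rule inj_on_inverseI[of _ h']) (rule homeomorphism_apply1[OF h])
  have "open (h ` r)"
    by (rule open_image_sphere[OF region_open[OF r] continuous_on_subset[OF homeomorphism_cont1[OF h] rc] inj_on_subset[OF inj rc]]) simp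
  moreover have "h ` r \<subseteq> cball 0 1" using homeomorphism_image1[OF h] rc by blast
  ultimately have sub: "h ` r \<subseteq> ball 0 1" using interior_maximal[of "h ` r" "cball 0 1"] by simp
  \<comment> \<open>Projection from a point off the tile puts the whole tile into the plane, where
    invariance of domain can be applied to \<open>h'\<close>.\<close>
  obtain z where z: "z \<notin> closure (f ` (r - {w}))" using plane.region_complement(2)[OF r] by blast
  define w' where "w' = g z"
  have w': "w' \<in> S2" "w' \<notin> closure r"
  proof -
    show "w' \<in> S2" using g_in w'_def by blast
    show "w' \<notin> closure r"
    proof
      assume "w' \<in> closure r"
      then have "f w' \<in> f ` (closure r - {w})" using g_in[of z] w'_def by blast
      then show False using z unfolding closure_region_image[OF rs] w'_def f_g by simp
    qed
  qed
  obtain f' g' where fg': "homeomorphism (S2 - {w'}) (UNIV :: complex set) f' g'" using stereographic[OF w'(1)] by blast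
  let ?A = "h' ` ball 0 1"
  have b: "ball (0::real^2) 1 \<subseteq> cball 0 1" by (rule ball_subset_cball)
  have Ac: "?A \<subseteq> closure r" using homeomorphism_image2[OF h] b by blast
  have As: "?A \<subseteq> S2 - {w'}" using Ac cr w'(2) by blast
  have "open ((f' \<circ> h') ` ball 0 1)"
  proof (rule invariance_of_domain_gen)
    show "continuous_on (ball 0 1) (f' \<circ> h')"
      by (intro continuous_on_compose continuous_on_subset[OF homeomorphism_cont2[OF h] b] continuous_on_subset[OF homeomorphism_cont1[OF fg'] As])
    have "inj_on h' (ball 0 1)" by (rule inj_on_inverseI[of _ h]) (use homeomorphism_apply2[OF h] b in blast)
    moreover have "inj_on f' ?A" by (rule inj_on_inverseI[of _ g']) (use homeomorphism_apply1[OF fg'] As in blast)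
    ultimately show "inj_on (f' \<circ> h') (ball 0 1)" by (rule comp_inj_on)
  qed simp_all
  then have "openin (top_of_set UNIV) (f' ` ?A)" by (simp add: image_comp)
  from homeomorphism_imp_open_map[OF homeomorphism_symD[OF fg'] this]
  have "openin (top_of_set (S2 - {w'})) (g' ` f' ` ?A)" .
  moreover have "g' ` f' ` ?A = ?A"
    unfolding image_image using homeomorphism_apply1[OF fg'] As by (intro set_eqI) force
  ultimately have "openin (top_of_set S2) ?A" by (simp add: openin_punctured_sphere)
  then have "?A \<subseteq> r" using Ac by (rule open_in_closure_region[OF r])
  have "ball 0 1 \<subseteq> h ` r"
  proof
    fix x :: "real^2" assume x: "x \<in> ball 0 1"
    then have "h (h' x) = x" using homeomorphism_apply2[OF h] b by blast
    moreover have "h' x \<in> r" using \<open>?A \<subseteq> r\<close> x by blast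
    ultimately show "x \<in> h ` r" by (metis imageI)
  qed
  then show ?thesis using h sub by blast
qed

end

context pent_tiling
begin

lemma sphere_tiling_exists: "\<exists>w f g. sphere_tiling V E w f g"
proof -
  have "\<Union>E \<subseteq> S2" using E_sub by blast
  then obtain w where w: "w \<in> S2" "w \<notin> \<Union>E" using graph_neq_sphere by blast
  obtain f g where "homeomorphism (S2 - {w}) (UNIV :: complex set) f g" using stereographic[OF w(1)] by blast
  then have "sphere_tiling V E w f g" using w by unfold_locales
  then show ?thesis by blast
qed

end

lemma (in sphere_tiling) finite_regions_plane: "finite (regions V E)"
  by (rule plane.finite_Rs)

context pent_tiling
begin

lemma finite_regions: "finite (regions V E)"
  using sphere_tiling_exists sphere_tiling.finite_regions_plane by blast

lemma region_disc_exists: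
  "r \<in> regions V E \<Longrightarrow> \<exists>h h'. homeomorphism (closure r) (cball (0::real^2) 1) h h' \<and> h ` r = ball 0 1"
  using sphere_tiling_exists sphere_tiling.region_disc by blast

end

section \<open>Combinatorially isomorphic tilings are homeomorphic\<close>

text \<open>Alexander's trick. The radial extension preserves the norm, which yields continuity at
  the centre and keeps the open ball apart from the sphere.\<close>

lemma cone_extension:
  fixes \<phi> :: "'a::euclidean_space \<Rightarrow> 'a"
  assumes \<phi>: "continuous_on (sphere 0 1) \<phi>" "inj_on \<phi> (sphere 0 1)" "\<phi> ` sphere 0 1 = sphere 0 1"
  shows "\<exists>\<psi>. continuous_on (cball 0 1) \<psi> \<and> inj_on \<psi> (cball 0 1) \<and> \<psi> ` ball 0 1 = ball 0 1 \<and>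
    (\<forall>x\<in>sphere 0 1. \<psi> x = \<phi> x)"
proof -
  define \<psi> where "\<psi> u = norm u *\<^sub>R \<phi> (u /\<^sub>R norm u)" for u
  have unit: "u /\<^sub>R norm u \<in> sphere 0 1" if "u \<noteq> 0" for u :: 'a using that by simp
  have norm_\<psi>: "norm (\<psi> u) = norm u" for u
  proof (cases "u = 0")
    case False
    then have "\<phi> (u /\<^sub>R norm u) \<in> sphere 0 1" using unit[OF False] \<phi>(3) by blast
    then show ?thesis by (simp add: \<psi>_def)
  qed (simp add: \<psi>_def)
  have "continuous_on (cball 0 1) \<psi>"
    unfolding continuous_on_eq_continuous_within
  proof
    fix u :: 'a assume u: "u \<in> cball 0 1"
    show "continuous (at u within cball 0 1) \<psi>"
    proof (cases "u = 0")
      case True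
      have "((\<lambda>x. norm (\<psi> x)) \<longlongrightarrow> norm (0 :: 'a)) (at 0 within cball 0 1)"
        unfolding norm_\<psi> by (intro tendsto_intros)
      then have "(\<psi> \<longlongrightarrow> 0) (at 0 within cball 0 1)" by (simp add: tendsto_norm_zero_iff)
      then show ?thesis using True by (simp add: continuous_within \<psi>_def)
    next
      case False
      have "continuous_on (cball 0 1 - {0}) (\<lambda>u. \<phi> (u /\<^sub>R norm u))"
      proof (rule continuous_on_compose2[OF \<phi>(1)])
        show "continuous_on (cball 0 1 - {0}) (\<lambda>u :: 'a. u /\<^sub>R norm u)" by (intro continuous_intros) auto
        show "(\<lambda>u :: 'a. u /\<^sub>R norm u) ` (cball 0 1 - {0}) \<subseteq> sphere 0 1" using unit by blast
      qed
      then have "continuous_on (cball 0 1 - {0}) \<psi>" unfolding \<psi>_def by (intro continuous_intros)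
      then have "continuous (at u within cball 0 1 - {0}) \<psi>"
        using u False by (simp add: continuous_on_eq_continuous_within)
      moreover have "at u within cball 0 1 - {0} = at u within cball 0 1"
        by (rule at_within_nhd[of _ "- {0}"]) (use False in auto)
      ultimately show ?thesis by simp
    qed
  qed
  moreover have "inj_on \<psi> (cball 0 1)"
  proof (rule inj_onI)
    fix u v :: 'a assume uv: "\<psi> u = \<psi> v"
    then have n: "norm u = norm v" using norm_\<psi> by metis
    show "u = v"
    proof (cases "u = 0")
      case True then show ?thesis using n by simp
    next
      case False
      then have v: "v \<noteq> 0" using n by auto
      have "\<phi> (u /\<^sub>R norm u) = \<phi> (v /\<^sub>R norm v)" using uv False v n by (simp add: \<psi>_def)
      then have "u /\<^sub>R norm u = v /\<^sub>R norm v" using inj_onD[OF \<phi>(2)] unit False v by blast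
      then show ?thesis using n False v by simp
    qed
  qed
  moreover have "\<psi> ` ball 0 1 = ball 0 1"
  proof
    show "\<psi> ` ball 0 1 \<subseteq> ball 0 1" using norm_\<psi> by auto
    show "ball 0 1 \<subseteq> \<psi> ` ball 0 1"
    proof
      fix v :: 'a assume v: "v \<in> ball 0 1"
      show "v \<in> \<psi> ` ball 0 1"
      proof (cases "v = 0")
        case True then show ?thesis by (intro image_eqI[of _ _ 0]) (simp_all add: \<psi>_def)
      next
        case False
        then obtain y where y: "y \<in> sphere 0 1" "\<phi> y = v /\<^sub>R norm v" using unit[OF False] \<phi>(3) by (metis imageE)
        have "\<psi> (norm v *\<^sub>R y) = v" using y False by (simp add: \<psi>_def)
        moreover have "norm v *\<^sub>R y \<in> ball 0 1" using y v by simp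
        ultimately show ?thesis by (metis imageI)
      qed
    qed
  qed
  moreover have "\<forall>x\<in>sphere 0 1. \<psi> x = \<phi> x" by (simp add: \<psi>_def)
  ultimately show ?thesis by (intro exI[of _ \<psi>] conjI)
qed

text \<open>Conjugation with \<open>h\<close> and \<open>k\<close> turns the boundary map into a
  bijection of the unit sphere, to which the cone applies.\<close>

lemma disc_extension:
  fixes h k :: "'a::metric_space \<Rightarrow> 'b::euclidean_space"
  assumes h: "homeomorphism A (cball 0 1) h h'" "a \<subseteq> A" "h ` a = ball 0 1"
    and k: "homeomorphism B (cball 0 1) k k'" "b \<subseteq> B" "k ` b = ball 0 1"
    and \<beta>: "continuous_on (A - a) \<beta>" "inj_on \<beta> (A - a)" "\<beta> ` (A - a) = B - b"
  shows "\<exists>\<psi>. continuous_on A \<psi> \<and> inj_on \<psi> A \<and> \<psi> ` a = b \<and> (\<forall>x\<in>A - a. \<psi> x = \<beta> x)"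
proof -
  have sph: "cball (0 :: 'b) 1 - ball 0 1 = sphere 0 1" by auto
  have injh: "inj_on h A" by (rule inj_on_inverseI[of _ h']) (rule homeomorphism_apply1[OF h(1)])
  have injk: "inj_on k B" by (rule inj_on_inverseI[of _ k']) (rule homeomorphism_apply1[OF k(1)])
  have hs: "h ` (A - a) = sphere 0 1"
    using inj_on_image_set_diff[OF injh, of A a] h(2,3) homeomorphism_image1[OF h(1)] sph by auto
  have ks: "k ` (B - b) = sphere 0 1"
    using inj_on_image_set_diff[OF injk, of B b] k(2,3) homeomorphism_image1[OF k(1)] sph by auto
  have h's: "h' ` sphere 0 1 = A - a"
    unfolding hs[symmetric] image_image using homeomorphism_apply1[OF h(1)] by (intro set_eqI) force
  have k'b: "k' ` ball 0 1 = b"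
    unfolding k(3)[symmetric] image_image using homeomorphism_apply1[OF k(1)] k(2) by (intro set_eqI) force
  let ?\<phi> = "k \<circ> (\<beta> \<circ> h')"
  have injh': "inj_on h' (sphere 0 1)"
    by (rule inj_on_inverseI[of _ h]) (rule homeomorphism_apply2[OF h(1)], simp)
  have c1: "continuous_on (sphere 0 1) (\<beta> \<circ> h')"
    by (rule continuous_on_compose) (use \<beta>(1) h's continuous_on_subset[OF homeomorphism_cont2[OF h(1)], of "sphere 0 1"] in auto)
  have img: "(\<beta> \<circ> h') ` sphere 0 1 = B - b" using h's \<beta>(3) by (simp only: image_comp[symmetric])
  have "continuous_on (sphere 0 1) ?\<phi>"
    by (rule continuous_on_compose[OF c1]) (use continuous_on_subset[OF homeomorphism_cont1[OF k(1)], of "B - b"] img in auto)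
  moreover have "inj_on ?\<phi> (sphere 0 1)"
    by (intro comp_inj_on injh') (simp_all only: h's \<beta>(2) \<beta>(3) image_comp[symmetric] inj_on_diff[OF injk])
  moreover have "?\<phi> ` sphere 0 1 = sphere 0 1"
    unfolding image_comp[symmetric] h's \<beta>(3) ks ..
  ultimately have "\<exists>c. continuous_on (cball 0 1) c \<and> inj_on c (cball 0 1) \<and> c ` ball 0 1 = ball 0 1 \<and> (\<forall>x\<in>sphere 0 1. c x = ?\<phi> x)"
    by (rule cone_extension)
  then obtain c where c: "continuous_on (cball 0 1) c" "inj_on c (cball 0 1)" "c ` ball 0 1 = ball 0 1"
    and c4: "\<forall>x\<in>sphere 0 1. c x = ?\<phi> x" by (elim exE conjE)
  have "c ` sphere 0 1 = ?\<phi> ` sphere 0 1" by (rule image_cong[OF refl]) (rule bspec[OF c4])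
  then have cs: "c ` sphere 0 1 = sphere 0 1"
    unfolding image_comp[symmetric] h's \<beta>(3) ks .
  have cc: "c ` cball 0 1 = cball 0 1"
  proof -
    have "cball (0 :: 'b) 1 = ball 0 1 \<union> sphere 0 1" by auto
    then show ?thesis using c(3) cs by (simp only: image_Un)
  qed
  have ch: "(c \<circ> h) ` A = cball 0 1" unfolding image_comp[symmetric] homeomorphism_image1[OF h(1)] cc ..
  have injk': "inj_on k' (cball 0 1)"
    by (rule inj_on_inverseI[of _ k]) (rule homeomorphism_apply2[OF k(1)])
  show ?thesis
  proof (intro exI[of _ "k' \<circ> (c \<circ> h)"] conjI ballI)
    show "continuous_on A (k' \<circ> (c \<circ> h))"
      by (intro continuous_on_compose homeomorphism_cont1[OF h(1)])
        (simp_all only: homeomorphism_image1[OF h(1)] c(1) ch homeomorphism_cont2[OF k(1)])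
    have "inj_on (c \<circ> h) A" by (rule comp_inj_on[OF injh]) (simp only: homeomorphism_image1[OF h(1)] c(2))
    then show "inj_on (k' \<circ> (c \<circ> h)) A" by (rule comp_inj_on) (simp only: ch injk')
    show "(k' \<circ> (c \<circ> h)) ` a = b" unfolding image_comp[symmetric] h(3) c(3) k'b ..
    fix x assume x: "x \<in> A - a"
    then have "h x \<in> sphere 0 1" using hs by blast
    then have "c (h x) = k (\<beta> (h' (h x)))" using c4 by simp
    also have "h' (h x) = x" using homeomorphism_apply1[OF h(1)] x by blast
    finally show "(k' \<circ> (c \<circ> h)) x = \<beta> x"
      using homeomorphism_apply1[OF k(1)] \<beta>(3) x by auto
  qed
qed

lemma continuous_on_Union_closed:
  assumes "finite F" "\<And>S. S \<in> F \<Longrightarrow> closed S" "\<And>S. S \<in> F \<Longrightarrow> continuous_on S h"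
  shows "continuous_on (\<Union>F) h"
  using assms
proof (induction F)
  case (insert S F)
  then have "continuous_on (S \<union> \<Union>F) h" by (intro continuous_on_closed_Un closed_Union) auto
  then show ?case by simp
qed simp

lemma inj_on_eq_imp_Int:
  "inj_on F A \<Longrightarrow> x \<in> A \<Longrightarrow> B \<subseteq> A \<Longrightarrow> F x \<in> F ` B \<Longrightarrow> x \<in> B"
  by (simp add: inj_on_image_mem_iff)

text \<open>The map is built on the entire graph before any tile is filled in. So \<open>bnd\<close>
  can compare boundaries as sets of edges: the map on the graph already carries one boundary onto
  the other.\<close>

theorem combinatorially_isomorphic_tilings:
  assumes t: "pent_tiling V E" "pent_tiling V' E'"
    and FV: "bij_betw FV V V'" and FE: "bij_betw FE E E'" and FR: "bij_betw FR (regions V E) (regions V' E')"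
    and edge: "\<And>e. e \<in> E \<Longrightarrow> FE e \<inter> V' = FV ` (e \<inter> V)"
    and bnd: "\<And>r. r \<in> regions V E \<Longrightarrow> \<exists>F\<subseteq>E. closure r - r = \<Union>F \<and> closure (FR r) - FR r = \<Union>(FE ` F)"
  shows "tiling_isomorphic V E V' E'"
proof -
  interpret A: pent_tiling V E by (rule t(1))
  interpret B: pent_tiling V' E' by (rule t(2))
  have FE_in: "FE e \<in> E'" if "e \<in> E" for e using that FE by (auto simp: bij_betw_def)
  have FR_in: "FR r \<in> regions V' E'" if "r \<in> regions V E" for r using that FR by (auto simp: bij_betw_def)
  have FV_inj: "inj_on FV V" and FE_inj: "inj_on FE E" and FR_inj: "inj_on FR (regions V E)"
    using FV FE FR by (simp_all add: bij_betw_def)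
  have "\<forall>e\<in>E. \<exists>H. continuous_on e H \<and> inj_on H e \<and> H ` e = FE e \<and> (\<forall>v\<in>e \<inter> V. H v = FV v)"
  proof
    fix e assume e: "e \<in> E"
    let ?g = "A.edge_arc e" and ?k = "B.edge_arc (FE e)"
    note g = A.edge_arc[OF e] and k = B.edge_arc[OF FE_in[OF e]]
    obtain h where h: "homeomorphism {0..1} e ?g h" using homeomorphism_arc[OF g(1)] g(2) by metis
    have "{pathstart ?k, pathfinish ?k} = {FV (pathstart ?g), FV (pathfinish ?g)}"
      using edge[OF e] unfolding g(3) k(3) by simp
    \<comment> \<open>The arc chosen for the target edge may run from the wrong end; reversing it
      makes the parametrisations agree with \<open>FV\<close> at both ends.\<close>
    then have "\<exists>k. arc k \<and> path_image k = FE e \<and> pathstart k = FV (pathstart ?g) \<and> pathfinish k = FV (pathfinish ?g)"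
      unfolding doubleton_eq_iff
    proof
      assume "pathstart ?k = FV (pathstart ?g) \<and> pathfinish ?k = FV (pathfinish ?g)"
      then show ?thesis using k by blast
    next
      assume "pathstart ?k = FV (pathfinish ?g) \<and> pathfinish ?k = FV (pathstart ?g)"
      then show ?thesis using k by (intro exI[of _ "reversepath ?k"]) (simp add: arc_reversepath)
    qed
    then obtain l where l: "arc l" "path_image l = FE e" "pathstart l = FV (pathstart ?g)" "pathfinish l = FV (pathfinish ?g)"
      by blast
    have hi: "h ` e = {0..1}" by (rule homeomorphism_image2[OF h])
    have "h (?g 0) = 0" "h (?g 1) = 1" using homeomorphism_apply1[OF h] by simp_all
    then have ends: "(l \<circ> h) (pathstart ?g) = FV (pathstart ?g)" "(l \<circ> h) (pathfinish ?g) = FV (pathfinish ?g)"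
      using l(3,4) by (simp_all add: pathstart_def pathfinish_def)
    show "\<exists>H. continuous_on e H \<and> inj_on H e \<and> H ` e = FE e \<and> (\<forall>v\<in>e \<inter> V. H v = FV v)"
    proof (intro exI[of _ "l \<circ> h"] conjI)
      show "continuous_on e (l \<circ> h)"
        using homeomorphism_cont2[OF h] arc_imp_path[OF l(1)] hi by (intro continuous_on_compose) (simp_all add: path_def)
      have "inj_on h e" by (rule inj_on_inverseI[of _ ?g]) (rule homeomorphism_apply2[OF h])
      then show "inj_on (l \<circ> h) e" using l(1) hi by (intro comp_inj_on) (simp_all add: arc_def)
      show "(l \<circ> h) ` e = FE e" unfolding image_comp[symmetric] hi using l(2) by (simp add: path_image_def)
      show "\<forall>v\<in>e \<inter> V. (l \<circ> h) v = FV v" unfolding g(3) using ends by simp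
    qed
  qed
  from bchoice[OF this] obtain H
    where H0: "\<forall>e\<in>E. continuous_on e (H e) \<and> inj_on (H e) e \<and> H e ` e = FE e \<and> (\<forall>v\<in>e \<inter> V. H e v = FV v)" ..
  have H: "continuous_on e (H e)" "inj_on (H e) e" "H e ` e = FE e" "v \<in> e \<inter> V \<Longrightarrow> H e v = FV v" if "e \<in> E" for e v
    using bspec[OF H0 that] by blast+
  \<comment> \<open>The choice of the edge is immaterial: distinct edges meet only in vertices, and
    there \<open>FV\<close> decides.\<close>
  define h1 where "h1 x = (if x \<in> V then FV x else H (SOME e. e \<in> E \<and> x \<in> e) x)" for x
  have h1: "h1 x = H e x" if "e \<in> E" "x \<in> e" for e x
  proof (cases "x \<in> V")
    case True
    then show ?thesis using H(4)[OF that(1), of x] that(2) by (simp add: h1_def)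
  next
    case False
    let ?e = "SOME e. e \<in> E \<and> x \<in> e"
    have "?e \<in> E \<and> x \<in> ?e" by (rule someI[of _ e]) (use that in simp)
    then have "?e = e" using A.edges_Int[of ?e e] that False by blast
    then show ?thesis using False by (simp add: h1_def)
  qed
  have h1_edge: "h1 ` e = FE e" "continuous_on e h1" "inj_on h1 e" if "e \<in> E" for e
  proof -
    show "h1 ` e = FE e" unfolding H(3)[OF that, symmetric] by (rule image_cong) (simp_all add: h1[OF that])
    show "continuous_on e h1" using H(1)[OF that] by (rule continuous_on_eq) (simp add: h1[OF that])
    show "inj_on h1 e" using H(2)[OF that] by (rule inj_on_cong[THEN iffD1, rotated]) (simp add: h1[OF that])
  qed
  have h1V: "x \<in> V" if "e \<in> E" "x \<in> e" "h1 x \<in> V'" for e x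
  proof -
    have "h1 ` (e \<inter> V) = FV ` (e \<inter> V)" by (rule image_cong) (simp_all add: h1_def)
    then have "FE e \<inter> V' = h1 ` (e \<inter> V)" using edge[OF that(1)] by simp
    moreover have "h1 x \<in> FE e" using h1_edge(1)[OF that(1)] that(2) by blast
    ultimately have "h1 x \<in> h1 ` (e \<inter> V)" using that(3) by blast
    then show ?thesis using inj_on_eq_imp_Int[OF h1_edge(3)[OF that(1)] that(2), of "e \<inter> V"] by blast
  qed
  have h1_inj: "inj_on h1 (\<Union>E)"
  proof (rule inj_onI)
    fix x y assume "x \<in> \<Union>E" "y \<in> \<Union>E" and eq: "h1 x = h1 y"
    then obtain e e' where e: "e \<in> E" "x \<in> e" "e' \<in> E" "y \<in> e'" by blast
    show "x = y"
    proof (cases "e = e'")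
      case True
      then show ?thesis using inj_onD[OF h1_edge(3)[OF e(1)] eq] e by simp
    next
      case False
      then have "FE e \<noteq> FE e'" using FE_inj e by (auto dest: inj_onD)
      then have "FE e \<inter> FE e' \<subseteq> V'" using B.edges_Int FE_in e by blast
      moreover have "h1 x \<in> FE e" "h1 y \<in> FE e'" using h1_edge(1)[OF e(1)] h1_edge(1)[OF e(3)] e by blast+
      ultimately have "h1 x \<in> V'" "h1 y \<in> V'" using eq by auto
      then have "x \<in> V" "y \<in> V" using h1V e by blast+
      then show ?thesis using eq FV_inj by (simp add: h1_def inj_onD)
    qed
  qed
  have h1_img: "h1 ` \<Union>F = \<Union>(FE ` F)" if "F \<subseteq> E" for F
    using h1_edge(1) that by (simp add: image_Union) (metis (no_types, lifting) SUP_cong subsetD)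
  have h1_cont: "continuous_on (\<Union>F) h1" if "F \<subseteq> E" for F
    by (rule continuous_on_Union_closed) (use that finite_subset[OF that A.finite_VE(2)] A.closed_edge h1_edge(2) in auto)
  have "\<forall>r\<in>regions V E. \<exists>\<psi>. continuous_on (closure r) \<psi> \<and> inj_on \<psi> (closure r) \<and> \<psi> ` r = FR r \<and> (\<forall>x\<in>closure r - r. \<psi> x = h1 x)"
  proof
    fix r assume r: "r \<in> regions V E"
    obtain F where F: "F \<subseteq> E" "closure r - r = \<Union>F" "closure (FR r) - FR r = \<Union>(FE ` F)" using bnd[OF r] by blast
    obtain h h' where h: "homeomorphism (closure r) (cball (0::real^2) 1) h h'" "h ` r = ball 0 1"
      using A.region_disc_exists[OF r] by blast
    obtain k k' where k: "homeomorphism (closure (FR r)) (cball (0::real^2) 1) k k'" "k ` FR r = ball 0 1"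
      using B.region_disc_exists[OF FR_in[OF r]] by blast
    have "continuous_on (closure r - r) h1" unfolding F(2) by (rule h1_cont[OF F(1)])
    moreover have "inj_on h1 (closure r - r)" unfolding F(2) by (rule inj_on_subset[OF h1_inj]) (use F(1) in blast)
    moreover have "h1 ` (closure r - r) = closure (FR r) - FR r" unfolding F(2,3) by (rule h1_img[OF F(1)])
    ultimately show "\<exists>\<psi>. continuous_on (closure r) \<psi> \<and> inj_on \<psi> (closure r) \<and> \<psi> ` r = FR r \<and> (\<forall>x\<in>closure r - r. \<psi> x = h1 x)"
      by (rule disc_extension[OF h(1) closure_subset h(2) k(1) closure_subset k(2)])
  qed
  from bchoice[OF this] obtain \<Psi> where P0: "\<forall>r\<in>regions V E. continuous_on (closure r) (\<Psi> r) \<and> inj_on (\<Psi> r) (closure r) \<and>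
    \<Psi> r ` r = FR r \<and> (\<forall>x\<in>closure r - r. \<Psi> r x = h1 x)" ..
  have \<Psi>: "continuous_on (closure r) (\<Psi> r)" "inj_on (\<Psi> r) (closure r)"
    "\<Psi> r ` r = FR r" "x \<in> closure r - r \<Longrightarrow> \<Psi> r x = h1 x" if "r \<in> regions V E" for r x
    using bspec[OF P0 that] by blast+
  have disj: "r = r'" if "r \<in> regions V E" "r' \<in> regions V E" "x \<in> r" "x \<in> r'" for r r' x
    using components_nonoverlap[of r "S2 - \<Union>E" r'] that unfolding A.regions_eq by blast
  have disj': "r = r'" if "r \<in> regions V' E'" "r' \<in> regions V' E'" "x \<in> r" "x \<in> r'" for r r' x
    using components_nonoverlap[of r "S2 - \<Union>E'" r'] that unfolding B.regions_eq by blast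
  define K where "K x = (if x \<in> \<Union>E then h1 x else \<Psi> (SOME r. r \<in> regions V E \<and> x \<in> r) x)" for x
  have K_reg: "K x = \<Psi> r x" if r: "r \<in> regions V E" "x \<in> r" for r x
  proof -
    let ?r = "SOME r. r \<in> regions V E \<and> x \<in> r"
    have "?r \<in> regions V E \<and> x \<in> ?r" by (rule someI[of _ r]) (use r in simp)
    then have "?r = r" using disj r by blast
    moreover have "x \<notin> \<Union>E" using A.region_sub[OF r(1)] r(2) by blast
    ultimately show ?thesis by (simp add: K_def)
  qed
  have K_closure: "K x = \<Psi> r x" if r: "r \<in> regions V E" "x \<in> closure r" for r x
  proof (cases "x \<in> r")
    case True then show ?thesis by (rule K_reg[OF r(1)])
  next
    case False
    obtain F where "F \<subseteq> E" "closure r - r = \<Union>F" using bnd[OF r(1)] by blast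
    then have "x \<in> \<Union>E" using r False by blast
    then show ?thesis using \<Psi>(4)[OF r(1), of x] r False by (simp add: K_def)
  qed
  have K_img: "K ` r = FR r" if "r \<in> regions V E" for r
    unfolding \<Psi>(3)[OF that, symmetric] by (rule image_cong) (simp_all add: K_reg[OF that])
  have K_E: "K ` \<Union>E = \<Union>E'"
  proof -
    have "K ` \<Union>E = h1 ` \<Union>E" by (rule image_cong) (simp_all add: K_def)
    also have "\<dots> = \<Union>E'" using h1_img[of E] FE by (simp add: bij_betw_def)
    finally show ?thesis .
  qed
  have S: "S2 = \<Union>E \<union> \<Union>(regions V E)" "S2 = \<Union>E' \<union> \<Union>(regions V' E')"
    using A.E_sub B.E_sub unfolding A.regions_eq B.regions_eq Union_components by blast+
  \<comment> \<open>Finitely many closed pieces, the edges and the closed tiles, cover the sphere,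
    and the map is continuous on each.\<close>
  have "continuous_on (\<Union>(E \<union> closure ` regions V E)) K"
  proof (rule continuous_on_Union_closed)
    show "finite (E \<union> closure ` regions V E)" using A.finite_VE A.finite_regions by simp
    fix T assume "T \<in> E \<union> closure ` regions V E"
    then consider "T \<in> E" | r where "r \<in> regions V E" "T = closure r" by blast
    then have "closed T \<and> continuous_on T K"
    proof cases
      case 1
      then have "h1 x = K x" if "x \<in> T" for x using that by (auto simp: K_def)
      then have "continuous_on T K" by (rule continuous_on_eq[OF h1_edge(2)[OF 1]])
      then show ?thesis using A.closed_edge[OF 1] by simp
    next
      case 2
      have "continuous_on (closure r) K" using \<Psi>(1)[OF 2(1)] by (rule continuous_on_eq) (simp add: K_closure[OF 2(1)])
      then show ?thesis using 2 by simp
    qed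
    then show "closed T" "continuous_on T K" by simp_all
  qed
  moreover have "S2 \<subseteq> \<Union>(E \<union> closure ` regions V E)" unfolding S(1) using closure_subset by blast
  ultimately have K_cont: "continuous_on S2 K" by (rule continuous_on_subset)
  have K_surj: "K ` S2 = S2"
  proof -
    have "K ` \<Union>(regions V E) = \<Union>(FR ` regions V E)" using K_img by (simp add: image_Union)
    then have "K ` \<Union>(regions V E) = \<Union>(regions V' E')" using FR by (simp add: bij_betw_def)
    then show ?thesis using K_E S by (metis image_Un)
  qed
  have K_inj: "inj_on K S2"
  proof (rule inj_onI)
    fix x y assume xy: "x \<in> S2" "y \<in> S2" and eq: "K x = K y"
    have out: "K u \<notin> \<Union>E'" if "u \<in> r" "r \<in> regions V E" for u r
      using K_img[OF that(2)] that(1) B.region_sub[OF FR_in[OF that(2)]] by blast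
    have cov: "u \<in> \<Union>E \<or> (\<exists>r\<in>regions V E. u \<in> r)" if "u \<in> S2" for u
      using subsetD[OF equalityD1[OF S(1)] that] by blast
    consider "x \<in> \<Union>E" "y \<in> \<Union>E" | r where "x \<in> r" "r \<in> regions V E" | r where "y \<in> r" "r \<in> regions V E"
      using cov[OF xy(1)] cov[OF xy(2)] by blast
    then show "x = y"
    proof cases
      case 1
      then show ?thesis using eq h1_inj by (simp add: K_def inj_onD)
    next
      case 2
      then have "y \<notin> \<Union>E" using out[OF 2] eq K_E by (metis imageI)
      then obtain r' where r': "r' \<in> regions V E" "y \<in> r'" using cov[OF xy(2)] by blast
      have "K x \<in> FR r" "K x \<in> FR r'" using K_img 2 r' eq by blast+
      then have "FR r = FR r'" using disj' FR_in 2 r' by blast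
      then have "r = r'" using FR_inj 2 r' by (simp add: inj_on_eq_iff)
      then have "\<Psi> r x = \<Psi> r y" using eq K_reg 2 r' by metis
      then show ?thesis using inj_onD[OF \<Psi>(2)[OF 2(2)]] 2 r' \<open>r = r'\<close> closure_subset[of r] by blast
    next
      case 3
      then have "x \<notin> \<Union>E" using out[OF 3] eq K_E by (metis imageI)
      then obtain r' where r': "r' \<in> regions V E" "x \<in> r'" using cov[OF xy(1)] by blast
      have "K x \<in> FR r" "K x \<in> FR r'" using K_img 3 r' eq by (metis imageI)+
      then have "FR r = FR r'" using disj' FR_in 3 r' by blast
      then have "r = r'" using FR_inj 3 r' by (simp add: inj_on_eq_iff)
      then have "\<Psi> r x = \<Psi> r y" using eq K_reg 3 r' by metis
      then show ?thesis using inj_onD[OF \<Psi>(2)[OF 3(2)]] 3 r' \<open>r = r'\<close> closure_subset[of r] by blast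
    qed
  qed
  obtain K' where "homeomorphism S2 S2 K K'" using homeomorphism_compact[OF compact_sphere K_cont K_surj K_inj] by blast
  moreover have "K ` V = V'"
  proof -
    have "V \<subseteq> \<Union>E" using A.graph_eq by blast
    then have "K ` V = FV ` V" by (intro image_cong) (auto simp: K_def h1_def)
    then show ?thesis using FV by (simp add: bij_betw_def)
  qed
  moreover have "(\<lambda>e. K ` e) ` E = E'"
  proof -
    have "K ` e = FE e" if "e \<in> E" for e
      unfolding h1_edge(1)[OF that, symmetric] by (rule image_cong) (use that in \<open>auto simp: K_def\<close>)
    then have "(\<lambda>e. K ` e) ` E = FE ` E" by (rule image_cong[OF refl])
    then show ?thesis using FE by (simp add: bij_betw_def)
  qed
  ultimately show ?thesis unfolding tiling_isomorphic_def by blast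
qed

section \<open>The pentagons of the earth map\<close>

context earthlike
begin

text \<open>The vertices of the pentagon \<open>(c, i)\<close> in the order in which \<open>earth_pentagons\<close> lists them, which is opposite to
  the orientation of the darts for \<open>c = 2\<close> and \<open>c = 3\<close>.\<close>

definition pentagon_order :: "nat \<Rightarrow> nat list" where
  "pentagon_order c = (if c < 2 then [0, 1, 2, 3, 4] else if c = 2 then [1, 0, 4, 3, 2] else [0, 4, 3, 2, 1])"

definition pentagon :: "nat \<times> int \<Rightarrow> earth_vertex list" where
  "pentagon = (\<lambda>(c, i). map (\<lambda>m. dart_vertex (c, i, m)) (pentagon_order c))"

lemma pentagon_simps:
  "pentagon (0, i) = [North_Pole, VX (ix i), VY' (ix i), VY (ix (i + 1)), VX (ix (i + 1))]"
  "pentagon (Suc 0, i) = [VX (ix i), VY (ix i), VZ (ix i), VZ' (ix i), VY' (ix i)]"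
  "pentagon (2, i) = [VY' (ix i), VY (ix (i + 1)), VZ (ix (i + 1)), VW (ix (i + 1)), VZ' (ix i)]"
  "pentagon (3, i) = [South_Pole, VW (ix i), VZ (ix i), VZ' (ix i), VW (ix (i + 1))]"
  by (simp_all add: pentagon_def pentagon_order_def dart_vertex_simps)

lemma pentagon_indexE:
  assumes "p \<in> {..<4::nat} \<times> {0..<int k}"
  obtains i where "i < k" "p = (0, int i)" | i where "i < k" "p = (Suc 0, int i)"
    | i where "i < k" "p = (2, int i)" | i where "i < k" "p = (3, int i)"
proof -
  obtain c j where p: "p = (c, j)" by (cases p)
  have c: "c = 0 \<or> c = Suc 0 \<or> c = 2 \<or> c = 3" using assms p by auto
  have "j = int (nat j)" "nat j < k" using assms p by auto
  then show thesis using that[of "nat j"] c p by metis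
qed

lemma earth_pentagons_eq: "earth_pentagons k = pentagon ` ({..<4::nat} \<times> {0..<int k})"
proof
  show "earth_pentagons k \<subseteq> pentagon ` ({..<4::nat} \<times> {0..<int k})"
  proof
    fix l assume "l \<in> earth_pentagons k"
    then obtain i where i: "i < k" "l \<in> {pentagon (0, int i), pentagon (Suc 0, int i), pentagon (2, int i), pentagon (3, int i)}"
      unfolding earth_pentagons_def Let_def pentagon_simps by (auto simp: ix_simps)
    from i(2) have "\<exists>c<4::nat. l = pentagon (c, int i)"
      by (elim insertE emptyE)
        (rule exI[of _ 0], simp, rule exI[of _ "Suc 0"], simp, rule exI[of _ 2], simp, rule exI[of _ 3], simp)
    then obtain c where "c < 4" "l = pentagon (c, int i)" by blast
    then show "l \<in> pentagon ` ({..<4::nat} \<times> {0..<int k})" using i(1) by (intro image_eqI[of _ _ "(c, int i)"]) auto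
  qed
  show "pentagon ` ({..<4::nat} \<times> {0..<int k}) \<subseteq> earth_pentagons k"
  proof (intro image_subsetI)
    fix p assume "p \<in> {..<4::nat} \<times> {0..<int k}"
    then show "pentagon p \<in> earth_pentagons k"
      by (rule pentagon_indexE) (auto simp: earth_pentagons_def Let_def pentagon_simps ix_simps)
  qed
qed

lemma pentagon_inj: "inj_on pentagon ({..<4::nat} \<times> {0..<int k})"
proof (rule inj_onI)
  fix p q assume p: "p \<in> {..<4::nat} \<times> {0..<int k}" and q: "q \<in> {..<4::nat} \<times> {0..<int k}" and eq: "pentagon p = pentagon q"
  from p show "p = q"
    by (rule pentagon_indexE; use q in \<open>rule pentagon_indexE\<close>) (use eq in \<open>simp_all add: pentagon_simps ix_simps\<close>)
qed

lemma place_next: "0 \<le> i \<Longrightarrow> i < int k \<Longrightarrow> c < 4 \<Longrightarrow>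
    n (place (c, i, 0)) = place (c, i, 1) \<and> n (place (c, i, 1)) = place (c, i, 2) \<and> n (place (c, i, 2)) = place (c, i, 3) \<and>
    n (place (c, i, 3)) = place (c, i, 4) \<and> n (place (c, i, 4)) = place (c, i, 0)"
  using place_n[of "(c, i, 0)"] place_n[of "(c, i, 1)"] place_n[of "(c, i, 2)"] place_n[of "(c, i, 3)"] place_n[of "(c, i, 4)"]
  by (simp add: model_def model_n_def flip: numeral_2_eq_2)

end

section \<open>Back from darts to the tiling of the sphere\<close>

context sphere_tiling
begin

abbreviation D :: "((real^3) set \<times> bool) set" where "D \<equiv> plane.darts"
abbreviation nd :: "(real^3) set \<times> bool \<Rightarrow> (real^3) set \<times> bool" where "nd \<equiv> plane.next_dart"
abbreviation od :: "(real^3) set \<times> bool \<Rightarrow> complex" where "od \<equiv> plane.org"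

lemma dart_image: "d \<in> D \<Longrightarrow> path_image (f \<circ> edge_arc (fst d)) = f ` fst d"
  using edge_arc(2)[OF plane.fst_darts] by (simp add: path_image_compose)

lemma dart_vertices: "d \<in> D \<Longrightarrow> f ` (fst d \<inter> V) = {od d, od (plane.opp d)}"
  using plane.edge_V[of d] dart_image[of d]
    inj_on_image_Int[OF f_inj edge_punctured[OF plane.fst_darts[of d]] V_punctured] by simp

lemma image_g_f: "A \<subseteq> S2 - {w} \<Longrightarrow> g ` f ` A = A"
  unfolding image_image using homeomorphism_apply1[OF fg] by (intro set_eqI) force

lemma dart_vertices': "d \<in> D \<Longrightarrow> fst d \<inter> V = {g (od d), g (od (nd d))}"
proof -
  assume d: "d \<in> D"
  have "fst d \<inter> V = g ` f ` (fst d \<inter> V)" using image_g_f[of "fst d \<inter> V"] V_punctured by blast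
  then show ?thesis unfolding dart_vertices[OF d] plane.org_opp[OF d] by simp
qed

lemma g_od_V: "d \<in> D \<Longrightarrow> g (od d) \<in> V"
  using dart_vertices' by blast

lemma g_inj: "g z = g z' \<longleftrightarrow> z = z'"
  by (metis f_g)

text \<open>The two darts of an edge start at different vertices, so each edge at \<open>v\<close>
  contributes exactly one dart.\<close>

lemma darts_at_vertex: "v \<in> V \<Longrightarrow> card {d \<in> D. od d = f v} = vertex_degree E v"
proof -
  assume v: "v \<in> V"
  have gfv: "g (f v) = v" using gf V_punctured v by blast
  have "bij_betw fst {d \<in> D. od d = f v} {e \<in> E. v \<in> e}"
    unfolding bij_betw_def
  proof
    show "inj_on fst {d \<in> D. od d = f v}"
    proof (rule inj_onI)
      fix d d' assume d: "d \<in> {d \<in> D. od d = f v}" "d' \<in> {d \<in> D. od d = f v}" "fst d = fst d'"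
      then have "d' = d \<or> d' = plane.opp d" by (simp only: plane.fst_eq_iff)
      moreover have "d \<in> D" using d(1) by simp
      then have "od (plane.opp d) \<noteq> od d" by (rule plane.org_neq)
      ultimately show "d = d'" using d(1,2) by auto
    qed
    show "fst ` {d \<in> D. od d = f v} = {e \<in> E. v \<in> e}"
    proof
      show "fst ` {d \<in> D. od d = f v} \<subseteq> {e \<in> E. v \<in> e}"
      proof (intro image_subsetI CollectI conjI)
        fix d assume d: "d \<in> {d \<in> D. od d = f v}"
        then show "fst d \<in> E" using plane.fst_darts by simp
        have "g (od d) = v" using d gfv by simp
        then show "v \<in> fst d" using dart_vertices'[of d] d by blast
      qed
      show "{e \<in> E. v \<in> e} \<subseteq> fst ` {d \<in> D. od d = f v}"
      proof
        fix e assume e: "e \<in> {e \<in> E. v \<in> e}"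
        have D: "(e, True) \<in> D" using e by (simp add: plane.darts_def)
        have "f v \<in> f ` (e \<inter> V)" using e v by blast
        then have "od (e, True) = f v \<or> od (plane.opp (e, True)) = f v" using dart_vertices[OF D] by auto
        then show "e \<in> fst ` {d \<in> D. od d = f v}"
        proof
          assume "od (e, True) = f v"
          then show ?thesis using D by (intro image_eqI[of _ _ "(e, True)"]) simp_all
        next
          assume "od (plane.opp (e, True)) = f v"
          then show ?thesis using D by (intro image_eqI[of _ _ "plane.opp (e, True)"]) simp_all
        qed
      qed
    qed
  qed
  then show ?thesis unfolding vertex_degree_def by (rule bij_betw_same_card)
qed

lemma walk_adjacency:
  assumes u: "u \<in> V" and "(f u, z) \<in> {(od e, od (nd e)) | e. e \<in> D} ^^ m"
  shows "\<exists>v\<in>V. z = f v \<and> (u, v) \<in> adjacency V E ^^ m"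
  using assms(2)
proof (induction m arbitrary: z)
  case 0
  then show ?case using u by auto
next
  case (Suc m)
  then obtain y where y: "(f u, y) \<in> {(od e, od (nd e)) | e. e \<in> D} ^^ m" "(y, z) \<in> {(od e, od (nd e)) | e. e \<in> D}"
    by (elim relpow_Suc_E)
  from Suc.IH[OF y(1)] obtain v where v: "v \<in> V" "y = f v" "(u, v) \<in> adjacency V E ^^ m" by blast
  from y(2) obtain d where d: "d \<in> D" "y = od d" "z = od (nd d)" by blast
  have "v \<in> S2" "v \<noteq> w" using V_punctured v(1) by blast+
  then have "g (f v) = v" by (rule gf)
  then have "g (od d) = v" using v(2) d(2) by simp
  then have "fst d \<inter> V = {v, g z}" using dart_vertices'[OF d(1)] d(3) by simp
  then have "(v, g z) \<in> adjacency V E" using plane.fst_darts[OF d(1)] by (auto simp: adjacency_def)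
  then have "(u, g z) \<in> adjacency V E ^^ Suc m" by (rule relpow_Suc_I[OF v(3)])
  moreover have "g z \<in> V" "z = f (g z)" using g_od_V[OF plane.next_dart_darts[OF d(1)]] d(3) f_g by simp_all
  ultimately show ?case by blast
qed

lemma graph_dist_le:
  assumes "u \<in> V" "v \<in> V" "(f u, f v) \<in> {(od e, od (nd e)) | e. e \<in> D} ^^ m" "m \<le> 4"
  shows "graph_dist V E u v \<le> 4"
proof -
  obtain v' where v': "v' \<in> V" "f v = f v'" "(u, v') \<in> adjacency V E ^^ m" using walk_adjacency[OF assms(1,3)] by blast
  have "v' = v" using inj_onD[OF f_inj v'(2)] assms(2) v'(1) V_punctured by blast
  then have "graph_dist V E u v \<le> enat m" unfolding graph_dist_def using v'(3) by (intro INF_lower) simp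
  also have "\<dots> \<le> 4" using assms(4) by (simp add: numeral_eq_enat)
  finally show ?thesis .
qed

text \<open>\<open>FL\<close> begins at an arbitrary dart of the tile; this form begins at a
  prescribed one.\<close>

lemma region_edges:
  assumes d: "d \<in> D"
  shows "closure (plane.reg d) - plane.reg d = fst d \<union> fst (nd d) \<union> fst (nd (nd d)) \<union> fst (nd (nd (nd d))) \<union> fst (nd (nd (nd (nd d))))"
proof -
  let ?r = "plane.reg d" and ?S = "{d, nd d, nd (nd d), nd (nd (nd d)), nd (nd (nd (nd d)))}"
  have r: "?r \<in> regions V E" by (rule plane.reg(1)[OF d])
  have S_D: "?S \<subseteq> D" using d plane.next_dart_darts by simp
  have regS: "plane.reg x = ?r" if "x \<in> ?S" for x
  proof -
    have D: "nd d \<in> D" "nd (nd d) \<in> D" "nd (nd (nd d)) \<in> D" using S_D by simp_all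
    show ?thesis using that plane.reg_next[OF d] plane.reg_next[OF D(1)] plane.reg_next[OF D(2)] plane.reg_next[OF D(3)]
      by (elim insertE emptyE) (simp_all only:)
  qed
  have FS: "set (plane.FL ?r) = ?S"
  proof
    show "?S \<subseteq> set (plane.FL ?r)"
    proof
      fix x assume x: "x \<in> ?S"
      then have "x \<in> D" using S_D by blast
      from plane.reg(2)[OF this] show "x \<in> set (plane.FL ?r)" unfolding regS[OF x] .
    qed
    show "set (plane.FL ?r) \<subseteq> ?S"
    proof
      fix x assume x: "x \<in> set (plane.FL ?r)"
      then have xD: "x \<in> D" using plane.FL_facts(2)[OF r] by blast
      have "?r = plane.reg x" by (rule plane.FL_inj[OF r plane.reg(1)[OF xD] x plane.reg(2)[OF xD]])
      then show "x \<in> ?S"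
      proof (rule plane.reg_eq_next[OF d xD])
        show "d \<in> ?S" by simp
        show "nd y \<in> ?S" if "y \<in> ?S" for y
          using that plane.next5(1)[OF d] by (elim insertE emptyE) simp_all
      qed
    qed
  qed
  have "f ` (closure ?r - ?r) = (\<Union>x\<in>?S. path_image (f \<circ> edge_arc (fst x)))"
    using plane.FL_facts(6)[OF r] unfolding region_boundary_image[OF r] FS .
  also have "\<dots> = (\<Union>x\<in>?S. f ` fst x)" by (rule SUP_cong[OF refl]) (use S_D dart_image in blast)
  also have "\<dots> = f ` (\<Union>x\<in>?S. fst x)" by blast
  finally have eq: "f ` (closure ?r - ?r) = f ` (\<Union>x\<in>?S. fst x)" .
  have 1: "(\<Union>x\<in>?S. fst x) \<subseteq> S2 - {w}" using S_D edge_punctured plane.fst_darts by (intro UN_least) blast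
  obtain es where "set es \<subseteq> E" "closure ?r - ?r = \<Union>(set es)" by (rule region_boundary[OF r])
  then have 2: "closure ?r - ?r \<subseteq> S2 - {w}" using edge_punctured by blast
  have "closure ?r - ?r = (\<Union>x\<in>?S. fst x)"
    using eq inj_on_image_eq_iff[OF f_inj 2 1] by simp
  then show ?thesis by auto
qed

text \<open>An unrolled boundary of five edges: rotation and reversal become permutations of the
  arguments, without arithmetic on list indices.\<close>

definition edge_cycle where
  "edge_cycle r v0 v1 v2 v3 v4 e0 e1 e2 e3 e4 \<longleftrightarrow> distinct [v0, v1, v2, v3, v4] \<and> {v0, v1, v2, v3, v4} \<subseteq> V \<and>
    distinct [e0, e1, e2, e3, e4] \<and> {e0, e1, e2, e3, e4} \<subseteq> E \<and> e0 \<inter> V = {v0, v1} \<and> e1 \<inter> V = {v1, v2} \<and>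
    e2 \<inter> V = {v2, v3} \<and> e3 \<inter> V = {v3, v4} \<and> e4 \<inter> V = {v4, v0} \<and> closure r - r = e0 \<union> e1 \<union> e2 \<union> e3 \<union> e4"

lemma edge_cycleD:
  assumes "edge_cycle r v0 v1 v2 v3 v4 e0 e1 e2 e3 e4"
  shows "distinct [v0, v1, v2, v3, v4]" "{v0, v1, v2, v3, v4} \<subseteq> V" "distinct [e0, e1, e2, e3, e4]"
    "{e0, e1, e2, e3, e4} \<subseteq> E" "e0 \<inter> V = {v0, v1}" "e1 \<inter> V = {v1, v2}"
    "e2 \<inter> V = {v2, v3}" "e3 \<inter> V = {v3, v4}" "e4 \<inter> V = {v4, v0}" "closure r - r = e0 \<union> e1 \<union> e2 \<union> e3 \<union> e4"
  using assms unfolding edge_cycle_def by - (elim conjE, assumption)+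

lemma edge_cycle_rotate:
  assumes "edge_cycle r v0 v1 v2 v3 v4 e0 e1 e2 e3 e4"
  shows "edge_cycle r v1 v2 v3 v4 v0 e1 e2 e3 e4 e0"
  unfolding edge_cycle_def
proof (intro conjI)
  show "distinct [v1, v2, v3, v4, v0]" using edge_cycleD(1)[OF assms] by auto
  show "distinct [e1, e2, e3, e4, e0]" using edge_cycleD(3)[OF assms] by auto
  show "{v1, v2, v3, v4, v0} \<subseteq> V" using edge_cycleD(2)[OF assms] by simp
  show "{e1, e2, e3, e4, e0} \<subseteq> E" using edge_cycleD(4)[OF assms] by simp
  show "closure r - r = e1 \<union> e2 \<union> e3 \<union> e4 \<union> e0" unfolding edge_cycleD(10)[OF assms] by (simp only: Un_ac)
qed (rule edge_cycleD(5-9)[OF assms])+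

lemma edge_cycle_reverse:
  assumes "edge_cycle r v0 v1 v2 v3 v4 e0 e1 e2 e3 e4"
  shows "edge_cycle r v0 v4 v3 v2 v1 e4 e3 e2 e1 e0"
  unfolding edge_cycle_def
proof (intro conjI)
  show "distinct [v0, v4, v3, v2, v1]" using edge_cycleD(1)[OF assms] by auto
  show "distinct [e4, e3, e2, e1, e0]" using edge_cycleD(3)[OF assms] by auto
  show "{v0, v4, v3, v2, v1} \<subseteq> V" using edge_cycleD(2)[OF assms] by simp
  show "{e4, e3, e2, e1, e0} \<subseteq> E" using edge_cycleD(4)[OF assms] by simp
  show "closure r - r = e4 \<union> e3 \<union> e2 \<union> e1 \<union> e0" unfolding edge_cycleD(10)[OF assms] by (simp only: Un_ac)
  show "e4 \<inter> V = {v0, v4}" "e3 \<inter> V = {v4, v3}" "e2 \<inter> V = {v3, v2}" "e1 \<inter> V = {v2, v1}" "e0 \<inter> V = {v1, v0}"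
    unfolding edge_cycleD(5-9)[OF assms] by (rule insert_commute)+
qed

lemma boundary_cycle5:
  assumes "edge_cycle r v0 v1 v2 v3 v4 e0 e1 e2 e3 e4"
  shows "boundary_cycle V E r [v0, v1, v2, v3, v4]"
proof -
  note e = edge_cycleD[OF assms]
  have l: "length [v0, v1, v2, v3, v4] = 5" by simp
  show ?thesis unfolding boundary_cycle_def l all_less5
  proof (intro conjI exI[of _ "[e0, e1, e2, e3, e4]"])
    show "closure r - r = \<Union>(set [e0, e1, e2, e3, e4])" unfolding e(10) by (simp add: Un_assoc)
    show "[e0, e1, e2, e3, e4] ! 0 \<inter> V = {[v0, v1, v2, v3, v4] ! 0, [v0, v1, v2, v3, v4] ! ((0 + 1) mod 5)}"
      "[e0, e1, e2, e3, e4] ! 1 \<inter> V = {[v0, v1, v2, v3, v4] ! 1, [v0, v1, v2, v3, v4] ! ((1 + 1) mod 5)}"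
      "[e0, e1, e2, e3, e4] ! 2 \<inter> V = {[v0, v1, v2, v3, v4] ! 2, [v0, v1, v2, v3, v4] ! ((2 + 1) mod 5)}"
      "[e0, e1, e2, e3, e4] ! 3 \<inter> V = {[v0, v1, v2, v3, v4] ! 3, [v0, v1, v2, v3, v4] ! ((3 + 1) mod 5)}"
      "[e0, e1, e2, e3, e4] ! 4 \<inter> V = {[v0, v1, v2, v3, v4] ! 4, [v0, v1, v2, v3, v4] ! ((4 + 1) mod 5)}"
      using e(5-9) by simp_all
    show "set [e0, e1, e2, e3, e4] \<subseteq> E" using e(4) by simp
    show "set [v0, v1, v2, v3, v4] \<subseteq> V" using e(2) by simp
  qed (rule e(1,3) | simp)+
qed

lemma edge_cycle_dart:
  assumes d: "d \<in> D"
  shows "edge_cycle (plane.reg d) (g (od d)) (g (od (nd d))) (g (od (nd (nd d)))) (g (od (nd (nd (nd d))))) (g (od (nd (nd (nd (nd d))))))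
    (fst d) (fst (nd d)) (fst (nd (nd d))) (fst (nd (nd (nd d)))) (fst (nd (nd (nd (nd d)))))"
proof -
  have D: "nd d \<in> D" "nd (nd d) \<in> D" "nd (nd (nd d)) \<in> D" "nd (nd (nd (nd d))) \<in> D"
    using d by (simp_all add: plane.next_dart_darts)
  have dist: "distinct [od d, od (nd d), od (nd (nd d)), od (nd (nd (nd d))), od (nd (nd (nd (nd d))))]" by (rule plane.next5(2)[OF d])
  have vs: "distinct [g (od d), g (od (nd d)), g (od (nd (nd d))), g (od (nd (nd (nd d)))), g (od (nd (nd (nd (nd d)))))]"
    using dist by (simp add: g_inj)
  note v = dart_vertices'[OF d] dart_vertices'[OF D(1)] dart_vertices'[OF D(2)] dart_vertices'[OF D(3)] dart_vertices'[OF D(4)]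
  have v5: "fst (nd (nd (nd (nd d)))) \<inter> V = {g (od (nd (nd (nd (nd d))))), g (od d)}"
    using v(5) by (simp only: plane.next5(1)[OF d])
  have ed: "distinct [fst d, fst (nd d), fst (nd (nd d)), fst (nd (nd (nd d))), fst (nd (nd (nd (nd d))))]"
  proof -
    have ne: "x \<noteq> y" if "x \<inter> V = {a, b}" "y \<inter> V = {b', c}" "a \<noteq> b'" "a \<noteq> c" for x y :: "(real^3) set" and a b b' c
      using that by auto
    have ne': "x \<noteq> y" if "x \<inter> V = {a, b}" "y \<inter> V = {b', c}" "b \<noteq> b'" "b \<noteq> c" for x y :: "(real^3) set" and a b b' c
      using that by auto
    have x01: "fst d \<noteq> fst (nd d)" by (rule ne[OF v(1) v(2)]) (use vs in auto)
    have x02: "fst d \<noteq> fst (nd (nd d))" by (rule ne[OF v(1) v(3)]) (use vs in auto)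
    have x03: "fst d \<noteq> fst (nd (nd (nd d)))" by (rule ne[OF v(1) v(4)]) (use vs in auto)
    have x04: "fst d \<noteq> fst (nd (nd (nd (nd d))))" by (rule ne'[OF v(1) v5]) (use vs in auto)
    have x12: "fst (nd d) \<noteq> fst (nd (nd d))" by (rule ne[OF v(2) v(3)]) (use vs in auto)
    have x13: "fst (nd d) \<noteq> fst (nd (nd (nd d)))" by (rule ne[OF v(2) v(4)]) (use vs in auto)
    have x14: "fst (nd d) \<noteq> fst (nd (nd (nd (nd d))))" by (rule ne[OF v(2) v5]) (use vs in auto)
    have x23: "fst (nd (nd d)) \<noteq> fst (nd (nd (nd d)))" by (rule ne[OF v(3) v(4)]) (use vs in auto)
    have x24: "fst (nd (nd d)) \<noteq> fst (nd (nd (nd (nd d))))" by (rule ne[OF v(3) v5]) (use vs in auto)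
    have x34: "fst (nd (nd (nd d))) \<noteq> fst (nd (nd (nd (nd d))))" by (rule ne[OF v(4) v5]) (use vs in auto)
    show ?thesis using x01 x02 x03 x04 x12 x13 x14 x23 x24 x34 by simp
  qed
  show ?thesis unfolding edge_cycle_def
  proof (intro conjI)
    show "{fst d, fst (nd d), fst (nd (nd d)), fst (nd (nd (nd d))), fst (nd (nd (nd (nd d))))} \<subseteq> E"
      using d D plane.fst_darts by simp
    show "{g (od d), g (od (nd d)), g (od (nd (nd d))), g (od (nd (nd (nd d)))), g (od (nd (nd (nd (nd d)))))} \<subseteq> V"
      using d D g_od_V by simp
  qed (rule vs ed v(1-4) v5 region_edges[OF d])+
qed

lemma is_earth_map_tiling:
  assumes \<nu>: "\<nu> \<in> V" "vertex_degree E \<nu> > 3"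
    and deg: "\<And>v. v \<in> V \<Longrightarrow> v \<noteq> \<nu> \<Longrightarrow> graph_dist V E \<nu> v \<le> 4 \<Longrightarrow> vertex_degree E v = 3"
  shows "earth_map_tiling (vertex_degree E \<nu>) V E"
proof -
  let ?k = "vertex_degree E \<nu>"
  have "card {d \<in> D. od d = f \<nu>} > 0" using darts_at_vertex[OF \<nu>(1)] \<nu>(2) by simp
  then have "{d \<in> D. od d = f \<nu>} \<noteq> {}" by (metis card.empty less_irrefl)
  then obtain t0 where t0: "t0 \<in> D" "od t0 = f \<nu>" by blast
  interpret P: earthlike D nd plane.opp od t0 ?k
  proof (intro earthlike.intro earthlike_axioms.intro)
    show "pentagonal_map D nd plane.opp od" by (rule plane.pentagonal_map_darts)
    show "t0 \<in> D" by (rule t0(1))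
    show "?k = card {d \<in> D. od d = od t0}" unfolding t0(2) by (rule darts_at_vertex[OF \<nu>(1), symmetric])
    fix d m assume d: "d \<in> D" "od d \<noteq> od t0" "(od t0, od d) \<in> {(od e, od (nd e)) | e. e \<in> D} ^^ m" "m \<le> 4"
    have v: "g (od d) \<in> V" "f (g (od d)) = od d" by (rule g_od_V[OF d(1)], rule f_g)
    have "g (od d) \<noteq> \<nu>" using d(2) t0(2) v(2) by auto
    moreover have "graph_dist V E \<nu> (g (od d)) \<le> 4"
      by (rule graph_dist_le[OF \<nu>(1) v(1) _ d(4)]) (use d(3) t0(2) v(2) in simp)
    ultimately have "vertex_degree E (g (od d)) = 3" by (rule deg[OF v(1)])
    then show "card {d' \<in> D. od d' = od d} = 3" using darts_at_vertex[OF v(1)] v(2) by simp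
  qed
  have orgD: "od ` D = f ` V"
  proof
    show "od ` D \<subseteq> f ` V" using plane.org_in_V by blast
    show "f ` V \<subseteq> od ` D"
    proof
      fix z assume "z \<in> f ` V"
      then obtain v where v: "v \<in> V" "z = f v" by blast
      have "card {d \<in> D. od d = f v} \<noteq> 0" using darts_at_vertex[OF v(1)] degree[OF v(1)] by simp
      then have "{d \<in> D. od d = f v} \<noteq> {}" by (metis card.empty)
      then obtain d where "d \<in> D" "od d = f v" by blast
      then show "z \<in> od ` D" using v(2) by (intro image_eqI[of _ _ d]) simp_all
    qed
  qed
  define \<phi> where "\<phi> u = g (P.position u)" for u
  have phi_bij: "bij_betw \<phi> (earth_vertices ?k) V"
  proof -
    have "bij_betw P.position (earth_vertices ?k) (f ` V)" using P.position_bij unfolding orgD .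
    moreover have "bij_betw g (f ` V) V"
      unfolding bij_betw_def using image_g_f[OF V_punctured] by (auto simp: inj_on_def g_inj)
    ultimately have "bij_betw (g \<circ> P.position) (earth_vertices ?k) V" by (rule bij_betw_trans)
    then show ?thesis unfolding \<phi>_def comp_def .
  qed
  have edges_bij: "bij_betw (\<lambda>e. e \<inter> V) E ((\<lambda>d. \<phi> ` d) ` earth_edges ?k)"
    unfolding bij_betw_def
  proof
    show "inj_on (\<lambda>e. e \<inter> V) E"
    proof (rule inj_onI)
      fix e e' assume e: "e \<in> E" "e' \<in> E" "e \<inter> V = e' \<inter> V"
      have D: "(e, True) \<in> D" "(e', True) \<in> D" using e by (simp_all add: plane.darts_def)
      have "{g (od (e, True)), g (od (nd (e, True)))} = {g (od (e', True)), g (od (nd (e', True)))}"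
        using dart_vertices'[OF D(1)] dart_vertices'[OF D(2)] e(3) by simp
      then have "od (e, True) = od (e', True) \<and> od (nd (e, True)) = od (nd (e', True)) \<or>
          od (e, True) = od (nd (e', True)) \<and> od (nd (e, True)) = od (e', True)"
        by (simp add: doubleton_eq_iff g_inj)
      then show "e = e'"
      proof
        assume "od (e, True) = od (e', True) \<and> od (nd (e, True)) = od (nd (e', True))"
        then have "(e, True) = (e', True)" by (intro P.no_parallel_darts D) simp_all
        then show ?thesis by simp
      next
        assume h: "od (e, True) = od (nd (e', True)) \<and> od (nd (e, True)) = od (e', True)"
        have O: "plane.opp (e', True) \<in> D" using D by simp
        have "(e, True) = plane.opp (e', True)"
          by (rule P.no_parallel_darts[OF D(1) O]) (use h plane.org_opp[OF D(2)] plane.org_opp[OF O] in simp_all)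
        then show ?thesis by (metis fst_conv plane.fst_opp)
      qed
    qed
    have E: "E = fst ` D" by (auto simp: plane.darts_def)
    have "(\<lambda>e. e \<inter> V) ` E = (\<lambda>e. e \<inter> V) ` fst ` D" by (rule arg_cong[OF E])
    also have "\<dots> = (\<lambda>d. {g (od d), g (od (nd d))}) ` D"
      unfolding image_image by (rule image_cong[OF refl]) (rule dart_vertices')
    also have "\<dots> = (\<lambda>A. g ` A) ` (\<lambda>d. {od d, od (nd d)}) ` D" unfolding image_image by simp
    also have "\<dots> = (\<lambda>A. g ` A) ` (\<lambda>d. P.position ` d) ` earth_edges ?k" unfolding P.position_edges ..
    also have "\<dots> = (\<lambda>d. \<phi> ` d) ` earth_edges ?k" unfolding image_image \<phi>_def ..
    finally show "(\<lambda>e. e \<inter> V) ` E = (\<lambda>d. \<phi> ` d) ` earth_edges ?k" .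
  qed
  let ?I = "{..<4::nat} \<times> {0..<int ?k}"
  define first where "first = (\<lambda>(c, i). P.place (c, i, 0))"
  have first_D: "first x \<in> D" if "x \<in> ?I" for x
    using that by (cases x) (auto simp: first_def P.model_def intro!: P.place_D)
  have reg_bij: "bij_betw (\<lambda>x. plane.reg (first x)) ?I (regions V E)"
    unfolding bij_betw_def
  proof
    show "inj_on (\<lambda>x. plane.reg (first x)) ?I"
    proof (rule inj_onI)
      fix x y assume x: "x \<in> ?I" "y \<in> ?I" "plane.reg (first x) = plane.reg (first y)"
      obtain c i where xc: "x = (c, i)" by (cases x)
      obtain c' i' where yc: "y = (c', i')" by (cases y)
      have c: "c < 4" "0 \<le> i" "i < int ?k" "c' < 4" "0 \<le> i'" "i' < int ?k" using x xc yc by auto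
      let ?S = "{P.place (c, i, 0), P.place (c, i, 1), P.place (c, i, 2), P.place (c, i, 3), P.place (c, i, 4)}"
      have "first y \<in> ?S"
      proof (rule plane.reg_eq_next[OF first_D[OF x(1)] first_D[OF x(2)] x(3)])
        show "first x \<in> ?S" by (simp add: first_def xc)
        fix d assume "d \<in> ?S"
        then show "nd d \<in> ?S" using P.place_next[OF c(2,3,1)] by auto
      qed
      then obtain m where m: "m \<in> {0, 1, 2, 3, 4}" "P.place (c', i', 0) = P.place (c, i, m)" by (auto simp: first_def yc)
      have "(c', i', 0) \<in> P.model" "(c, i, m) \<in> P.model" using c m(1) by (auto simp: P.model_def)
      then have "(c', i', 0) = (c, i, m)" using m(2) P.place_bij by (meson bij_betw_def inj_onD)
      then show "x = y" using xc yc by simp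
    qed
    show "(\<lambda>x. plane.reg (first x)) ` ?I = regions V E"
    proof
      show "(\<lambda>x. plane.reg (first x)) ` ?I \<subseteq> regions V E" using plane.reg(1) first_D by blast
      show "regions V E \<subseteq> (\<lambda>x. plane.reg (first x)) ` ?I"
      proof
        fix r assume r: "r \<in> regions V E"
        have d: "plane.FL r ! 0 \<in> D" "plane.reg (plane.FL r ! 0) = r"
          by (rule plane.FL_nth_dart[OF r], simp, rule plane.reg_nth[OF r], simp)
        obtain p where p: "p \<in> P.model" "plane.FL r ! 0 = P.place p" by (rule P.place_surjE[OF d(1)])
        obtain c i m where pc: "p = (c, i, m)" by (cases p)
        have c: "c < 4" "0 \<le> i" "i < int ?k" "m < 5" using p(1) pc by (auto simp: P.model_def)
        have M: "P.place (c, i, j) \<in> D" if "j < 5" for j using that c by (intro P.place_D) (simp add: P.model_def)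
        have M': "P.place (c, i, 0) \<in> D" "P.place (c, i, 1) \<in> D" "P.place (c, i, 2) \<in> D" "P.place (c, i, 3) \<in> D"
          by (rule M; simp)+
        have n: "nd (P.place (c, i, 0)) = P.place (c, i, 1)" "nd (P.place (c, i, 1)) = P.place (c, i, 2)"
            "nd (P.place (c, i, 2)) = P.place (c, i, 3)" "nd (P.place (c, i, 3)) = P.place (c, i, 4)"
          using P.place_next[OF c(2,3,1)] by blast+
        have R: "plane.reg (P.place (c, i, 1)) = plane.reg (P.place (c, i, 0))"
            "plane.reg (P.place (c, i, 2)) = plane.reg (P.place (c, i, 1))"
            "plane.reg (P.place (c, i, 3)) = plane.reg (P.place (c, i, 2))"
            "plane.reg (P.place (c, i, 4)) = plane.reg (P.place (c, i, 3))"
          using plane.reg_next[OF M'(1)] plane.reg_next[OF M'(2)] plane.reg_next[OF M'(3)] plane.reg_next[OF M'(4)]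
          by (simp_all only: n)
        have "m \<in> {0, 1, 2, 3, 4}" using c(4) by auto
        then have "plane.reg (P.place (c, i, m)) = plane.reg (P.place (c, i, 0))"
          by (elim insertE emptyE) (simp_all only: R)
        moreover have "r = plane.reg (P.place (c, i, m))" using d(2) unfolding p(2) pc by (rule sym)
        ultimately have "r = plane.reg (first (c, i))" unfolding first_def prod.case by (rule trans[rotated])
        moreover have "(c, i) \<in> ?I" using c by simp
        ultimately show "r \<in> (\<lambda>x. plane.reg (first x)) ` ?I" by (rule image_eqI)
      qed
    qed
  qed
  define \<psi> where "\<psi> l = plane.reg (first (inv_into ?I P.pentagon l))" for l
  have inv: "inv_into ?I P.pentagon (P.pentagon x) = x" if "x \<in> ?I" for x
    by (rule inv_into_f_f[OF P.pentagon_inj that])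
  have psi_bij: "bij_betw \<psi> (earth_pentagons ?k) (regions V E)"
  proof -
    have "bij_betw P.pentagon ?I (earth_pentagons ?k)" unfolding bij_betw_def P.earth_pentagons_eq using P.pentagon_inj by simp
    from bij_betw_trans[OF bij_betw_inv_into[OF this] reg_bij] show ?thesis unfolding \<psi>_def comp_def .
  qed
  have bc: "boundary_cycle V E (\<psi> l) (map \<phi> l)" if l: "l \<in> earth_pentagons ?k" for l
  proof -
    obtain x where x: "x \<in> ?I" "l = P.pentagon x" using l unfolding P.earth_pentagons_eq by blast
    obtain c i where xc: "x = (c, i)" by (cases x)
    have c: "c < 4" "0 \<le> i" "i < int ?k" using x(1) xc by auto
    have psi: "\<psi> l = plane.reg (P.place (c, i, 0))" using inv[OF x(1)] by (simp add: \<psi>_def x(2) first_def xc)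
    have phi: "\<phi> (P.dart_vertex (c, i, m)) = g (od (P.place (c, i, m)))" if "m < 5" for m
      unfolding \<phi>_def by (subst P.position_dart_vertex) (use that c in \<open>simp_all add: P.model_def\<close>)
    let ?v = "\<lambda>m. \<phi> (P.dart_vertex (c, i, m))"
    have pl: "P.place (c, i, 0) \<in> D" using c by (intro P.place_D) (simp add: P.model_def)
    note ph = phi[of 0] phi[of 1] phi[of 2] phi[of 3] phi[of 4]
    obtain e0 e1 e2 e3 e4 where C: "edge_cycle (\<psi> l) (?v 0) (?v 1) (?v 2) (?v 3) (?v 4) e0 e1 e2 e3 e4"
      using edge_cycle_dart[OF pl] P.place_next[OF c(2,3,1)] ph unfolding psi by simp
    note R = edge_cycle_reverse[OF C]
    \<comment> \<open>The order for c = 2 runs backwards from dart 1: one reversal, which keeps dart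
      0 in front, and then four rotations.\<close>
    note R4 = edge_cycle_rotate[OF edge_cycle_rotate[OF edge_cycle_rotate[OF edge_cycle_rotate[OF R]]]]
    note B = boundary_cycle5[OF C] boundary_cycle5[OF R] and B2 = boundary_cycle5[OF R4]
    have ml: "map \<phi> l = map ?v (P.pentagon_order c)" by (simp add: x(2) xc P.pentagon_def)
    consider "c < 2" | "c = 2" | "c = 3" using c(1) by linarith
    then show ?thesis
    proof cases
      case 1
      then have "P.pentagon_order c = [0, 1, 2, 3, 4]" by (simp add: P.pentagon_order_def)
      then show ?thesis unfolding ml using B(1) by simp
    next
      case 2
      then have "P.pentagon_order c = [1, 0, 4, 3, 2]" by (simp add: P.pentagon_order_def)
      then show ?thesis unfolding ml using B2 by simp
    next
      case 3
      then have "P.pentagon_order c = [0, 4, 3, 2, 1]" by (simp add: P.pentagon_order_def)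
      then show ?thesis unfolding ml using B(2) by simp
    qed
  qed
  show ?thesis unfolding earth_map_tiling_def
    using tiling \<nu>(2) phi_bij edges_bij psi_bij bc by (intro conjI exI[of _ \<phi>] exI[of _ \<psi>]) auto
qed

end

text \<open>Both tilings carry labels from the same abstract earth map, so undoing one labelling and
  applying the other matches vertices and tiles.\<close>

lemma earth_map_tilings_isomorphic:
  assumes "earth_map_tiling k V E" "earth_map_tiling k V' E'"
  shows "tiling_isomorphic V E V' E'"
proof -
  from assms(1) obtain \<phi> \<psi> where A: "pentagonal_tiling V E" "bij_betw \<phi> (earth_vertices k) V"
    "bij_betw (\<lambda>e. e \<inter> V) E ((\<lambda>d. \<phi> ` d) ` earth_edges k)" "bij_betw \<psi> (earth_pentagons k) (regions V E)"
    "\<And>p. p \<in> earth_pentagons k \<Longrightarrow> boundary_cycle V E (\<psi> p) (map \<phi> p)" unfolding earth_map_tiling_def by blast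
  from assms(2) obtain \<phi>' \<psi>' where B: "pentagonal_tiling V' E'" "bij_betw \<phi>' (earth_vertices k) V'"
    "bij_betw (\<lambda>e. e \<inter> V') E' ((\<lambda>d. \<phi>' ` d) ` earth_edges k)" "bij_betw \<psi>' (earth_pentagons k) (regions V' E')"
    "\<And>p. p \<in> earth_pentagons k \<Longrightarrow> boundary_cycle V' E' (\<psi>' p) (map \<phi>' p)" unfolding earth_map_tiling_def by blast
  have "V \<noteq> {}" "V' \<noteq> {}" using A(2) B(2) unfolding earth_vertices_def by (auto simp: bij_betw_def)
  then have t: "pent_tiling V E" "pent_tiling V' E'" using A(1) B(1) by (unfold_locales; simp)+
  have earth_sub: "d \<subseteq> earth_vertices k" if "d \<in> earth_edges k" for d
    using that by (auto simp: earth_edges_def earth_vertices_def Let_def)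
  define FV where "FV = \<phi>' \<circ> inv_into (earth_vertices k) \<phi>"
  define R where "R d = \<phi>' ` (inv_into (earth_vertices k) \<phi> ` d)" for d
  \<comment> \<open>An edge of a realisation is determined by its pair of ends, so the map on edges
    is forced by the map on vertices.\<close>
  define FE where "FE = inv_into E' (\<lambda>e. e \<inter> V') \<circ> (\<lambda>e. FV ` (e \<inter> V))"
  define FR where "FR = \<psi>' \<circ> inv_into (earth_pentagons k) \<psi>"
  have inv: "inv_into (earth_vertices k) \<phi> (\<phi> x) = x" if "x \<in> earth_vertices k" for x
    using A(2) that by (simp add: bij_betw_def)
  have FV\<phi>: "FV (\<phi> x) = \<phi>' x" if "x \<in> earth_vertices k" for x using inv[OF that] by (simp add: FV_def)
  have FV: "bij_betw FV V V'" unfolding FV_def by (rule bij_betw_trans[OF bij_betw_inv_into[OF A(2)] B(2)])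
  have FR: "bij_betw FR (regions V E) (regions V' E')" unfolding FR_def by (rule bij_betw_trans[OF bij_betw_inv_into[OF A(4)] B(4)])
  have FV_edge: "FV ` \<phi> ` d = \<phi>' ` d" if "d \<in> earth_edges k" for d
    unfolding image_image by (rule image_cong[OF refl]) (use FV\<phi> earth_sub[OF that] in blast)
  have mid: "bij_betw (\<lambda>A. FV ` A) ((\<lambda>d. \<phi> ` d) ` earth_edges k) ((\<lambda>d. \<phi>' ` d) ` earth_edges k)"
    unfolding bij_betw_def
  proof
    show "inj_on (\<lambda>A. FV ` A) ((\<lambda>d. \<phi> ` d) ` earth_edges k)"
    proof (rule inj_onI)
      fix a b assume ab: "a \<in> (\<lambda>d. \<phi> ` d) ` earth_edges k" "b \<in> (\<lambda>d. \<phi> ` d) ` earth_edges k" "FV ` a = FV ` b"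
      then obtain d d' where "d \<in> earth_edges k" "a = \<phi> ` d" "d' \<in> earth_edges k" "b = \<phi> ` d'" by blast
      then have "a \<subseteq> \<phi> ` earth_vertices k" "b \<subseteq> \<phi> ` earth_vertices k" using earth_sub by (simp_all add: image_mono)
      then have "a \<subseteq> V" "b \<subseteq> V" using A(2) by (simp_all add: bij_betw_def)
      then show "a = b" using inj_on_image_eq_iff[of FV V a b] FV ab(3) by (simp add: bij_betw_def)
    qed
    show "(\<lambda>A. FV ` A) ` (\<lambda>d. \<phi> ` d) ` earth_edges k = (\<lambda>d. \<phi>' ` d) ` earth_edges k"
      unfolding image_image[of "\<lambda>A. FV ` A"] by (rule image_cong[OF refl]) (rule FV_edge)
  qed
  have FE: "bij_betw FE E E'"
    using bij_betw_trans[OF bij_betw_trans[OF A(3) mid] bij_betw_inv_into[OF B(3)]] unfolding FE_def comp_def .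
  have edge: "FE e \<inter> V' = FV ` (e \<inter> V)" if e: "e \<in> E" for e
  proof -
    have "e \<inter> V \<in> (\<lambda>d. \<phi> ` d) ` earth_edges k"
      unfolding bij_betw_imp_surj_on[OF A(3), symmetric] using e by (rule imageI)
    then have "FV ` (e \<inter> V) \<in> (\<lambda>A. FV ` A) ` (\<lambda>d. \<phi> ` d) ` earth_edges k" by (rule imageI)
    then have "FV ` (e \<inter> V) \<in> (\<lambda>e. e \<inter> V') ` E'"
      unfolding bij_betw_imp_surj_on[OF mid] bij_betw_imp_surj_on[OF B(3)] .
    from f_inv_into_f[OF this] show ?thesis by (simp add: FE_def)
  qed
  have bnd: "\<exists>F\<subseteq>E. closure r - r = \<Union>F \<and> closure (FR r) - FR r = \<Union>(FE ` F)" if r: "r \<in> regions V E" for r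
  proof -
    obtain p where p: "p \<in> earth_pentagons k" "r = \<psi> p" using r A(4) by (auto simp: bij_betw_def)
    have FRr: "FR r = \<psi>' p" using A(4) p by (simp add: FR_def bij_betw_def)
    have pv: "set p \<subseteq> earth_vertices k" "length p = 5"
      using p(1) by (auto simp: earth_pentagons_def earth_vertices_def Let_def)
    from A(5)[OF p(1)] obtain es where es: "length es = 5" "set es \<subseteq> E" "closure r - r = \<Union>(set es)"
      "\<And>i. i < 5 \<Longrightarrow> es ! i \<inter> V = {\<phi> (p ! i), \<phi> (p ! ((i + 1) mod 5))}"
      unfolding boundary_cycle_def p(2) using pv(2) by auto
    from B(5)[OF p(1)] obtain es' where es': "length es' = 5" "set es' \<subseteq> E'" "closure (FR r) - FR r = \<Union>(set es')"
      "\<And>i. i < 5 \<Longrightarrow> es' ! i \<inter> V' = {\<phi>' (p ! i), \<phi>' (p ! ((i + 1) mod 5))}"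
      unfolding boundary_cycle_def FRr using pv(2) by auto
    \<comment> \<open>Both lists of edges follow the same pentagon \<open>p\<close>, so edges at
      equal places have corresponding ends and hence correspond.\<close>
    have "es' ! i = FE (es ! i)" if i: "i < 5" for i
    proof -
      have e: "es ! i \<in> E" "es' ! i \<in> E'" using es(1,2) es'(1,2) i nth_mem by (metis subsetD)+
      have "p ! i \<in> earth_vertices k" "p ! ((i + 1) mod 5) \<in> earth_vertices k"
        using pv i nth_mem[of i p] nth_mem[of "(i + 1) mod 5" p] by auto
      then have "FV ` (es ! i \<inter> V) = es' ! i \<inter> V'" unfolding es(4)[OF i] es'(4)[OF i] by (simp add: FV\<phi>)
      then have "FE (es ! i) \<inter> V' = es' ! i \<inter> V'" using edge[OF e(1)] by simp
      moreover have "FE (es ! i) \<in> E'" using FE e(1) by (auto simp: bij_betw_def)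
      ultimately show ?thesis using B(3) e(2) by (auto simp: bij_betw_def dest: inj_onD)
    qed
    then have "es' = map FE es" using es(1) es'(1) by (intro nth_equalityI) simp_all
    then have "closure (FR r) - FR r = \<Union>(FE ` set es)" using es'(3) by simp
    then show ?thesis using es(2,3) by blast
  qed
  show ?thesis by (rule combinatorially_isomorphic_tilings[OF t FV FE FR edge bnd])
qed

theorem theorem4:
  fixes V :: "(real^3) set" and E :: "(real^3) set set" and \<nu> :: "real^3"
  assumes "pentagonal_tiling V E"
    and "\<nu> \<in> V"
    and "vertex_degree E \<nu> > 3"
    and "\<And>v. v \<in> V \<Longrightarrow> v \<noteq> \<nu> \<Longrightarrow> graph_dist V E \<nu> v \<le> 4 \<Longrightarrow> vertex_degree E v = 3"
  shows "\<exists>k\<ge>4. (\<exists>V' E'. earth_map_tiling k V' E') \<and>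
           (\<forall>V' E'. earth_map_tiling k V' E' \<longrightarrow> tiling_isomorphic V E V' E')"
proof -
  interpret pent_tiling V E using assms(1,2) by unfold_locales auto
  obtain w f g where "sphere_tiling V E w f g" using sphere_tiling_exists by blast
  then have e: "earth_map_tiling (vertex_degree E \<nu>) V E"
    using assms(2-4) by (rule sphere_tiling.is_earth_map_tiling)
  show ?thesis
  proof (intro exI[of _ "vertex_degree E \<nu>"] conjI allI impI)
    show "4 \<le> vertex_degree E \<nu>" using assms(3) by simp
    \<comment> \<open>The given tiling is itself a realisation, so the isomorphism claim is not
      vacuous.\<close>
    show "\<exists>V' E'. earth_map_tiling (vertex_degree E \<nu>) V' E'" using e by blast
    show "tiling_isomorphic V E V' E'" if "earth_map_tiling (vertex_degree E \<nu>) V' E'" for V' E'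
      by (rule earth_map_tilings_isomorphic[OF e that])
  qed
qed

end
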